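(* Let $(R,\mathfrak m)$ be a Gorenstein local ring of dimension one, and let $I$ be an $\mathfrak m$-primary trace ideal of $R$. Then $r_R(I)=1+r(R/I)$ and $r(R\ltimes I)=2+r(R/I)$.
   Context: All rings are commutative. For a ring $R$ and an $R$-module $M$, the idealization $R\ltimes M$ is the ring with additive group $R\oplus M$ and multiplication $(a,x)(b,y)=(ab,ay+bx)$. If $(R,\mathfrak m)$ is a Cohen-Macaulay (Noetherian) local ring of dimension $d$ and $M$ is a finitely generated $R$-module with $\operatorname{depth}_RM=d$, then $R\ltimes M$ is a Cohen-Macaulay local ring of dimension $d$ with maximal ideal $\mathfrak m\times M$. The Cohen-Macaulay type of such an $M$ is $r_R(M)=\ell_R(\operatorname{Ext}^d_R(R/\mathfrak m,M))$, where $\ell_R$ denotes length, and $r(R)=r_R(R)$; for the Artinian ring $R/I$, $r(R/I)$ is the length of its socle. An ideal $I$ of $R$ is a trace ideal if, for some $R$-module $M$, $I$ is the image of the map $\operatorname{Hom}_R(M,R)\otimes_RM\to R$, $f\otimes x\mapsto f(x)$. *)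

theory Defs
  imports
    "HOL-Algebra.Module"
    "HOL-Algebra.QuotRing"
    "HOL-Algebra.Ring_Divisibility"
    "HOL-Library.Extended_Nat"
    "HOL-Library.FuncSet"
begin

text \<open>
  A module record extends a ring record, but the locale \<^locale>\<open>module\<close> ignores the fields
  \<^const>\<open>mult\<close> and \<^const>\<open>one\<close>; they are left \<^const>\<open>undefined\<close> below wherever
  there is no natural choice.
\<close>

section \<open>Modules\<close>

definition regular_module :: "('a, 'b) ring_scheme \<Rightarrow> ('a, 'a) module" where
  "regular_module R =
    \<lparr>carrier = carrier R, mult = mult R, one = one R, zero = zero R, add = add R,
     smult = mult R\<rparr>"

definition ideal_module :: "('a, 'b) ring_scheme \<Rightarrow> 'a set \<Rightarrow> ('a, 'a) module" where
  "ideal_module R I = (regular_module R)\<lparr>carrier := I\<rparr>"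

text \<open>The free module of rank \<open>n\<close>: vectors indexed by \<open>{..<n}\<close>, padded with zeros.\<close>

definition free_module :: "('a, 'b) ring_scheme \<Rightarrow> nat \<Rightarrow> ('a, nat \<Rightarrow> 'a) module" where
  "free_module R n =
    \<lparr>carrier = {v. (\<forall>i<n. v i \<in> carrier R) \<and> (\<forall>i\<ge>n. v i = \<zero>\<^bsub>R\<^esub>)},
     mult = undefined, one = undefined,
     zero = (\<lambda>i. \<zero>\<^bsub>R\<^esub>), add = (\<lambda>v w i. v i \<oplus>\<^bsub>R\<^esub> w i),
     smult = (\<lambda>a v i. a \<otimes>\<^bsub>R\<^esub> v i)\<rparr>"

definition quotient_module ::
    "('a, 'b) ring_scheme \<Rightarrow> ('a, 'm) module \<Rightarrow> 'm set \<Rightarrow> ('a, 'm set) module" where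
  "quotient_module R M N =
    \<lparr>carrier = a_rcosets\<^bsub>M\<^esub> N, mult = undefined, one = undefined,
     zero = N, add = set_add M,
     smult = (\<lambda>a X. \<Union>x\<in>X. N +>\<^bsub>M\<^esub> (a \<odot>\<^bsub>M\<^esub> x))\<rparr>"

definition is_module_hom ::
    "('a, 'b) ring_scheme \<Rightarrow> ('a, 'm) module \<Rightarrow> ('a, 'n) module \<Rightarrow> ('m \<Rightarrow> 'n) \<Rightarrow> bool" where
  "is_module_hom R M N f \<longleftrightarrow>
    f \<in> carrier M \<rightarrow> carrier N \<and>
    (\<forall>x\<in>carrier M. \<forall>y\<in>carrier M. f (x \<oplus>\<^bsub>M\<^esub> y) = f x \<oplus>\<^bsub>N\<^esub> f y) \<and>
    (\<forall>a\<in>carrier R. \<forall>x\<in>carrier M. f (a \<odot>\<^bsub>M\<^esub> x) = a \<odot>\<^bsub>N\<^esub> f x)"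

definition module_kernel :: "('a, 'm) module \<Rightarrow> ('a, 'n) module \<Rightarrow> ('m \<Rightarrow> 'n) \<Rightarrow> 'm set" where
  "module_kernel M N f = {x \<in> carrier M. f x = \<zero>\<^bsub>N\<^esub>}"

text \<open>The module of homomorphisms; maps are \<^const>\<open>extensional\<close> so that equality of elements
  is equality of maps on the carrier.\<close>

definition hom_module ::
    "('a, 'b) ring_scheme \<Rightarrow> ('a, 'm) module \<Rightarrow> ('a, 'n) module \<Rightarrow> ('a, 'm \<Rightarrow> 'n) module" where
  "hom_module R M N =
    \<lparr>carrier = {f \<in> extensional (carrier M). is_module_hom R M N f},
     mult = undefined, one = undefined,
     zero = (\<lambda>x\<in>carrier M. \<zero>\<^bsub>N\<^esub>),
     add = (\<lambda>f g. \<lambda>x\<in>carrier M. f x \<oplus>\<^bsub>N\<^esub> g x),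
     smult = (\<lambda>a f. \<lambda>x\<in>carrier M. a \<odot>\<^bsub>N\<^esub> f x)\<rparr>"

text \<open>Length: the supremum of the lengths of strictly increasing chains of submodules.\<close>

definition module_length :: "('a, 'b) ring_scheme \<Rightarrow> ('a, 'm) module \<Rightarrow> enat" where
  "module_length R M =
    Sup {enat n | n. \<exists>N :: nat \<Rightarrow> 'm set.
      (\<forall>i\<le>n. submodule (N i) R M) \<and> (\<forall>i<n. N i \<subset> N (Suc i))}"

section \<open>Ext\<close>

text \<open>
  \<open>F\<^sub>i\<close> is free of rank \<open>b i\<close>, and
  \<open>\<dots> \<rightarrow> F\<^sub>2 \<rightarrow> F\<^sub>1 \<rightarrow> F\<^sub>0 \<rightarrow> N \<rightarrow> 0\<close> is exact, with maps
  \<open>d i : F\<^sub>i\<^sub>+\<^sub>1 \<rightarrow> F\<^sub>i\<close> and \<open>e : F\<^sub>0 \<rightarrow> N\<close>.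
\<close>

definition free_resolution ::
    "('a, 'b) ring_scheme \<Rightarrow> ('a, 'n) module \<Rightarrow>
     (nat \<Rightarrow> nat) \<Rightarrow> (nat \<Rightarrow> (nat \<Rightarrow> 'a) \<Rightarrow> (nat \<Rightarrow> 'a)) \<Rightarrow> ((nat \<Rightarrow> 'a) \<Rightarrow> 'n) \<Rightarrow> bool" where
  "free_resolution R N b d e \<longleftrightarrow>
    is_module_hom R (free_module R (b 0)) N e \<and>
    e ` carrier (free_module R (b 0)) = carrier N \<and>
    (\<forall>i. is_module_hom R (free_module R (b (Suc i))) (free_module R (b i)) (d i)) \<and>
    d 0 ` carrier (free_module R (b 1)) = module_kernel (free_module R (b 0)) N e \<and>
    (\<forall>i. d (Suc i) ` carrier (free_module R (b (Suc (Suc i)))) =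
         module_kernel (free_module R (b (Suc i))) (free_module R (b i)) (d i))"

definition cocycles ::
    "('a, 'b) ring_scheme \<Rightarrow> (nat \<Rightarrow> nat) \<Rightarrow> (nat \<Rightarrow> (nat \<Rightarrow> 'a) \<Rightarrow> (nat \<Rightarrow> 'a)) \<Rightarrow>
     ('a, 'm) module \<Rightarrow> nat \<Rightarrow> ((nat \<Rightarrow> 'a) \<Rightarrow> 'm) set" where
  "cocycles R b d M i =
    {f \<in> carrier (hom_module R (free_module R (b i)) M).
       \<forall>x\<in>carrier (free_module R (b (Suc i))). f (d i x) = \<zero>\<^bsub>M\<^esub>}"

fun coboundaries ::
    "('a, 'b) ring_scheme \<Rightarrow> (nat \<Rightarrow> nat) \<Rightarrow> (nat \<Rightarrow> (nat \<Rightarrow> 'a) \<Rightarrow> (nat \<Rightarrow> 'a)) \<Rightarrow>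
     ('a, 'm) module \<Rightarrow> nat \<Rightarrow> ((nat \<Rightarrow> 'a) \<Rightarrow> 'm) set" where
  "coboundaries R b d M 0 = {\<zero>\<^bsub>hom_module R (free_module R (b 0)) M\<^esub>}"
| "coboundaries R b d M (Suc i) =
    (\<lambda>g. compose (carrier (free_module R (b (Suc i)))) g (d i)) `
      carrier (hom_module R (free_module R (b i)) M)"

text \<open>
  \<open>Ext\<^sup>i\<^sub>R(N, M)\<close>, the cohomology of \<open>Hom\<^sub>R(F, M)\<close>, for a chosen
  resolution \<open>F\<close> of \<open>N\<close> by free modules of finite rank. Such resolutions exist when \<open>R\<close> is
  Noetherian and \<open>N\<close> is finitely generated, which is the only case in which the definition is
  meant to be used; as always, a different choice gives an isomorphic module.
\<close>

definition Ext ::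
    "('a, 'b) ring_scheme \<Rightarrow> ('a, 'n) module \<Rightarrow> ('a, 'm) module \<Rightarrow> nat \<Rightarrow>
     ('a, ((nat \<Rightarrow> 'a) \<Rightarrow> 'm) set) module" where
  "Ext R N M i =
    (let (b, d, e) = (SOME (b, d, e). free_resolution R N b d e) in
     quotient_module R
       ((hom_module R (free_module R (b i)) M)\<lparr>carrier := cocycles R b d M i\<rparr>)
       (coboundaries R b d M i))"

section \<open>Injective dimension\<close>

text \<open>
  HOL cannot quantify over modules of all types inside a definition, so the modules \<open>A\<close>, \<open>B\<close>
  below are drawn from the type of the free modules of finite rank. This includes copies of
  \<open>R\<close> and of its ideals, so by Baer's criterion there is no loss of generality.
\<close>

definition injective_module :: "('a, 'b) ring_scheme \<Rightarrow> ('a, 'e) module \<Rightarrow> bool" where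
  "injective_module R E \<longleftrightarrow>
    module R E \<and>
    (\<forall>(A :: ('a, nat \<Rightarrow> 'a) module) (B :: ('a, nat \<Rightarrow> 'a) module) f g.
       module R A \<and> module R B \<and>
       is_module_hom R A B f \<and> inj_on f (carrier A) \<and> is_module_hom R A E g \<longrightarrow>
       (\<exists>h. is_module_hom R B E h \<and> (\<forall>x\<in>carrier A. h (f x) = g x)))"

text \<open>\<open>0 \<rightarrow> M \<rightarrow> E 0 \<rightarrow> E 1 \<rightarrow> \<dots>\<close> exact, with maps \<open>e : M \<rightarrow> E 0\<close> and
  \<open>d i : E i \<rightarrow> E (i + 1)\<close>.\<close>

definition injective_resolution ::
    "('a, 'b) ring_scheme \<Rightarrow> ('a, 'm) module \<Rightarrow>
     (nat \<Rightarrow> ('a, 'e) module) \<Rightarrow> (nat \<Rightarrow> 'e \<Rightarrow> 'e) \<Rightarrow> ('m \<Rightarrow> 'e) \<Rightarrow> bool" where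
  "injective_resolution R M E d e \<longleftrightarrow>
    (\<forall>i. injective_module R (E i)) \<and>
    is_module_hom R M (E 0) e \<and> inj_on e (carrier M) \<and>
    (\<forall>i. is_module_hom R (E i) (E (Suc i)) (d i)) \<and>
    e ` carrier M = module_kernel (E 0) (E 1) (d 0) \<and>
    (\<forall>i. d i ` carrier (E i) = module_kernel (E (Suc i)) (E (Suc (Suc i))) (d (Suc i)))"

text \<open>
  The type argument is the type in which the injective modules live. A theorem assuming this
  with a type variable \<open>'e\<close> covers all injective resolutions, since \<open>'e\<close> is universally
  quantified in the theorem. The type argument of \<open>trace_ideal\<close> below has the same purpose.
\<close>

definition finite_injective_dimension ::
    "'e itself \<Rightarrow> ('a, 'b) ring_scheme \<Rightarrow> ('a, 'm) module \<Rightarrow> bool" where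
  "finite_injective_dimension T R M \<longleftrightarrow>
    (\<exists>(E :: nat \<Rightarrow> ('a, 'e) module) d e n.
       injective_resolution R M E d e \<and> (\<forall>i>n. carrier (E i) = {\<zero>\<^bsub>E i\<^esub>}))"

section \<open>Local rings\<close>

definition local_ring :: "('a, 'b) ring_scheme \<Rightarrow> bool" where
  "local_ring R \<longleftrightarrow> cring R \<and> (\<exists>!m. maximalideal m R)"

definition max_ideal :: "('a, 'b) ring_scheme \<Rightarrow> 'a set" where
  "max_ideal R = (THE m. maximalideal m R)"

definition residue_field :: "('a, 'b) ring_scheme \<Rightarrow> ('a, 'a set) module" where
  "residue_field R = quotient_module R (regular_module R) (max_ideal R)"

definition krull_dim :: "('a, 'b) ring_scheme \<Rightarrow> enat" where
  "krull_dim R =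
    Sup {enat n | n. \<exists>P :: nat \<Rightarrow> 'a set.
      (\<forall>i\<le>n. primeideal (P i) R) \<and> (\<forall>i<n. P i \<subset> P (Suc i))}"

definition gorenstein_local_ring :: "'e itself \<Rightarrow> ('a, 'b) ring_scheme \<Rightarrow> bool" where
  "gorenstein_local_ring T R \<longleftrightarrow>
    noetherian_ring R \<and> local_ring R \<and> finite_injective_dimension T R (regular_module R)"

text \<open>
  \<open>r\<^sub>R(M)\<close> and \<open>r(R)\<close>, for \<open>R\<close> Noetherian local; \<^const>\<open>krull_dim\<close> is then finite, so
  \<^const>\<open>the_enat\<close> is harmless.
\<close>

definition module_type :: "('a, 'b) ring_scheme \<Rightarrow> ('a, 'm) module \<Rightarrow> enat" where
  "module_type R M = module_length R (Ext R (residue_field R) M (the_enat (krull_dim R)))"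

definition ring_type :: "('a, 'b) ring_scheme \<Rightarrow> enat" where
  "ring_type R = module_type R (regular_module R)"

text \<open>For an Artinian local ring \<open>A\<close> with maximal ideal \<open>\<nn>\<close>, the type \<open>r(A)\<close> is the
  length of the socle \<open>(0 : \<nn>)\<close>.\<close>

definition socle :: "('a, 'b) ring_scheme \<Rightarrow> 'a set" where
  "socle A = {x \<in> carrier A. \<forall>a\<in>max_ideal A. a \<otimes>\<^bsub>A\<^esub> x = \<zero>\<^bsub>A\<^esub>}"

definition artinian_ring_type :: "('a, 'b) ring_scheme \<Rightarrow> enat" where
  "artinian_ring_type A = module_length A (ideal_module A (socle A))"

section \<open>Ideals and idealization\<close>

definition ideal_radical :: "('a, 'b) ring_scheme \<Rightarrow> 'a set \<Rightarrow> 'a set" where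
  "ideal_radical R I = {x \<in> carrier R. \<exists>n::nat. x [^]\<^bsub>R\<^esub> n \<in> I}"

definition primary_ideal :: "('a, 'b) ring_scheme \<Rightarrow> 'a set \<Rightarrow> bool" where
  "primary_ideal R I \<longleftrightarrow>
    ideal I R \<and> I \<noteq> carrier R \<and>
    (\<forall>a\<in>carrier R. \<forall>b\<in>carrier R.
       a \<otimes>\<^bsub>R\<^esub> b \<in> I \<longrightarrow> a \<in> I \<or> (\<exists>n::nat. b [^]\<^bsub>R\<^esub> n \<in> I))"

definition primary_to :: "('a, 'b) ring_scheme \<Rightarrow> 'a set \<Rightarrow> 'a set \<Rightarrow> bool" where
  "primary_to R P I \<longleftrightarrow> primary_ideal R I \<and> ideal_radical R I = P"

text \<open>The image of \<open>Hom\<^sub>R(M, R) \<otimes>\<^sub>R M \<rightarrow> R\<close>: elements of the tensor product are finite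
  sums of pure tensors.\<close>

definition trace :: "('a, 'b) ring_scheme \<Rightarrow> ('a, 'm) module \<Rightarrow> 'a set" where
  "trace R M =
    {(\<Oplus>\<^bsub>R\<^esub>i\<in>{..<n}. f i (x i)) | (n::nat) f x.
       \<forall>i<n. is_module_hom R M (regular_module R) (f i) \<and> x i \<in> carrier M}"

definition trace_ideal :: "'m itself \<Rightarrow> ('a, 'b) ring_scheme \<Rightarrow> 'a set \<Rightarrow> bool" where
  "trace_ideal T R I \<longleftrightarrow> (\<exists>M :: ('a, 'm) module. module R M \<and> I = trace R M)"

definition idealization ::
    "('a, 'b) ring_scheme \<Rightarrow> ('a, 'm) module \<Rightarrow> ('a \<times> 'm) ring" (infixl \<open>\<ltimes>\<close> 70) where
  "R \<ltimes> M =
    \<lparr>carrier = carrier R \<times> carrier M,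
     mult = (\<lambda>(a, x) (b, y). (a \<otimes>\<^bsub>R\<^esub> b, a \<odot>\<^bsub>M\<^esub> y \<oplus>\<^bsub>M\<^esub> b \<odot>\<^bsub>M\<^esub> x)),
     one = (\<one>\<^bsub>R\<^esub>, \<zero>\<^bsub>M\<^esub>),
     zero = (\<zero>\<^bsub>R\<^esub>, \<zero>\<^bsub>M\<^esub>),
     add = (\<lambda>(a, x) (b, y). (a \<oplus>\<^bsub>R\<^esub> b, x \<oplus>\<^bsub>M\<^esub> y))\<rparr>"

end

theory Submission
  imports Defs
begin

text \<open>
  Let \<open>x\<close> be a regular element in the maximal ideal \<open>\<mm>\<close>. For a module \<open>M\<close> on which \<open>x\<close> is regular, the
  first Ext module of the residue field with values in \<open>M\<close> is the socle of \<open>M/xM\<close>, so every type in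
  question is the length of an interval of submodules.

  In a finite injective resolution of \<open>R\<close>, injectivity of a cosyzygy \<open>E/C\<close> passes down to \<open>C\<close>: by
  Noetherian induction only maps from primes \<open>P\<close> need to be extended to \<open>C\<close>. For \<open>P \<noteq> \<mm>\<close> the
  obstruction module is divisible by an element of \<open>\<mm>\<close> outside \<open>P\<close>, and by dimension shifting it is a
  finitely generated Ext module with values in \<open>R\<close>, so that it vanishes by Nakayama's lemma; for
  \<open>P = \<mm>\<close> one uses a socle element of \<open>R\<close> or of \<open>R/(x)\<close>. If the socle of \<open>R\<close> were nonzero, the descent
  would reach \<open>R\<close> itself and force dimension zero; hence a regular element exists, the descent reaches
  the first cosyzygy, and this gives annihilator duality in \<open>R/(x)\<close>.

  Since \<open>I\<close> is a trace ideal, \<open>sI \<subseteq> (x)\<close> implies \<open>sI \<subseteq> xI\<close>, that is, \<open>R : I = I : I =: B\<close>. Taking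
  \<open>x \<in> I\<close>, the submodule \<open>T/xI\<close> given by the socle of \<open>I/xI\<close> meets \<open>(x)/xI\<close> in a copy of the
  socle of \<open>R/I\<close>, and the quotient is contained in the socle of \<open>R/(x)\<close>, which is simple; it is nonzero
  because \<open>1 \<notin> \<mm>B\<close> and \<open>I = R : B\<close>. For the idealization the corresponding socle is an extension of
  the socle of \<open>R/(x)\<close> by \<open>T/xI\<close>.
\<close>

section \<open>Chains and lengths\<close>

text \<open>The given injective resolution is arbitrary: it may fail to be minimal, and its terms
  are injective only against modules over one type. The descent therefore carries
  \<open>principally_injective\<close>, a condition on elements that suffices both for the
  Noetherian induction and for the final duality. The prime \<mm> escapes the divisibility argument
  because no element of \<mm> lies outside it. Its replacement combines a socle element modulo x
  with a division property: if x v lies in the cosyzygy C, then x v = x w for some w in C. In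
  positive degree this comes from divisibility of the preceding injective module; in degree zero,
  where C is a copy of R, it fails for a regular x in \<mm> but is trivial for x = 0. Hence the
  descent is run twice, with x = 0 and with a regular x, and the second run stops at the first
  cosyzygy.

  Lengths are suprema of chains in \<open>enat\<close>. Two tools suffice: strictly monotone maps
  between families of submodules compare lengths, and one simple step on top of an interval adds
  one. Neither presupposes finite length.\<close>

definition chain_length :: "'x set set \<Rightarrow> enat" where
  "chain_length \<A> =
    Sup {enat n | n. \<exists>N :: nat \<Rightarrow> 'x set. (\<forall>i\<le>n. N i \<in> \<A>) \<and> (\<forall>i<n. N i \<subset> N (Suc i))}"

lemma module_length_chain: "module_length R M = chain_length {N. submodule N R M}"
  by (simp add: module_length_def chain_length_def)

lemma krull_dim_chain: "krull_dim R = chain_length {P. primeideal P R}"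
  by (simp add: krull_dim_def chain_length_def)

lemma chain_length_upper:
  assumes "\<And>i. i \<le> n \<Longrightarrow> N i \<in> \<A>" "\<And>i. i < n \<Longrightarrow> N i \<subset> N (Suc i)"
  shows "enat n \<le> chain_length \<A>"
  unfolding chain_length_def by (rule Sup_upper) (use assms in blast)

lemma chain_length_least:
  assumes "\<And>n N. \<lbrakk>\<And>i. i \<le> n \<Longrightarrow> N i \<in> \<A>; \<And>i. i < n \<Longrightarrow> N i \<subset> N (Suc i)\<rbrakk> \<Longrightarrow> enat n \<le> l"
  shows "chain_length \<A> \<le> l"
  unfolding chain_length_def by (rule Sup_least) (use assms in blast)

text \<open>Two such maps in opposite directions give equality of lengths; strictness in both
  directions takes the place of a bijection.\<close>

lemma chain_length_mono_map:
  assumes "\<And>N. N \<in> \<A> \<Longrightarrow> F N \<in> \<B>"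
    and "\<And>N N'. \<lbrakk>N \<in> \<A>; N' \<in> \<A>; N \<subset> N'\<rbrakk> \<Longrightarrow> F N \<subset> F N'"
  shows "chain_length \<A> \<le> chain_length \<B>"
proof (rule chain_length_least)
  fix n and N :: "nat \<Rightarrow> _"
  assume "\<And>i. i \<le> n \<Longrightarrow> N i \<in> \<A>" "\<And>i. i < n \<Longrightarrow> N i \<subset> N (Suc i)"
  then show "enat n \<le> chain_length \<B>"
    by (intro chain_length_upper[where N = "\<lambda>i. F (N i)"] assms) (simp_all add: Suc_leI)
qed

lemma chain_mono:
  fixes N :: "nat \<Rightarrow> 'x set"
  assumes "\<And>i. i < n \<Longrightarrow> N i \<subset> N (Suc i)" "i \<le> j" "j \<le> n"
  shows "N i \<subseteq> N j"
  using assms(2,3)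
proof (induction j)
  case (Suc j)
  then show ?case using assms(1)[of j] by (cases "i = Suc j") auto
qed simp

text \<open>Intersecting with B costs a chain at most one link: members inside B are unchanged, and
  from the first member outside B on, the modular condition keeps the intersections strictly
  increasing. Conversely, C can be put on top of a chain below B.\<close>

lemma chain_length_Suc:
  assumes top: "C \<in> \<A>" "\<And>N. N \<in> \<A> \<Longrightarrow> N \<subseteq> C"
    and B: "B \<subset> C"
    and inter: "\<And>N. N \<in> \<A> \<Longrightarrow> N \<inter> B \<in> \<A>"
    and modular: "\<And>N N'. \<lbrakk>N \<in> \<A>; N' \<in> \<A>; N \<subset> N'; \<not> N \<subseteq> B\<rbrakk> \<Longrightarrow> N \<inter> B \<subset> N' \<inter> B"
  shows "chain_length \<A> = 1 + chain_length {N \<in> \<A>. N \<subseteq> B}" (is "_ = 1 + chain_length ?\<B>")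
proof (rule antisym)
  have B_in: "B \<in> \<A>" using inter[OF top(1)] B by (simp add: inf_absorb2 psubset_imp_subset)
  show "chain_length \<A> \<le> 1 + chain_length ?\<B>"
  proof (rule chain_length_least)
    fix n and N :: "nat \<Rightarrow> _"
    assume N: "\<And>i. i \<le> n \<Longrightarrow> N i \<in> \<A>" and strict: "\<And>i. i < n \<Longrightarrow> N i \<subset> N (Suc i)"
    show "enat n \<le> 1 + chain_length ?\<B>"
    proof (cases "N n \<subseteq> B")
      case True
      then have "N i \<subseteq> B" if "i \<le> n" for i using chain_mono[of n N, OF strict that] by auto
      then have "enat n \<le> chain_length ?\<B>" using N strict by (intro chain_length_upper[where N = N]) blast+
      then show ?thesis using order_trans[OF _ add_increasing] by fastforce
    next
      case False
      define j where "j = (LEAST j. \<not> N j \<subseteq> B)"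
      have j: "\<not> N j \<subseteq> B" "\<And>i. i < j \<Longrightarrow> N i \<subseteq> B"
        unfolding j_def using LeastI[of "\<lambda>j. \<not> N j \<subseteq> B", OF False] not_less_Least by blast+
      have "j \<le> n" unfolding j_def by (rule Least_le) (rule False)
      show ?thesis
      proof (cases n)
        case (Suc k)
        \<comment> \<open>The first member outside B is skipped, since \<open>N j \<inter> B\<close>
          may equal the member before it. This is the link that is lost.\<close>
        define N' where "N' i = (if i < j then N i else N (Suc i) \<inter> B)" for i
        have big: "\<not> N i \<subseteq> B" if "j \<le> i" "i \<le> n" for i
          using j(1) chain_mono[of n N, OF strict that] by auto
        have step: "N i \<inter> B \<subset> N (Suc i) \<inter> B" if "j \<le> i" "i < n" for i
          using modular[of "N i" "N (Suc i)"] N strict big that by auto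
        have "enat k \<le> chain_length ?\<B>"
        proof (rule chain_length_upper[where N = N'])
          fix i assume "i \<le> k"
          then show "N' i \<in> ?\<B>" using N inter j(2) Suc by (auto simp: N'_def)
        next
          fix i assume i: "i < k"
          show "N' i \<subset> N' (Suc i)"
          proof (cases "Suc i < j")
            case True then show ?thesis using strict i Suc by (simp add: N'_def)
          next
            case False
            show ?thesis
            proof (cases "i < j")
              case True
              then have "Suc i = j" using False by simp
              then have "N i \<subseteq> N j \<inter> B" using strict[of i] j(2)[of i] i Suc by auto
              also have "\<dots> \<subset> N (Suc j) \<inter> B" using step[of j] \<open>Suc i = j\<close> i Suc by simp
              finally show ?thesis using True \<open>Suc i = j\<close> by (simp add: N'_def)
            next
              case False
              then show ?thesis using step[of "Suc i"] i Suc by (simp add: N'_def)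
            qed
          qed
        qed
        then have "1 + enat k \<le> 1 + chain_length ?\<B>" by (rule add_left_mono)
        then show ?thesis using Suc by (simp add: one_enat_def)
      qed (simp add: zero_enat_def[symmetric])
    qed
  qed
  show "1 + chain_length ?\<B> \<le> chain_length \<A>"
  proof -
    have *: "1 + enat n \<le> chain_length \<A>"
      if N: "\<forall>i\<le>n. N i \<in> ?\<B>" and strict: "\<forall>i<n. N i \<subset> N (Suc i)" for n and N :: "nat \<Rightarrow> _"
    proof -
      have "enat (Suc n) \<le> chain_length \<A>"
      proof (rule chain_length_upper[where N = "\<lambda>i. if i \<le> n then N i else C"])
        fix i assume "i < Suc n"
        then show "(if i \<le> n then N i else C) \<subset> (if Suc i \<le> n then N (Suc i) else C)"
          using N strict B by (cases "Suc i \<le> n") (auto simp: not_le less_Suc_eq dest!: spec[of _ n])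
      qed (use N top in auto)
      then show ?thesis by (simp add: one_enat_def)
    qed
    show ?thesis
    proof (cases "chain_length \<A>")
      case (enat k)
      have "1 \<le> chain_length \<A>"
        using *[of 0 "\<lambda>_. B"] B_in by (simp add: zero_enat_def[symmetric])
      then have "1 \<le> k" using enat by (simp add: one_enat_def)
      \<comment> \<open>The summand 1 is moved across the supremum by subtraction, which is harmless
        because the finite value k is at least 1.\<close>
      have "chain_length ?\<B> \<le> enat (k - 1)"
      proof (rule chain_length_least)
        fix n and N :: "nat \<Rightarrow> _"
        assume "\<And>i. i \<le> n \<Longrightarrow> N i \<in> ?\<B>" "\<And>i. i < n \<Longrightarrow> N i \<subset> N (Suc i)"
        then have "1 + enat n \<le> enat k" using *[of n N] enat by simp
        then show "enat n \<le> enat (k - 1)" by (simp add: one_enat_def)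
      qed
      then have "1 + chain_length ?\<B> \<le> 1 + enat (k - 1)" by (rule add_left_mono)
      then show ?thesis using enat \<open>1 \<le> k\<close> by (simp add: one_enat_def)
    qed simp
  qed
qed

section \<open>Modules\<close>

text \<open>Negatives are multiples by -1, so closure under them comes from closure under
  scalars.\<close>

lemma (in module) submoduleI':
  assumes "H \<subseteq> carrier M" "\<zero>\<^bsub>M\<^esub> \<in> H"
    and "\<And>a b. \<lbrakk>a \<in> H; b \<in> H\<rbrakk> \<Longrightarrow> a \<oplus>\<^bsub>M\<^esub> b \<in> H"
    and smult: "\<And>a x. \<lbrakk>a \<in> carrier R; x \<in> H\<rbrakk> \<Longrightarrow> a \<odot>\<^bsub>M\<^esub> x \<in> H"
  shows "submodule H R M"
proof (rule submoduleI[OF assms(1,2) _ assms(3) smult])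
  fix a assume "a \<in> H"
  then show "\<ominus>\<^bsub>M\<^esub> a \<in> H"
    using smult[of "\<ominus> \<one>" a] assms(1) by (auto simp: smult_l_minus)
qed

lemma (in module) submoduleD:
  assumes "submodule H R M"
  shows "H \<subseteq> carrier M" "\<zero>\<^bsub>M\<^esub> \<in> H"
    and "\<And>a b. \<lbrakk>a \<in> H; b \<in> H\<rbrakk> \<Longrightarrow> a \<oplus>\<^bsub>M\<^esub> b \<in> H"
    and "\<And>a b. \<lbrakk>a \<in> H; b \<in> H\<rbrakk> \<Longrightarrow> a \<ominus>\<^bsub>M\<^esub> b \<in> H"
    and "\<And>a x. \<lbrakk>a \<in> carrier R; x \<in> H\<rbrakk> \<Longrightarrow> a \<odot>\<^bsub>M\<^esub> x \<in> H"
  using submoduleE[OF assms] subgroup.one_closed[OF submodule.axioms(1)[OF assms]]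
  by (auto simp: a_minus_def)

lemma (in module) minus_smult_r:
  "\<lbrakk>a \<in> carrier R; x \<in> carrier M; y \<in> carrier M\<rbrakk> \<Longrightarrow>
    a \<odot>\<^bsub>M\<^esub> (x \<ominus>\<^bsub>M\<^esub> y) = a \<odot>\<^bsub>M\<^esub> x \<ominus>\<^bsub>M\<^esub> a \<odot>\<^bsub>M\<^esub> y"
  by (simp add: a_minus_def smult_r_distr smult_r_minus)

lemma (in module) minus_smult_l:
  "\<lbrakk>a \<in> carrier R; b \<in> carrier R; x \<in> carrier M\<rbrakk> \<Longrightarrow>
    (a \<ominus> b) \<odot>\<^bsub>M\<^esub> x = a \<odot>\<^bsub>M\<^esub> x \<ominus>\<^bsub>M\<^esub> b \<odot>\<^bsub>M\<^esub> x"
  by (simp add: a_minus_def smult_l_distr smult_l_minus)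

lemma (in module) smult_left_commute:
  "\<lbrakk>a \<in> carrier R; b \<in> carrier R; x \<in> carrier M\<rbrakk> \<Longrightarrow>
    a \<odot>\<^bsub>M\<^esub> (b \<odot>\<^bsub>M\<^esub> x) = b \<odot>\<^bsub>M\<^esub> (a \<odot>\<^bsub>M\<^esub> x)"
  by (metis R.m_comm smult_assoc1)

lemma (in abelian_group) minus_cancel: "\<lbrakk>x \<in> carrier G; y \<in> carrier G\<rbrakk> \<Longrightarrow> x \<ominus> y \<oplus> y = x"
  by (simp add: a_minus_def a_assoc l_neg)

lemma (in abelian_group) add_minus_cancel:
  "\<lbrakk>x \<in> carrier G; y \<in> carrier G\<rbrakk> \<Longrightarrow> x \<oplus> y \<ominus> y = x"
  by (simp add: a_minus_def a_assoc r_neg)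

lemma (in abelian_group) add_minus_cancel_left:
  "\<lbrakk>x \<in> carrier G; y \<in> carrier G\<rbrakk> \<Longrightarrow> x \<oplus> y \<ominus> x = y"
  by (metis a_comm add_minus_cancel)

lemma (in abelian_group) minus_zero_right: "x \<in> carrier G \<Longrightarrow> x \<ominus> \<zero> = x"
  by (simp add: a_minus_def)

lemma (in abelian_group) minus_eq_zero_iff:
  "\<lbrakk>x \<in> carrier G; y \<in> carrier G\<rbrakk> \<Longrightarrow> x \<ominus> y = \<zero> \<longleftrightarrow> x = y"
proof
  assume *: "x \<in> carrier G" "y \<in> carrier G" and "x \<ominus> y = \<zero>"
  have "x = x \<ominus> y \<oplus> y" using * by (rule minus_cancel[symmetric])
  also have "\<dots> = y" using * \<open>x \<ominus> y = \<zero>\<close> by simp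
  finally show "x = y" .
qed (simp add: a_minus_def r_neg)

lemma is_module_homI:
  assumes "\<And>x. x \<in> carrier M \<Longrightarrow> f x \<in> carrier N"
    and "\<And>x y. \<lbrakk>x \<in> carrier M; y \<in> carrier M\<rbrakk> \<Longrightarrow> f (x \<oplus>\<^bsub>M\<^esub> y) = f x \<oplus>\<^bsub>N\<^esub> f y"
    and "\<And>a x. \<lbrakk>a \<in> carrier R; x \<in> carrier M\<rbrakk> \<Longrightarrow> f (a \<odot>\<^bsub>M\<^esub> x) = a \<odot>\<^bsub>N\<^esub> f x"
  shows "is_module_hom R M N f"
  using assms by (simp add: is_module_hom_def)

lemma is_module_homD:
  assumes "is_module_hom R M N f"
  shows "\<And>x. x \<in> carrier M \<Longrightarrow> f x \<in> carrier N"
    and "\<And>x y. \<lbrakk>x \<in> carrier M; y \<in> carrier M\<rbrakk> \<Longrightarrow> f (x \<oplus>\<^bsub>M\<^esub> y) = f x \<oplus>\<^bsub>N\<^esub> f y"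
    and "\<And>a x. \<lbrakk>a \<in> carrier R; x \<in> carrier M\<rbrakk> \<Longrightarrow> f (a \<odot>\<^bsub>M\<^esub> x) = a \<odot>\<^bsub>N\<^esub> f x"
  using assms by (auto simp: is_module_hom_def)

text \<open>\<open>is_module_hom\<close> mentions only sums and multiples; zero and negatives are
  reached through the scalars 0 and -1.\<close>

lemma is_module_hom_zero_minus:
  assumes M: "module R M" and N: "module R N" and f: "is_module_hom R M N f"
  shows "f \<zero>\<^bsub>M\<^esub> = \<zero>\<^bsub>N\<^esub>"
    and "\<lbrakk>x \<in> carrier M; y \<in> carrier M\<rbrakk> \<Longrightarrow> f (x \<ominus>\<^bsub>M\<^esub> y) = f x \<ominus>\<^bsub>N\<^esub> f y"
proof -
  interpret M: module R M by (rule M)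
  interpret N: module R N by (rule N)
  note D = is_module_homD[OF f]
  show "f \<zero>\<^bsub>M\<^esub> = \<zero>\<^bsub>N\<^esub>"
    using D(3)[of "\<zero>\<^bsub>R\<^esub>" "\<zero>\<^bsub>M\<^esub>"] D(1)[of "\<zero>\<^bsub>M\<^esub>"] by simp
  assume xy: "x \<in> carrier M" "y \<in> carrier M"
  have "f (\<ominus>\<^bsub>M\<^esub> y) = \<ominus>\<^bsub>N\<^esub> f y"
    using D(3)[of "\<ominus>\<^bsub>R\<^esub> \<one>\<^bsub>R\<^esub>" y] D(1) xy by (simp add: M.smult_l_minus N.smult_l_minus)
  then show "f (x \<ominus>\<^bsub>M\<^esub> y) = f x \<ominus>\<^bsub>N\<^esub> f y"
    using D(2)[of x "\<ominus>\<^bsub>M\<^esub> y"] xy by (simp add: a_minus_def)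
qed

lemma is_module_hom_compose:
  "\<lbrakk>is_module_hom R M N f; is_module_hom R N P g\<rbrakk> \<Longrightarrow> is_module_hom R M P (\<lambda>x. g (f x))"
  by (auto simp: is_module_hom_def Pi_iff)

lemma is_module_hom_minus:
  assumes "module R N" "is_module_hom R M N f" "is_module_hom R M N g"
  shows "is_module_hom R M N (\<lambda>x. f x \<ominus>\<^bsub>N\<^esub> g x)"
proof -
  interpret N: module R N by fact
  note f = is_module_homD[OF assms(2)] and g = is_module_homD[OF assms(3)]
  show ?thesis
  proof (rule is_module_homI)
    fix x y assume "x \<in> carrier M" "y \<in> carrier M"
    then show "f (x \<oplus>\<^bsub>M\<^esub> y) \<ominus>\<^bsub>N\<^esub> g (x \<oplus>\<^bsub>M\<^esub> y) = (f x \<ominus>\<^bsub>N\<^esub> g x) \<oplus>\<^bsub>N\<^esub> (f y \<ominus>\<^bsub>N\<^esub> g y)"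
      using f g by (simp add: a_minus_def N.minus_add N.smult_r_distr N.a_ac)
  qed (use f g in \<open>auto simp: N.minus_smult_r\<close>)
qed

lemma is_module_hom_add:
  assumes "module R N" "is_module_hom R M N f" "is_module_hom R M N g"
  shows "is_module_hom R M N (\<lambda>x. f x \<oplus>\<^bsub>N\<^esub> g x)"
proof -
  interpret N: module R N by fact
  note f = is_module_homD[OF assms(2)] and g = is_module_homD[OF assms(3)]
  show ?thesis
    by (rule is_module_homI) (use f g in \<open>auto simp: N.smult_r_distr N.a_ac\<close>)
qed

lemma is_module_hom_smult:
  assumes "module R N" "is_module_hom R M N f" "c \<in> carrier R"
  shows "is_module_hom R M N (\<lambda>x. c \<odot>\<^bsub>N\<^esub> f x)"
proof -
  interpret N: module R N by fact
  note f = is_module_homD[OF assms(2)]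
  show ?thesis
    by (rule is_module_homI) (use f assms(3) in \<open>auto simp: N.smult_r_distr N.smult_left_commute\<close>)
qed

text \<open>The axioms are equations, and negatives are multiples by \<open>-1\<close>.\<close>

lemma module_image:
  assumes P: "module R P" and onto: "f ` carrier P = carrier Q"
    and add: "\<And>x y. \<lbrakk>x \<in> carrier P; y \<in> carrier P\<rbrakk> \<Longrightarrow> f (x \<oplus>\<^bsub>P\<^esub> y) = f x \<oplus>\<^bsub>Q\<^esub> f y"
    and smult: "\<And>a x. \<lbrakk>a \<in> carrier R; x \<in> carrier P\<rbrakk> \<Longrightarrow> f (a \<odot>\<^bsub>P\<^esub> x) = a \<odot>\<^bsub>Q\<^esub> f x"
    and zero: "f \<zero>\<^bsub>P\<^esub> = \<zero>\<^bsub>Q\<^esub>"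
  shows "module R Q"
proof -
  interpret P: module R P by (rule P)
  have cl: "f x \<in> carrier Q" if "x \<in> carrier P" for x using that onto by blast
  have ex: "\<exists>x\<in>carrier P. y = f x" if "y \<in> carrier Q" for y using that onto by blast
  show ?thesis
  proof (rule moduleI)
    show "abelian_group Q"
    proof (rule abelian_groupI)
      fix x assume "x \<in> carrier Q"
      then obtain x' where "x' \<in> carrier P" "x = f x'" using ex by blast
      then show "\<exists>y\<in>carrier Q. y \<oplus>\<^bsub>Q\<^esub> x = \<zero>\<^bsub>Q\<^esub>"
        by (intro bexI[of _ "f (\<ominus>\<^bsub>P\<^esub> x')"]) (auto simp: cl zero P.l_neg simp flip: add)
    next
      fix x y z assume "x \<in> carrier Q" "y \<in> carrier Q" "z \<in> carrier Q"
      then obtain x' y' z' where "x' \<in> carrier P" "x = f x'" "y' \<in> carrier P" "y = f y'"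
        "z' \<in> carrier P" "z = f z'" using ex by meson
      then show "x \<oplus>\<^bsub>Q\<^esub> y \<oplus>\<^bsub>Q\<^esub> z = x \<oplus>\<^bsub>Q\<^esub> (y \<oplus>\<^bsub>Q\<^esub> z)" "x \<oplus>\<^bsub>Q\<^esub> y \<in> carrier Q"
        "x \<oplus>\<^bsub>Q\<^esub> y = y \<oplus>\<^bsub>Q\<^esub> x" "\<zero>\<^bsub>Q\<^esub> \<oplus>\<^bsub>Q\<^esub> x = x"
        by (simp_all add: cl P.a_ac flip: add zero)
    qed (use cl zero P.zero_closed in metis)
  next
    have "(a \<oplus>\<^bsub>R\<^esub> b) \<odot>\<^bsub>Q\<^esub> x = a \<odot>\<^bsub>Q\<^esub> x \<oplus>\<^bsub>Q\<^esub> b \<odot>\<^bsub>Q\<^esub> x \<and>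
        a \<odot>\<^bsub>Q\<^esub> (x \<oplus>\<^bsub>Q\<^esub> y) = a \<odot>\<^bsub>Q\<^esub> x \<oplus>\<^bsub>Q\<^esub> a \<odot>\<^bsub>Q\<^esub> y \<and>
        (a \<otimes>\<^bsub>R\<^esub> b) \<odot>\<^bsub>Q\<^esub> x = a \<odot>\<^bsub>Q\<^esub> (b \<odot>\<^bsub>Q\<^esub> x) \<and>
        a \<odot>\<^bsub>Q\<^esub> x \<in> carrier Q \<and> \<one>\<^bsub>R\<^esub> \<odot>\<^bsub>Q\<^esub> x = x"
      if a: "a \<in> carrier R" "b \<in> carrier R" and "x \<in> carrier Q" "y \<in> carrier Q" for a b x y
    proof -
      obtain x' y' where "x' \<in> carrier P" "x = f x'" "y' \<in> carrier P" "y = f y'"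
        using ex \<open>x \<in> carrier Q\<close> \<open>y \<in> carrier Q\<close> by meson
      with a show ?thesis
        by (simp add: cl P.smult_l_distr P.smult_r_distr P.smult_assoc1 flip: add smult)
    qed
    then show "\<And>a x. a \<in> carrier R \<Longrightarrow> x \<in> carrier Q \<Longrightarrow> a \<odot>\<^bsub>Q\<^esub> x \<in> carrier Q"
      "\<And>a b x. a \<in> carrier R \<Longrightarrow> b \<in> carrier R \<Longrightarrow> x \<in> carrier Q \<Longrightarrow>
        (a \<oplus>\<^bsub>R\<^esub> b) \<odot>\<^bsub>Q\<^esub> x = a \<odot>\<^bsub>Q\<^esub> x \<oplus>\<^bsub>Q\<^esub> b \<odot>\<^bsub>Q\<^esub> x"
      "\<And>a x y. a \<in> carrier R \<Longrightarrow> x \<in> carrier Q \<Longrightarrow> y \<in> carrier Q \<Longrightarrow>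
        a \<odot>\<^bsub>Q\<^esub> (x \<oplus>\<^bsub>Q\<^esub> y) = a \<odot>\<^bsub>Q\<^esub> x \<oplus>\<^bsub>Q\<^esub> a \<odot>\<^bsub>Q\<^esub> y"
      "\<And>a b x. a \<in> carrier R \<Longrightarrow> b \<in> carrier R \<Longrightarrow> x \<in> carrier Q \<Longrightarrow>
        (a \<otimes>\<^bsub>R\<^esub> b) \<odot>\<^bsub>Q\<^esub> x = a \<odot>\<^bsub>Q\<^esub> (b \<odot>\<^bsub>Q\<^esub> x)"
      "\<And>x. x \<in> carrier Q \<Longrightarrow> \<one>\<^bsub>R\<^esub> \<odot>\<^bsub>Q\<^esub> x = x"
      using P.R.one_closed by blast+
  qed (rule P.is_cring)
qed

section \<open>Quotient modules\<close>

lemma quotient_module_simps: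
  fixes M :: "('a, 'm) module"
  assumes M: "module R M" and N: "submodule N R M"
  shows "carrier (quotient_module R M N) = (\<lambda>x. N +>\<^bsub>M\<^esub> x) ` carrier M"
    and "\<zero>\<^bsub>quotient_module R M N\<^esub> = N"
    and "\<lbrakk>x \<in> carrier M; y \<in> carrier M\<rbrakk> \<Longrightarrow>
      (N +>\<^bsub>M\<^esub> x) \<oplus>\<^bsub>quotient_module R M N\<^esub> (N +>\<^bsub>M\<^esub> y) = N +>\<^bsub>M\<^esub> (x \<oplus>\<^bsub>M\<^esub> y)"
    and "\<lbrakk>a \<in> carrier R; x \<in> carrier M\<rbrakk> \<Longrightarrow>
      a \<odot>\<^bsub>quotient_module R M N\<^esub> (N +>\<^bsub>M\<^esub> x) = N +>\<^bsub>M\<^esub> (a \<odot>\<^bsub>M\<^esub> x)"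
    and "\<lbrakk>x \<in> carrier M; y \<in> carrier M\<rbrakk> \<Longrightarrow> N +>\<^bsub>M\<^esub> x = N +>\<^bsub>M\<^esub> y \<longleftrightarrow> x \<ominus>\<^bsub>M\<^esub> y \<in> N"
proof -
  interpret module R M by (rule M)
  interpret N: abelian_subgroup N M
    by (rule abelian_subgroupI3)
      (use N in \<open>auto simp: submodule_def additive_subgroup_def M.abelian_group_axioms\<close>)
  note D = submoduleD[OF N]
  show "carrier (quotient_module R M N) = (\<lambda>x. N +>\<^bsub>M\<^esub> x) ` carrier M"
    by (auto simp: quotient_module_def A_RCOSETS_def')
  show "\<zero>\<^bsub>quotient_module R M N\<^esub> = N" by (simp add: quotient_module_def)
  show "(N +>\<^bsub>M\<^esub> x) \<oplus>\<^bsub>quotient_module R M N\<^esub> (N +>\<^bsub>M\<^esub> y) = N +>\<^bsub>M\<^esub> (x \<oplus>\<^bsub>M\<^esub> y)"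
    if "x \<in> carrier M" "y \<in> carrier M"
    using that by (simp add: quotient_module_def N.a_rcos_sum)
  show eq: "N +>\<^bsub>M\<^esub> x = N +>\<^bsub>M\<^esub> y \<longleftrightarrow> x \<ominus>\<^bsub>M\<^esub> y \<in> N" if "x \<in> carrier M" "y \<in> carrier M" for x y
    using that N.a_rcos_module[of y x] N.a_repr_independence'[of x y] N.a_rcos_self[of x]
    by (auto simp: a_minus_def)
  show "a \<odot>\<^bsub>quotient_module R M N\<^esub> (N +>\<^bsub>M\<^esub> x) = N +>\<^bsub>M\<^esub> (a \<odot>\<^bsub>M\<^esub> x)"
    if a: "a \<in> carrier R" and x: "x \<in> carrier M"
  proof -
    \<comment> \<open>All representatives of a coset contribute the same set, so the union in the
      scalar action of \<open>quotient_module\<close> collapses to one coset.\<close>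
    have "N +>\<^bsub>M\<^esub> (a \<odot>\<^bsub>M\<^esub> y) = N +>\<^bsub>M\<^esub> (a \<odot>\<^bsub>M\<^esub> x)" if "y \<in> N +>\<^bsub>M\<^esub> x" for y
    proof -
      have y: "y \<in> carrier M" using N.a_elemrcos_carrier[OF x that] .
      have "y \<ominus>\<^bsub>M\<^esub> x \<in> N" using N.a_rcos_module[OF x y] that by (simp add: a_minus_def)
      then have "a \<odot>\<^bsub>M\<^esub> y \<ominus>\<^bsub>M\<^esub> a \<odot>\<^bsub>M\<^esub> x \<in> N"
        using D(5)[OF a] minus_smult_r[OF a y x] by metis
      then show ?thesis using eq[of "a \<odot>\<^bsub>M\<^esub> y" "a \<odot>\<^bsub>M\<^esub> x"] a x y by blast
    qed
    then have "(\<Union>y\<in>N +>\<^bsub>M\<^esub> x. N +>\<^bsub>M\<^esub> (a \<odot>\<^bsub>M\<^esub> y)) = N +>\<^bsub>M\<^esub> (a \<odot>\<^bsub>M\<^esub> x)"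
      using N.a_rcos_self[OF x] by blast
    then show ?thesis by (simp add: quotient_module_def)
  qed
qed

lemma quotient_module_module:
  fixes M :: "('a, 'm) module"
  assumes M: "module R M" and N: "submodule N R M"
  shows "module R (quotient_module R M N)"
    and "is_module_hom R M (quotient_module R M N) ((+>\<^bsub>M\<^esub>) N)"
proof -
  interpret module R M by (rule M)
  note Q = quotient_module_simps[OF M N] and D = submoduleD[OF N]
  have "N +>\<^bsub>M\<^esub> \<zero>\<^bsub>M\<^esub> = N" using D(1) by simp
  then show "module R (quotient_module R M N)"
    by (intro module_image[OF module_axioms, where f = "(+>\<^bsub>M\<^esub>) N"]) (simp_all add: Q)
  show "is_module_hom R M (quotient_module R M N) ((+>\<^bsub>M\<^esub>) N)"
    by (rule is_module_homI) (simp_all add: Q)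
qed

section \<open>The ring and its ideals as modules\<close>

lemma (in cring) regular_module_simps:
  "carrier (regular_module R) = carrier R" "\<zero>\<^bsub>regular_module R\<^esub> = \<zero>"
  "(\<oplus>\<^bsub>regular_module R\<^esub>) = (\<oplus>)" "(\<odot>\<^bsub>regular_module R\<^esub>) = (\<otimes>)"
  by (simp_all add: regular_module_def)

lemma (in cring) regular_module_module: "module R (regular_module R)"
  by (rule moduleI, rule is_cring, rule abelian_groupI)
    (auto simp: regular_module_simps l_distr r_distr m_assoc a_ac
      intro: bexI[of _ "\<ominus> _"] l_neg)

lemma (in cring) regular_module_minus:
  "\<lbrakk>a \<in> carrier R; b \<in> carrier R\<rbrakk> \<Longrightarrow> a \<ominus>\<^bsub>regular_module R\<^esub> b = a \<ominus> b"
  by (simp add: a_minus_def a_inv_def m_inv_def regular_module_def)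

lemma (in cring) submodule_regular_iff: "submodule J R (regular_module R) \<longleftrightarrow> ideal J R"
proof
  interpret M: module R "regular_module R" by (rule regular_module_module)
  assume "submodule J R (regular_module R)"
  note D = M.submoduleD[OF this, unfolded regular_module_simps]
  have neg: "\<ominus> a \<in> J" if "a \<in> J" for a
    using D(5)[of "\<ominus> \<one>" a] that D(1) by (auto simp: l_minus)
  have mult: "a \<otimes> x \<in> J" if "a \<in> J" "x \<in> carrier R" for a x
    using D(5)[OF that(2,1)] D(1) that m_comm by auto
  show "ideal J R"
    by (rule idealI[OF ring_axioms])
      (use D neg mult in \<open>auto intro!: add.subgroupI simp: subset_iff simp flip: a_inv_def\<close>)
next
  interpret M: module R "regular_module R" by (rule regular_module_module)
  assume "ideal J R"
  then interpret J: ideal J R .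
  show "submodule J R (regular_module R)"
    by (rule M.submoduleI') (auto simp: regular_module_simps J.I_l_closed)
qed

lemma (in cring) idealI':
  assumes "J \<subseteq> carrier R" "\<zero> \<in> J" "\<And>a b. \<lbrakk>a \<in> J; b \<in> J\<rbrakk> \<Longrightarrow> a \<oplus> b \<in> J"
    and "\<And>r a. \<lbrakk>r \<in> carrier R; a \<in> J\<rbrakk> \<Longrightarrow> r \<otimes> a \<in> J"
  shows "ideal J R"
  using assms module.submoduleI'[OF regular_module_module, of J]
  by (simp add: submodule_regular_iff regular_module_simps)

lemma (in cring) idealD:
  assumes "ideal J R"
  shows "J \<subseteq> carrier R" "\<zero> \<in> J" "\<And>a b. \<lbrakk>a \<in> J; b \<in> J\<rbrakk> \<Longrightarrow> a \<oplus> b \<in> J"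
    "\<And>a b. \<lbrakk>a \<in> J; b \<in> J\<rbrakk> \<Longrightarrow> a \<ominus> b \<in> J" "\<And>r a. \<lbrakk>r \<in> carrier R; a \<in> J\<rbrakk> \<Longrightarrow> r \<otimes> a \<in> J"
proof -
  interpret ideal J R by (rule assms)
  show "J \<subseteq> carrier R" "\<zero> \<in> J" "\<And>a b. \<lbrakk>a \<in> J; b \<in> J\<rbrakk> \<Longrightarrow> a \<oplus> b \<in> J"
    "\<And>a b. \<lbrakk>a \<in> J; b \<in> J\<rbrakk> \<Longrightarrow> a \<ominus> b \<in> J" "\<And>r a. \<lbrakk>r \<in> carrier R; a \<in> J\<rbrakk> \<Longrightarrow> r \<otimes> a \<in> J"
    by (auto simp: a_minus_def I_l_closed Icarr)
qed

lemma ideal_module_simps: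
  "carrier (ideal_module R J) = J" "\<zero>\<^bsub>ideal_module R J\<^esub> = \<zero>\<^bsub>R\<^esub>"
  "(\<oplus>\<^bsub>ideal_module R J\<^esub>) = (\<oplus>\<^bsub>R\<^esub>)" "(\<odot>\<^bsub>ideal_module R J\<^esub>) = (\<otimes>\<^bsub>R\<^esub>)"
  by (simp_all add: ideal_module_def regular_module_def)

lemma (in cring) ideal_module_module: "ideal J R \<Longrightarrow> module R (ideal_module R J)"
  using submodule.submodule_is_module[OF _ regular_module_module, of J]
  by (simp add: ideal_module_def submodule_regular_iff)

lemma (in cring) submodule_ideal_module_iff:
  assumes J: "ideal J R"
  shows "submodule N R (ideal_module R J) \<longleftrightarrow> ideal N R \<and> N \<subseteq> J"
proof -
  interpret M: module R "ideal_module R J" by (rule ideal_module_module[OF J])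
  show ?thesis
  proof
    assume "submodule N R (ideal_module R J)"
    note D = M.submoduleD[OF this, unfolded ideal_module_simps]
    show "ideal N R \<and> N \<subseteq> J" using D(1,2,3,5) idealD(1)[OF J] by (auto intro!: idealI')
  next
    assume *: "ideal N R \<and> N \<subseteq> J"
    then show "submodule N R (ideal_module R J)"
      using idealD(2,3,5)[of N] by (intro M.submoduleI') (simp_all add: ideal_module_simps)
  qed
qed

section \<open>Free modules\<close>

lemma free_module_simps:
  "v \<in> carrier (free_module R n) \<longleftrightarrow> (\<forall>i<n. v i \<in> carrier R) \<and> (\<forall>i\<ge>n. v i = \<zero>\<^bsub>R\<^esub>)"
  "\<zero>\<^bsub>free_module R n\<^esub> = (\<lambda>i. \<zero>\<^bsub>R\<^esub>)"
  "v \<oplus>\<^bsub>free_module R n\<^esub> w = (\<lambda>i. v i \<oplus>\<^bsub>R\<^esub> w i)"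
  "a \<odot>\<^bsub>free_module R n\<^esub> v = (\<lambda>i. a \<otimes>\<^bsub>R\<^esub> v i)"
  by (simp_all add: free_module_def)

lemma (in cring) free_module_closed: "v \<in> carrier (free_module R n) \<Longrightarrow> v i \<in> carrier R"
  by (cases "i < n") (auto simp: free_module_simps)

lemma (in cring) free_module_module: "module R (free_module R n)"
proof (rule moduleI[OF is_cring])
  have cl: "v i \<in> carrier R" if "v \<in> carrier (free_module R n)" for v i
    using that by (rule free_module_closed)
  show "abelian_group (free_module R n)"
  proof (rule abelian_groupI)
    fix x assume "x \<in> carrier (free_module R n)"
    then show "\<exists>y\<in>carrier (free_module R n). y \<oplus>\<^bsub>free_module R n\<^esub> x = \<zero>\<^bsub>free_module R n\<^esub>"
      using cl by (intro bexI[of _ "\<lambda>i. \<ominus> x i"]) (auto simp: free_module_simps l_neg)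
  next
    fix x y z assume "x \<in> carrier (free_module R n)" "y \<in> carrier (free_module R n)"
      "z \<in> carrier (free_module R n)"
    then have "x i \<in> carrier R" "y i \<in> carrier R" "z i \<in> carrier R" for i using cl by auto
    then show "x \<oplus>\<^bsub>free_module R n\<^esub> y \<oplus>\<^bsub>free_module R n\<^esub> z =
        x \<oplus>\<^bsub>free_module R n\<^esub> (y \<oplus>\<^bsub>free_module R n\<^esub> z)"
      "x \<oplus>\<^bsub>free_module R n\<^esub> y = y \<oplus>\<^bsub>free_module R n\<^esub> x"
      "\<zero>\<^bsub>free_module R n\<^esub> \<oplus>\<^bsub>free_module R n\<^esub> x = x"
      by (auto simp: free_module_simps a_ac)
  qed (auto simp: free_module_simps)
next
  fix a b x y assume "a \<in> carrier R" "b \<in> carrier R" "x \<in> carrier (free_module R n)"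
  moreover from this(3) have "x i \<in> carrier R" for i using free_module_closed by blast
  ultimately show "(a \<oplus> b) \<odot>\<^bsub>free_module R n\<^esub> x =
      a \<odot>\<^bsub>free_module R n\<^esub> x \<oplus>\<^bsub>free_module R n\<^esub> b \<odot>\<^bsub>free_module R n\<^esub> x"
    "(a \<otimes> b) \<odot>\<^bsub>free_module R n\<^esub> x = a \<odot>\<^bsub>free_module R n\<^esub> (b \<odot>\<^bsub>free_module R n\<^esub> x)"
    by (auto simp: free_module_simps l_distr m_assoc)
next
  fix a x y assume "a \<in> carrier R" "x \<in> carrier (free_module R n)" "y \<in> carrier (free_module R n)"
  moreover from this(2,3) have "x i \<in> carrier R" "y i \<in> carrier R" for i using free_module_closed by auto
  ultimately show "a \<odot>\<^bsub>free_module R n\<^esub> (x \<oplus>\<^bsub>free_module R n\<^esub> y) =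
      a \<odot>\<^bsub>free_module R n\<^esub> x \<oplus>\<^bsub>free_module R n\<^esub> a \<odot>\<^bsub>free_module R n\<^esub> y"
    by (auto simp: free_module_simps r_distr)
next
  fix x assume "x \<in> carrier (free_module R n)"
  moreover from this have "x i \<in> carrier R" for i using free_module_closed by auto
  ultimately show "\<one> \<odot>\<^bsub>free_module R n\<^esub> x = x" by (auto simp: free_module_simps)
qed (auto simp: free_module_simps)

definition unit_vector :: "('a, 'b) ring_scheme \<Rightarrow> nat \<Rightarrow> nat \<Rightarrow> 'a" where
  "unit_vector R j = (\<lambda>i. if i = j then \<one>\<^bsub>R\<^esub> else \<zero>\<^bsub>R\<^esub>)"

lemma (in cring) unit_vector_closed: "j < n \<Longrightarrow> unit_vector R j \<in> carrier (free_module R n)"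
  by (auto simp: unit_vector_def free_module_simps)

lemma (in cring) free_module_span:
  assumes L: "submodule L R (free_module R n)" and unit: "\<And>j. j < n \<Longrightarrow> unit_vector R j \<in> L"
  shows "L = carrier (free_module R n)"
proof
  interpret F: module R "free_module R n" by (rule free_module_module)
  note D = F.submoduleD[OF L]
  show "L \<subseteq> carrier (free_module R n)" by (rule D)
  show "carrier (free_module R n) \<subseteq> L"
  proof
    fix w assume w: "w \<in> carrier (free_module R n)"
    \<comment> \<open>Truncations of w are built up one coordinate at a time, each new coordinate
      adding a multiple of a unit vector.\<close>
    have "(\<lambda>i. if i < k then w i else \<zero>) \<in> L" if "k \<le> n" for k
      using that
    proof (induction k)
      case 0
      then show ?case using D(2) by (simp add: free_module_simps)
    next
      case (Suc k)
      have "(\<lambda>i. if i < Suc k then w i else \<zero>) =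
          (\<lambda>i. if i < k then w i else \<zero>) \<oplus>\<^bsub>free_module R n\<^esub> w k \<odot>\<^bsub>free_module R n\<^esub> unit_vector R k"
        using free_module_closed[OF w] by (auto simp: free_module_simps unit_vector_def less_Suc_eq)
      also have "\<dots> \<in> L"
        using Suc unit free_module_closed[OF w] D by auto
      finally show ?case .
    qed
    from this[of n] have "(\<lambda>i. if i < n then w i else \<zero>) \<in> L" by simp
    moreover have "(\<lambda>i. if i < n then w i else \<zero>) = w" using w by (auto simp: free_module_simps)
    ultimately show "w \<in> L" by simp
  qed
qed

section \<open>Submodules under homomorphisms\<close>

lemma submodule_vimage:
  assumes "module R M" "module R N" and f: "is_module_hom R M N f" and L: "submodule L R N"
  shows "submodule {x \<in> carrier M. f x \<in> L} R M"
proof -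
  interpret M: module R M by fact
  interpret N: module R N by fact
  note D = N.submoduleD[OF L] and F = is_module_homD[OF f]
  show ?thesis
    by (rule M.submoduleI') (use D F is_module_hom_zero_minus(1)[OF assms(1,2) f] in auto)
qed

lemma submodule_zero: "module R M \<Longrightarrow> submodule {\<zero>\<^bsub>M\<^esub>} R M"
proof -
  assume M: "module R M"
  then interpret M: module R M .
  show ?thesis by (rule M.submoduleI') auto
qed

lemma submodule_kernel:
  assumes "module R M" "module R N" "is_module_hom R M N f"
  shows "submodule (module_kernel M N f) R M"
  using submodule_vimage[OF assms submodule_zero[OF assms(2)]] by (simp add: module_kernel_def)

lemma submodule_image:
  assumes "module R M" "module R N" and f: "is_module_hom R M N f" and L: "submodule L R M"
  shows "submodule (f ` L) R N"
proof -
  interpret M: module R M by fact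
  interpret N: module R N by fact
  note D = M.submoduleD[OF L] and F = is_module_homD[OF f]
  have cl: "x \<in> carrier M" if "x \<in> L" for x using D(1) that by blast
  show ?thesis
  proof (rule N.submoduleI')
    show "f ` L \<subseteq> carrier N" using F(1) cl by blast
    show "\<zero>\<^bsub>N\<^esub> \<in> f ` L" using D(2) is_module_hom_zero_minus(1)[OF assms(1,2) f] by force
  next
    fix a b assume "a \<in> f ` L" "b \<in> f ` L"
    then obtain x y where "x \<in> L" "y \<in> L" "a = f x" "b = f y" by blast
    then have "a \<oplus>\<^bsub>N\<^esub> b = f (x \<oplus>\<^bsub>M\<^esub> y)" using F(2) cl by simp
    then show "a \<oplus>\<^bsub>N\<^esub> b \<in> f ` L" using D(3) \<open>x \<in> L\<close> \<open>y \<in> L\<close> by blast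
  next
    fix a b assume "a \<in> carrier R" "b \<in> f ` L"
    then obtain x where "x \<in> L" "b = f x" by blast
    then have "a \<odot>\<^bsub>N\<^esub> b = f (a \<odot>\<^bsub>M\<^esub> x)" using F(3) cl \<open>a \<in> carrier R\<close> by simp
    then show "a \<odot>\<^bsub>N\<^esub> b \<in> f ` L" using D(5) \<open>x \<in> L\<close> \<open>a \<in> carrier R\<close> by blast
  qed
qed

section \<open>Homomorphisms out of free modules\<close>

lemma (in cring) hom_free_in:
  assumes M: "module R M" and h: "is_module_hom R (free_module R n) M h"
    and L: "submodule L R M" and unit: "\<And>j. j < n \<Longrightarrow> h (unit_vector R j) \<in> L"
    and w: "w \<in> carrier (free_module R n)"
  shows "h w \<in> L"
  using free_module_span[OF submodule_vimage[OF free_module_module M h L]] unit unit_vector_closed w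
  by blast

lemma (in cring) hom_free_cong:
  assumes M: "module R M" and g: "is_module_hom R (free_module R n) M g"
    and h: "is_module_hom R (free_module R n) M h"
    and unit: "\<And>j. j < n \<Longrightarrow> g (unit_vector R j) = h (unit_vector R j)"
    and w: "w \<in> carrier (free_module R n)"
  shows "g w = h w"
proof -
  interpret M: module R M by (rule M)
  note gh = is_module_homD(1)[OF g] is_module_homD(1)[OF h]
  have "g w \<ominus>\<^bsub>M\<^esub> h w \<in> {\<zero>\<^bsub>M\<^esub>}"
    by (rule hom_free_in[OF M is_module_hom_minus[OF M g h] submodule_zero[OF M] _ w])
      (use gh unit unit_vector_closed in \<open>auto simp: M.minus_eq_zero_iff\<close>)
  then show ?thesis using gh w by (simp add: M.minus_eq_zero_iff)
qed

definition lincomb :: "('a, 'm) module \<Rightarrow> nat \<Rightarrow> (nat \<Rightarrow> 'm) \<Rightarrow> (nat \<Rightarrow> 'a) \<Rightarrow> 'm" where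
  "lincomb M n m w = (\<Oplus>\<^bsub>M\<^esub>i\<in>{..<n}. w i \<odot>\<^bsub>M\<^esub> m i)"

lemma (in cring) lincomb:
  assumes M: "module R M" and m: "\<And>i. i < n \<Longrightarrow> m i \<in> carrier M"
  shows "is_module_hom R (free_module R n) M (lincomb M n m)"
    and "j < n \<Longrightarrow> lincomb M n m (unit_vector R j) = m j"
proof -
  interpret M: module R M by (rule M)
  show "is_module_hom R (free_module R n) M (lincomb M n m)"
  proof (rule is_module_homI)
    fix x y assume xy: "x \<in> carrier (free_module R n)" "y \<in> carrier (free_module R n)"
    then have cl: "x i \<in> carrier R" "y i \<in> carrier R" for i by (auto intro: free_module_closed)
    show "lincomb M n m x \<in> carrier M" unfolding lincomb_def using cl m by (auto intro!: M.finsum_closed)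
    have "lincomb M n m (x \<oplus>\<^bsub>free_module R n\<^esub> y) =
        (\<Oplus>\<^bsub>M\<^esub>i\<in>{..<n}. x i \<odot>\<^bsub>M\<^esub> m i \<oplus>\<^bsub>M\<^esub> y i \<odot>\<^bsub>M\<^esub> m i)"
      unfolding lincomb_def using cl m
      by (intro M.finsum_cong') (auto simp: free_module_simps M.smult_l_distr)
    also have "\<dots> = lincomb M n m x \<oplus>\<^bsub>M\<^esub> lincomb M n m y"
      unfolding lincomb_def using cl m by (intro M.finsum_addf) auto
    finally show "lincomb M n m (x \<oplus>\<^bsub>free_module R n\<^esub> y) = lincomb M n m x \<oplus>\<^bsub>M\<^esub> lincomb M n m y" .
  next
    fix a x assume a: "a \<in> carrier R" and x: "x \<in> carrier (free_module R n)"
    then have cl: "x i \<in> carrier R" for i by (auto intro: free_module_closed)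
    have "lincomb M n m (a \<odot>\<^bsub>free_module R n\<^esub> x) = (\<Oplus>\<^bsub>M\<^esub>i\<in>{..<n}. a \<odot>\<^bsub>M\<^esub> (x i \<odot>\<^bsub>M\<^esub> m i))"
      unfolding lincomb_def using cl a m
      by (intro M.finsum_cong') (auto simp: free_module_simps M.smult_assoc1)
    also have "\<dots> = a \<odot>\<^bsub>M\<^esub> lincomb M n m x"
      unfolding lincomb_def using cl m a by (intro M.finsum_smult_ldistr[symmetric]) auto
    finally show "lincomb M n m (a \<odot>\<^bsub>free_module R n\<^esub> x) = a \<odot>\<^bsub>M\<^esub> lincomb M n m x" .
  qed
  assume j: "j < n"
  have "lincomb M n m (unit_vector R j) = (\<Oplus>\<^bsub>M\<^esub>i\<in>{..<n}. if j = i then m i else \<zero>\<^bsub>M\<^esub>)"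
    unfolding lincomb_def using m by (intro M.finsum_cong') (auto simp: unit_vector_def)
  also have "\<dots> = m j" using j m by (intro M.finsum_singleton) auto
  finally show "lincomb M n m (unit_vector R j) = m j" .
qed

text \<open>Projectivity of free modules: preimages under p are chosen on the unit vectors only. The
  condition compares the images of q and p inside Q, which suits maps onto a proper submodule such
  as a cosyzygy.\<close>

lemma (in cring) free_module_lift:
  assumes P: "module R P" and Q: "module R Q" and p: "is_module_hom R P Q p"
    and q: "is_module_hom R (free_module R n) Q q"
    and onto: "q ` carrier (free_module R n) \<subseteq> p ` carrier P"
  obtains h where "is_module_hom R (free_module R n) P h"
    "\<And>w. w \<in> carrier (free_module R n) \<Longrightarrow> p (h w) = q w"
proof -
  have "\<exists>m. m \<in> carrier P \<and> p m = q (unit_vector R i)" if "i < n" for i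
    using onto unit_vector_closed[OF that] by (metis image_iff subset_iff)
  then obtain m where m: "\<And>i. i < n \<Longrightarrow> m i \<in> carrier P"
    "\<And>i. i < n \<Longrightarrow> p (m i) = q (unit_vector R i)" by metis
  note l = lincomb[OF P m(1)]
  show thesis
  proof (rule that[OF l(1)])
    fix w assume w: "w \<in> carrier (free_module R n)"
    show "p (lincomb P n m w) = q w"
      by (rule hom_free_cong[OF Q is_module_hom_compose[OF l(1) p] q _ w]) (simp_all add: l(2) m)
  qed simp_all
qed

section \<open>Noetherian rings and modules\<close>

text \<open>Zorn's lemma applies because the union of a nonempty chain of ideals of a Noetherian
  ring is a member of the chain.\<close>

lemma (in noetherian_ring) exists_maximal_ideal_in:
  assumes "\<I> \<noteq> {}" "\<And>J. J \<in> \<I> \<Longrightarrow> ideal J R"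
  obtains M where "M \<in> \<I>" "\<And>J. \<lbrakk>J \<in> \<I>; M \<subseteq> J\<rbrakk> \<Longrightarrow> J = M"
proof -
  have "\<exists>M\<in>\<I>. \<forall>J\<in>\<I>. M \<subseteq> J \<longrightarrow> J = M"
  proof (rule subset_Zorn_nonempty[OF assms(1)])
    fix C assume C: "C \<noteq> {}" "subset.chain \<I> C"
    then have "subset.chain {J. ideal J R} C"
      using assms(2) by (auto simp: subset.chain_def)
    then have "\<Union>C \<in> C" using C(1) by (rule ideal_chain_is_trivial[rotated])
    then show "\<Union>C \<in> \<I>" using C(2) by (auto simp: subset.chain_def)
  qed
  then show thesis using that by blast
qed

text \<open>Generation is expressed through the submodules that contain S, so that no linear
  combinations have to be written down.\<close>

definition fin_gen :: "('a, 'b) ring_scheme \<Rightarrow> ('a, 'm) module \<Rightarrow> 'm set \<Rightarrow> bool" where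
  "fin_gen R M K \<longleftrightarrow>
    (\<exists>S. finite S \<and> S \<subseteq> K \<and> (\<forall>N. submodule N R M \<longrightarrow> S \<subseteq> N \<longrightarrow> K \<subseteq> N))"

lemma fin_gen_ideal:
  fixes R (structure)
  assumes "cring R" "noetherian_ring R" and J: "ideal J R"
  shows "fin_gen R (regular_module R) J"
proof -
  interpret cring R by fact
  interpret noetherian_ring R by fact
  from finetely_gen[OF J] obtain S where S: "S \<subseteq> carrier R" "finite S" "J = Idl S" by blast
  then have "S \<subseteq> J" using genideal_self by blast
  moreover have "J \<subseteq> N" if "submodule N R (regular_module R)" "S \<subseteq> N" for N
    using genideal_minimal[of N S] that S(3) by (simp add: submodule_regular_iff)
  ultimately show ?thesis using S(2) by (auto simp: fin_gen_def)
qed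

text \<open>Induction on the rank: the last coordinates of vectors in K form a finitely generated
  ideal, and the vectors with last coordinate zero form a submodule in smaller rank. Vectors lifting
  generators of the ideal, together with generators of that submodule, generate K.\<close>

lemma fin_gen_free:
  fixes R (structure)
  assumes R: "cring R" "noetherian_ring R"
  shows "submodule K R (free_module R n) \<Longrightarrow> fin_gen R (free_module R n) K"
proof (induction n arbitrary: K)
  case 0
  interpret cring R by (rule R)
  interpret F: module R "free_module R 0" by (rule free_module_module)
  have "K \<subseteq> {\<zero>\<^bsub>free_module R 0\<^esub>}"
    using F.submoduleD(1)[OF 0] by (auto simp: free_module_def)
  then show ?case using F.submoduleD(2) by (auto simp: fin_gen_def intro!: exI[of _ "{}"])
next
  case (Suc n)
  interpret cring R by (rule R)
  let ?F = "free_module R n" and ?F' = "free_module R (Suc n)"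
  interpret F: module R ?F by (rule free_module_module)
  interpret F': module R ?F' by (rule free_module_module)
  interpret RR: module R "regular_module R" by (rule regular_module_module)
  have last_hom: "is_module_hom R ?F' (regular_module R) (\<lambda>v. v n)"
    by (rule is_module_homI) (auto simp: free_module_simps regular_module_simps)
  \<comment> \<open>Thanks to the padding with zeros, the free module of rank n is literally the
    kernel of the last coordinate.\<close>
  have mem: "v \<in> carrier ?F \<longleftrightarrow> v \<in> carrier ?F' \<and> v n = \<zero>" for v
    by (auto simp: free_module_simps not_less less_Suc_eq) (metis Suc_leI le_neq_implies_less)
  have restrict: "submodule (N \<inter> carrier ?F) R ?F" if "submodule N R ?F'" for N
    using F'.submoduleD[OF that] by (intro F.submoduleI') (auto simp: free_module_simps)
  obtain S where S: "finite S" "S \<subseteq> K \<inter> carrier ?F"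
    "\<And>N. \<lbrakk>submodule N R ?F; S \<subseteq> N\<rbrakk> \<Longrightarrow> K \<inter> carrier ?F \<subseteq> N"
    using Suc.IH[OF restrict[OF Suc.prems]] by (auto simp: fin_gen_def)
  have "ideal ((\<lambda>v. v n) ` K) R"
    using submodule_image[OF F'.module_axioms RR.module_axioms last_hom Suc.prems]
    by (simp add: submodule_regular_iff)
  from fin_gen_ideal[OF R this] obtain A where A: "finite A" "A \<subseteq> (\<lambda>v. v n) ` K"
    "\<And>N. \<lbrakk>submodule N R (regular_module R); A \<subseteq> N\<rbrakk> \<Longrightarrow> (\<lambda>v. v n) ` K \<subseteq> N"
    unfolding fin_gen_def by blast
  obtain V where V: "V \<subseteq> K" "finite V" "A = (\<lambda>v. v n) ` V"
    using finite_subset_image[OF A(1,2)] by blast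
  have "K \<subseteq> N" if N: "submodule N R ?F'" "S \<union> V \<subseteq> N" for N
  proof
    fix v assume v: "v \<in> K"
    note DN = F'.submoduleD[OF N(1)] and DK = F'.submoduleD[OF Suc.prems]
    \<comment> \<open>N is cut down to K so that the vector u found below lies in K as well; only
      then does v - u fall under the case of smaller rank.\<close>
    have NK: "submodule (N \<inter> K) R ?F'"
      using DN DK by (intro F'.submoduleI') auto
    have "A \<subseteq> (\<lambda>v. v n) ` (N \<inter> K)" using V N(2) by blast
    then have "v n \<in> (\<lambda>v. v n) ` (N \<inter> K)"
      using A(3)[OF submodule_image[OF F'.module_axioms RR.module_axioms last_hom NK]] v by blast
    then obtain u where u: "u \<in> N" "u \<in> K" "u n = v n" by auto
    have cl: "u \<in> carrier ?F'" "v \<in> carrier ?F'" using u v DK(1) by auto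
    have "(v \<ominus>\<^bsub>?F'\<^esub> u) n = v n \<ominus>\<^bsub>regular_module R\<^esub> u n"
      by (rule is_module_hom_zero_minus(2)[OF F'.module_axioms RR.module_axioms last_hom cl(2,1)])
    also have "\<dots> = \<zero>" using u(3) free_module_closed[OF cl(2), of n]
      by (simp add: regular_module_minus r_right_minus_eq)
    finally have "v \<ominus>\<^bsub>?F'\<^esub> u \<in> carrier ?F" using cl by (simp add: mem)
    moreover have "v \<ominus>\<^bsub>?F'\<^esub> u \<in> K" using DK(4) v u by blast
    moreover have "K \<inter> carrier ?F \<subseteq> N \<inter> carrier ?F"
      using S(2) N(2) by (intro S(3) restrict N(1)) auto
    ultimately have "v \<ominus>\<^bsub>?F'\<^esub> u \<in> N" by blast
    then have "v \<ominus>\<^bsub>?F'\<^esub> u \<oplus>\<^bsub>?F'\<^esub> u \<in> N" using DN(3) u(1) by blast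
    then show "v \<in> N" using F'.minus_cancel[OF cl(2,1)] by simp
  qed
  moreover have "finite (S \<union> V)" "S \<union> V \<subseteq> K" using S(1,2) V by auto
  ultimately show ?case unfolding fin_gen_def by blast
qed

lemma (in cring) fin_gen_image_free:
  assumes M: "module R M" and K: "submodule K R M" "fin_gen R M K"
  obtains b g where "is_module_hom R (free_module R b) M g" "g ` carrier (free_module R b) = K"
proof -
  interpret M: module R M by (rule M)
  obtain S where S: "finite S" "S \<subseteq> K" "\<And>N. \<lbrakk>submodule N R M; S \<subseteq> N\<rbrakk> \<Longrightarrow> K \<subseteq> N"
    using K(2) by (auto simp: fin_gen_def)
  obtain xs where xs: "set xs = S" using finite_list[OF S(1)] by blast
  let ?n = "length xs"
  have x: "xs ! i \<in> K" if "i < ?n" for i using that xs S(2) by auto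
  then have "xs ! i \<in> carrier M" if "i < ?n" for i using that M.submoduleD(1)[OF K(1)] by blast
  note l = lincomb[OF M, of ?n "(!) xs", OF this]
  let ?g = "lincomb M ?n ((!) xs)"
  have "?g ` carrier (free_module R ?n) = K"
  proof
    show "?g ` carrier (free_module R ?n) \<subseteq> K"
      using hom_free_in[OF M l(1) K(1)] l(2) x by auto
    have "x \<in> ?g ` carrier (free_module R ?n)" if "x \<in> S" for x
    proof -
      have "\<exists>i<?n. xs ! i = x" using that xs by (simp flip: in_set_conv_nth)
      then obtain i where "i < ?n" "x = xs ! i" by blast
      then have "?g (unit_vector R i) = x" "unit_vector R i \<in> carrier (free_module R ?n)"
        by (simp_all add: l(2) unit_vector_closed)
      then show ?thesis by blast
    qed
    then show "K \<subseteq> ?g ` carrier (free_module R ?n)"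
      using submodule_image[OF free_module_module M l(1)
          module.carrier_is_submodule[OF free_module_module]]
      by (intro S(3)) blast+
  qed
  then show thesis using that l(1) by blast
qed

text \<open>Each differential must map onto the kernel of the previous one, so the resolution arises
  by dependent choice. A state consists of the rank of the target, the rank of the source and the
  differential; recording the target rank lets consecutive states be matched.\<close>

lemma free_resolution_of_submodule:
  assumes R: "cring R" "noetherian_ring R" and K: "submodule K R (free_module R n)"
  obtains b d where "b 0 = n"
    "\<And>i. is_module_hom R (free_module R (b (Suc i))) (free_module R (b i)) (d i)"
    "d 0 ` carrier (free_module R (b 1)) = K"
    "\<And>i. d (Suc i) ` carrier (free_module R (b (Suc (Suc i)))) =
       module_kernel (free_module R (b (Suc i))) (free_module R (b i)) (d i)"
proof -
  interpret cring R by (rule R)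
  let ?F = "free_module R"
  have ex: "\<exists>b g. is_module_hom R (?F b) (?F n) g \<and> g ` carrier (?F b) = K"
    if "submodule K R (?F n)" for K n
    using fin_gen_image_free[OF free_module_module that fin_gen_free[OF R that]] by metis
  obtain b0 d0 where 0: "is_module_hom R (?F b0) (?F n) d0" "d0 ` carrier (?F b0) = K"
    using ex[OF K] by blast
  define P where "P = (\<lambda>(n, m, g). is_module_hom R (?F m) (?F n) g)"
  define Q where "Q = (\<lambda>(n, m, g) (n', m', g').
    n' = m \<and> g' ` carrier (?F m') = module_kernel (?F m) (?F n) g)"
  have "\<exists>s. \<forall>i. (P (s i) \<and> (i = 0 \<longrightarrow> s i = (n, b0, d0))) \<and> Q (s i) (s (Suc i))"
  proof (rule dependent_nat_choice)
    show "\<exists>x. P x \<and> (0 = 0 \<longrightarrow> x = (n, b0, d0))" using 0 by (auto simp: P_def)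
  next
    fix x :: "nat \<times> nat \<times> ((nat \<Rightarrow> 'a) \<Rightarrow> nat \<Rightarrow> 'a)" and i :: nat
    obtain k m g where x: "x = (k, m, g)" by (cases x)
    assume "P x \<and> (i = 0 \<longrightarrow> x = (n, b0, d0))"
    then have "submodule (module_kernel (?F m) (?F k) g) R (?F m)"
      using x by (auto simp: P_def intro: submodule_kernel free_module_module)
    from ex[OF this] obtain b' g' where "is_module_hom R (?F b') (?F m) g'"
      "g' ` carrier (?F b') = module_kernel (?F m) (?F k) g" by blast
    then show "\<exists>y. (P y \<and> (Suc i = 0 \<longrightarrow> y = (n, b0, d0))) \<and> Q x y"
      using x by (intro exI[of _ "(m, b', g')"]) (auto simp: P_def Q_def)
  qed
  then obtain s where s: "\<And>i. P (s i)" "s 0 = (n, b0, d0)" "\<And>i. Q (s i) (s (Suc i))" by blast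
  define b where "b i = fst (s i)" for i
  define d where "d i = snd (snd (s i))" for i
  have eq: "s i = (b i, b (Suc i), d i)" for i
    using s(3)[of i] by (auto simp: Q_def b_def d_def split: prod.splits)
  show thesis
  proof (rule that[of b d])
    show "b 0 = n" using s(2) by (simp add: b_def)
    show "is_module_hom R (?F (b (Suc i))) (?F (b i)) (d i)" for i
      using s(1)[of i] by (simp add: eq P_def)
    show "d 0 ` carrier (?F (b 1)) = K" using s(2) 0(2) eq[of 0] by simp
    show "d (Suc i) ` carrier (?F (b (Suc (Suc i)))) = module_kernel (?F (b (Suc i))) (?F (b i)) (d i)"
      for i using s(3)[of i] eq[of i] eq[of "Suc i"] by (simp add: Q_def)
  qed
qed

section \<open>Local rings\<close>

text \<open>Locality is phrased through units and an explicit maximal ideal. This form is easy to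
  verify for quotients and idealizations, and \<open>max_ideal_eq\<close> leads back to the definite
  description.\<close>

locale local_cring = cring R for R (structure) +
  fixes \<mm> :: "'a set"
  assumes max_ideal_ideal: "ideal \<mm> R" and one_notin: "\<one> \<notin> \<mm>"
    and units: "\<And>a. \<lbrakk>a \<in> carrier R; a \<notin> \<mm>\<rbrakk> \<Longrightarrow> a \<in> Units R"
begin

lemma max_ideal_sub: "a \<in> \<mm> \<Longrightarrow> a \<in> carrier R"
  using idealD(1)[OF max_ideal_ideal] by blast

lemma proper_ideal_sub:
  assumes "ideal J R" "J \<noteq> carrier R"
  shows "J \<subseteq> \<mm>"
proof
  fix a assume a: "a \<in> J"
  show "a \<in> \<mm>"
  proof (rule ccontr)
    assume "a \<notin> \<mm>"
    then have "a \<in> Units R" using a idealD(1)[OF assms(1)] units by blast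
    then have "inv a \<otimes> a \<in> J" "inv a \<otimes> a = \<one>"
      using idealD(5)[OF assms(1) _ a] by (blast intro: Units_inv_closed, blast intro: Units_l_inv)
    then have "\<one> \<in> J" by simp
    then show False using assms ideal.one_imp_carrier by metis
  qed
qed

lemma maximalideal_max_ideal: "maximalideal \<mm> R"
proof (rule maximalidealI)
  show "ideal \<mm> R" by (rule max_ideal_ideal)
  show "carrier R \<noteq> \<mm>" using one_notin by auto
  show "J = \<mm> \<or> J = carrier R" if "ideal J R" "\<mm> \<subseteq> J" "J \<subseteq> carrier R" for J
    using proper_ideal_sub[OF that(1)] that(2) by blast
qed

lemma maximalideal_unique:
  assumes "maximalideal M R"
  shows "M = \<mm>"
proof -
  interpret M: maximalideal M R by (rule assms)
  have "M \<subseteq> \<mm>" by (rule proper_ideal_sub[OF M.is_ideal]) (use M.I_notcarr in simp)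
  then have "\<mm> = M \<or> \<mm> = carrier R"
    using max_ideal_sub by (intro M.I_maximal max_ideal_ideal) auto
  then show ?thesis using one_notin by auto
qed

lemma max_ideal_eq: "max_ideal R = \<mm>"
  unfolding max_ideal_def
  by (rule the_equality) (rule maximalideal_max_ideal, erule maximalideal_unique)

lemma one_minus_unit: "a \<in> \<mm> \<Longrightarrow> \<one> \<ominus> a \<in> Units R"
proof (rule units)
  assume a: "a \<in> \<mm>"
  show "\<one> \<ominus> a \<in> carrier R" using a max_ideal_sub by simp
  show "\<one> \<ominus> a \<notin> \<mm>"
    using idealD(3)[OF max_ideal_ideal _ a] minus_cancel[of \<one> a] a max_ideal_sub one_notin by force
qed

text \<open>The hypothesis says \<open>K \<subseteq> B + \<mm> K\<close>, with \<open>B + \<mm> K\<close> described by its minimality.\<close>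

lemma nakayama:
  assumes M: "module R M" and K: "fin_gen R M K" "submodule K R M" and B: "submodule B R M"
    and gen: "\<And>L. \<lbrakk>submodule L R M; B \<subseteq> L; \<And>a k. \<lbrakk>a \<in> \<mm>; k \<in> K\<rbrakk> \<Longrightarrow> a \<odot>\<^bsub>M\<^esub> k \<in> L\<rbrakk> \<Longrightarrow> K \<subseteq> L"
  shows "K \<subseteq> B"
proof -
  interpret M: module R M by (rule M)
  have KM: "k \<in> carrier M" if "k \<in> K" for k using M.submoduleD(1)[OF K(2)] that by blast
  have "K \<subseteq> B" if "finite S" "S \<subseteq> K" "submodule B R M"
    "\<And>N. \<lbrakk>submodule N R M; B \<union> S \<subseteq> N\<rbrakk> \<Longrightarrow> K \<subseteq> N"
    "\<And>L. \<lbrakk>submodule L R M; B \<subseteq> L; \<And>a k. \<lbrakk>a \<in> \<mm>; k \<in> K\<rbrakk> \<Longrightarrow> a \<odot>\<^bsub>M\<^esub> k \<in> L\<rbrakk> \<Longrightarrow> K \<subseteq> L" for S B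
    using that
  proof (induction S arbitrary: B rule: finite_induct)
    case (insert s S)
    note D = M.submoduleD[OF insert.prems(2)]
    have s: "s \<in> K" "s \<in> carrier M" using insert.prems(1) KM by auto
    have sum: "submodule {b \<oplus>\<^bsub>M\<^esub> r \<odot>\<^bsub>M\<^esub> s | b r. b \<in> B \<and> r \<in> J} R M" (is "submodule (?N J) R M")
      if J: "ideal J R" for J
    proof (rule M.submoduleI')
      note DJ = idealD[OF J]
      show "?N J \<subseteq> carrier M" using s D(1) DJ(1) by auto
      show "\<zero>\<^bsub>M\<^esub> \<in> ?N J" using s D(2) DJ(2) by force
      fix x y assume "x \<in> ?N J" "y \<in> ?N J"
      then obtain b r b' r' where br: "b \<in> B" "r \<in> J" "b' \<in> B" "r' \<in> J"
        "x = b \<oplus>\<^bsub>M\<^esub> r \<odot>\<^bsub>M\<^esub> s" "y = b' \<oplus>\<^bsub>M\<^esub> r' \<odot>\<^bsub>M\<^esub> s" by blast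
      have cl: "b \<in> carrier M" "b' \<in> carrier M" "r \<in> carrier R" "r' \<in> carrier R"
        using br D(1) DJ(1) by auto
      have "x \<oplus>\<^bsub>M\<^esub> y = (b \<oplus>\<^bsub>M\<^esub> b') \<oplus>\<^bsub>M\<^esub> (r \<oplus> r') \<odot>\<^bsub>M\<^esub> s"
        using cl s(2) br by (simp add: M.a_ac M.smult_l_distr)
      then show "x \<oplus>\<^bsub>M\<^esub> y \<in> ?N J" using br D(3) DJ(3) by blast
    next
      note DJ = idealD[OF J]
      fix a x assume a: "a \<in> carrier R" and "x \<in> ?N J"
      then obtain b r where br: "b \<in> B" "r \<in> J" "x = b \<oplus>\<^bsub>M\<^esub> r \<odot>\<^bsub>M\<^esub> s" by blast
      have cl: "b \<in> carrier M" "r \<in> carrier R" using br D(1) DJ(1) by auto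
      have "a \<odot>\<^bsub>M\<^esub> x = a \<odot>\<^bsub>M\<^esub> b \<oplus>\<^bsub>M\<^esub> (a \<otimes> r) \<odot>\<^bsub>M\<^esub> s"
        using cl s(2) br a by (simp add: M.smult_r_distr M.smult_assoc1)
      then show "a \<odot>\<^bsub>M\<^esub> x \<in> ?N J" using br a D(5) DJ(5) by blast
    qed
    have B_sub: "B \<subseteq> ?N J" if "ideal J R" for J
    proof
      fix b assume b: "b \<in> B"
      then have "b = b \<oplus>\<^bsub>M\<^esub> \<zero> \<odot>\<^bsub>M\<^esub> s" using D(1) s by auto
      then show "b \<in> ?N J" using b idealD(2)[OF that] by blast
    qed
    have s_in: "s \<in> ?N (carrier R)"
      using D(2) s by (auto intro!: exI[of _ "\<zero>\<^bsub>M\<^esub>"] exI[of _ \<one>])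
    \<comment> \<open>The induction hypothesis is used with B + R s in place of B. The assumption on
      K then improves B + R s to B + \<mm> s, and solving for s with the unit 1 - a puts s into
      B.\<close>
    have KN: "K \<subseteq> ?N (carrier R)"
    proof (rule insert.IH)
      show "S \<subseteq> K" using insert.prems by simp
      show "submodule (?N (carrier R)) R M" by (rule sum[OF oneideal])
      show "K \<subseteq> N" if "submodule N R M" "?N (carrier R) \<union> S \<subseteq> N" for N
        using that s_in B_sub[OF oneideal] by (intro insert.prems(3)) auto
      show "K \<subseteq> L" if "submodule L R M" "?N (carrier R) \<subseteq> L"
        "\<And>a k. \<lbrakk>a \<in> \<mm>; k \<in> K\<rbrakk> \<Longrightarrow> a \<odot>\<^bsub>M\<^esub> k \<in> L" for L
        using that B_sub[OF oneideal] by (intro insert.prems(4)) auto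
    qed
    have "K \<subseteq> ?N \<mm>"
    proof (rule insert.prems(4)[OF sum[OF max_ideal_ideal] B_sub[OF max_ideal_ideal]])
      fix a k assume a: "a \<in> \<mm>" and "k \<in> K"
      then obtain b r where br: "b \<in> B" "r \<in> carrier R" "k = b \<oplus>\<^bsub>M\<^esub> r \<odot>\<^bsub>M\<^esub> s" using KN by blast
      have "b \<in> carrier M" using br D(1) by auto
      then have "a \<odot>\<^bsub>M\<^esub> k = a \<odot>\<^bsub>M\<^esub> b \<oplus>\<^bsub>M\<^esub> (r \<otimes> a) \<odot>\<^bsub>M\<^esub> s"
        using s(2) br max_ideal_sub[OF a] by (simp add: M.smult_r_distr M.smult_assoc1 m_comm)
      then show "a \<odot>\<^bsub>M\<^esub> k \<in> ?N \<mm>"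
        using br a D(5) max_ideal_sub idealD(5)[OF max_ideal_ideal] by blast
    qed
    then obtain b a where ba: "b \<in> B" "a \<in> \<mm>" "s = b \<oplus>\<^bsub>M\<^esub> a \<odot>\<^bsub>M\<^esub> s" using s by blast
    have cl: "a \<in> carrier R" "b \<in> carrier M" using ba D(1) max_ideal_sub by auto
    have "(\<one> \<ominus> a) \<odot>\<^bsub>M\<^esub> s = s \<ominus>\<^bsub>M\<^esub> a \<odot>\<^bsub>M\<^esub> s" using cl s by (simp add: M.minus_smult_l)
    also have "\<dots> = (b \<oplus>\<^bsub>M\<^esub> a \<odot>\<^bsub>M\<^esub> s) \<ominus>\<^bsub>M\<^esub> a \<odot>\<^bsub>M\<^esub> s" using ba(3) by simp
    also have "\<dots> = b" using cl s by (simp add: M.add_minus_cancel)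
    finally have *: "(\<one> \<ominus> a) \<odot>\<^bsub>M\<^esub> s \<in> B" using ba by simp
    have u: "\<one> \<ominus> a \<in> Units R" by (rule one_minus_unit[OF ba(2)])
    have "inv (\<one> \<ominus> a) \<odot>\<^bsub>M\<^esub> ((\<one> \<ominus> a) \<odot>\<^bsub>M\<^esub> s) = s"
      using u s cl by (simp add: M.smult_assoc1[symmetric])
    then have "s \<in> B" using D(5)[OF _ *] u by (metis Units_inv_closed)
    have gen': "K \<subseteq> N" if "submodule N R M" "B \<union> S \<subseteq> N" for N
      using that \<open>s \<in> B\<close> by (intro insert.prems(3)) auto
    show ?case
      by (rule insert.IH[OF _ insert.prems(2) gen' insert.prems(4)]) (use insert.prems(1) in auto)
  next
    case empty
    then show ?case using empty.prems(3)[OF empty.prems(2)] by simp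
  qed
  moreover obtain S where "finite S" "S \<subseteq> K" "\<And>N. \<lbrakk>submodule N R M; S \<subseteq> N\<rbrakk> \<Longrightarrow> K \<subseteq> N"
    using K(1) by (auto simp: fin_gen_def)
  ultimately show ?thesis using B gen by (metis Un_subset_iff)
qed

end

locale noetherian_local = local_cring R \<mm> + noetherian_ring R for R (structure) and \<mm>

section \<open>Injective modules\<close>

text \<open>Submodules of free modules live in the type over which \<open>injective_module\<close>
  quantifies; the later uses of injectivity are brought to this shape.\<close>

lemma injective_extend:
  fixes R (structure)
  assumes R: "cring R" and E: "injective_module R E" and K: "submodule K R (free_module R n)"
    and f: "is_module_hom R ((free_module R n)\<lparr>carrier := K\<rparr>) E f"
  obtains h where "is_module_hom R (free_module R n) E h" "\<And>x. x \<in> K \<Longrightarrow> h x = f x"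
proof -
  interpret cring R by (rule R)
  interpret F: module R "free_module R n" by (rule free_module_module)
  let ?A = "(free_module R n)\<lparr>carrier := K\<rparr>"
  have "module R ?A" by (rule submodule.submodule_is_module[OF K F.module_axioms])
  moreover have "is_module_hom R ?A (free_module R n) id"
    by (rule is_module_homI) (use F.submoduleD(1)[OF K] in auto)
  ultimately have "\<exists>h. is_module_hom R (free_module R n) E h \<and> (\<forall>x\<in>carrier ?A. h (id x) = f x)"
    using E f F.module_axioms unfolding injective_module_def
    by (elim conjE allE[of _ ?A] allE[of _ "free_module R n"] allE[of _ id] allE[of _ f]) auto
  then show thesis using that by auto
qed

text \<open>As q kills the kernel of p, it descends to the image of p, and from there it extends by
  injectivity.\<close>

lemma injective_factor:
  fixes R (structure)
  assumes R: "cring R" and E: "injective_module R E" and P: "module R P"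
    and p: "is_module_hom R P (free_module R n) p" and q: "is_module_hom R P E q"
    and ker: "\<And>z. \<lbrakk>z \<in> carrier P; p z = \<zero>\<^bsub>free_module R n\<^esub>\<rbrakk> \<Longrightarrow> q z = \<zero>\<^bsub>E\<^esub>"
  obtains h where "is_module_hom R (free_module R n) E h" "\<And>z. z \<in> carrier P \<Longrightarrow> h (p z) = q z"
proof -
  interpret cring R by (rule R)
  interpret F: module R "free_module R n" by (rule free_module_module)
  interpret P: module R P by (rule P)
  interpret E: module R E using E by (simp add: injective_module_def)
  let ?K = "p ` carrier P"
  note Dp = is_module_homD[OF p] and Dq = is_module_homD[OF q]
  have K: "submodule ?K R (free_module R n)"
    by (rule submodule_image[OF P F.module_axioms p P.carrier_is_submodule])
  define f where "f w = q (SOME z. z \<in> carrier P \<and> p z = w)" for w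
  have f: "f (p z) = q z" if z: "z \<in> carrier P" for z
  proof -
    define y where "y = (SOME y. y \<in> carrier P \<and> p y = p z)"
    have y: "y \<in> carrier P" "p y = p z"
      using someI[of "\<lambda>y. y \<in> carrier P \<and> p y = p z" z] z by (auto simp: y_def)
    have "p (y \<ominus>\<^bsub>P\<^esub> z) = \<zero>\<^bsub>free_module R n\<^esub>"
      using y z Dp(1) is_module_hom_zero_minus(2)[OF P F.module_axioms p y(1) z]
      by (simp add: F.minus_eq_zero_iff)
    then have "q y \<ominus>\<^bsub>E\<^esub> q z = \<zero>\<^bsub>E\<^esub>"
      using ker y z is_module_hom_zero_minus(2)[OF P E.module_axioms q y(1) z] by simp
    then show ?thesis using Dq(1) y z by (simp add: E.minus_eq_zero_iff f_def y_def)
  qed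
  have "is_module_hom R ((free_module R n)\<lparr>carrier := ?K\<rparr>) E f"
    by (rule is_module_homI) (auto simp: f Dq Dp(2,3)[symmetric])
  from injective_extend[OF R E K this] obtain h
    where "is_module_hom R (free_module R n) E h" "\<And>x. x \<in> ?K \<Longrightarrow> h x = f x" by blast
  then show thesis using that f by auto
qed

text \<open>One direction of Baer's criterion. The ideal is transported into the free module of rank
  one to reach the right type; e is the value of the extension at the unit vector.\<close>

lemma injective_ideal_extend:
  fixes R (structure)
  assumes R: "cring R" and E: "injective_module R E" and J: "ideal J R"
    and f: "is_module_hom R (ideal_module R J) E f"
  obtains e where "e \<in> carrier E" "\<And>a. a \<in> J \<Longrightarrow> f a = a \<odot>\<^bsub>E\<^esub> e"
proof -
  interpret cring R by (rule R)
  let ?F = "free_module R 1"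
  have last_hom: "is_module_hom R ?F (regular_module R) (\<lambda>v. v 0)"
    by (rule is_module_homI) (auto simp: free_module_simps regular_module_simps)
  define K where "K = {w \<in> carrier ?F. w 0 \<in> J}"
  have K: "submodule K R ?F"
    unfolding K_def
    using submodule_vimage[OF free_module_module regular_module_module last_hom] J
    by (simp add: submodule_regular_iff)
  note Df = is_module_homD[OF f, unfolded ideal_module_simps]
  have "is_module_hom R (?F\<lparr>carrier := K\<rparr>) E (\<lambda>w. f (w 0))"
    by (rule is_module_homI) (auto simp: K_def Df free_module_simps)
  from injective_extend[OF R E K this] obtain h
    where h: "is_module_hom R ?F E h" "\<And>w. w \<in> K \<Longrightarrow> h w = f (w 0)" by blast
  have u: "unit_vector R 0 \<in> carrier ?F" by (simp add: unit_vector_closed)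
  show thesis
  proof (rule that)
    show "h (unit_vector R 0) \<in> carrier E" using is_module_homD(1)[OF h(1) u] .
    fix a assume a: "a \<in> J"
    then have aR: "a \<in> carrier R" using idealD(1)[OF J] by blast
    have a0: "(a \<odot>\<^bsub>?F\<^esub> unit_vector R 0) 0 = a"
      using aR by (simp add: free_module_simps unit_vector_def)
    moreover have "a \<odot>\<^bsub>?F\<^esub> unit_vector R 0 \<in> carrier ?F"
      using module.smult_closed[OF free_module_module aR u] .
    ultimately have "h (a \<odot>\<^bsub>?F\<^esub> unit_vector R 0) = f a"
      using h(2) a by (simp add: K_def)
    then show "f a = a \<odot>\<^bsub>E\<^esub> h (unit_vector R 0)" using is_module_homD(3)[OF h(1) aR u] by simp
  qed
qed

text \<open>A weak form of Baer's criterion for a submodule \<open>C\<close> of \<open>E\<close>: it concerns the homomorphisms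
  \<open>J + Rv \<rightarrow> C\<close> that vanish on \<open>J\<close> and send \<open>v\<close> to \<open>d\<close>.\<close>

definition principally_injective ::
    "('a, 'b) ring_scheme \<Rightarrow> ('a, 'e) module \<Rightarrow> 'e set \<Rightarrow> bool" where
  "principally_injective R E C \<longleftrightarrow>
    (\<forall>J v d. ideal J R \<longrightarrow> v \<in> carrier R \<longrightarrow> d \<in> C \<longrightarrow>
      (\<forall>a\<in>carrier R. a \<otimes>\<^bsub>R\<^esub> v \<in> J \<longrightarrow> a \<odot>\<^bsub>E\<^esub> d = \<zero>\<^bsub>E\<^esub>) \<longrightarrow>
      (\<exists>c\<in>C. (\<forall>a\<in>J. a \<odot>\<^bsub>E\<^esub> c = \<zero>\<^bsub>E\<^esub>) \<and> d = v \<odot>\<^bsub>E\<^esub> c))"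

lemma principally_injectiveE:
  assumes "principally_injective R E C" "ideal J R" "v \<in> carrier R" "d \<in> C"
    and "\<And>a. \<lbrakk>a \<in> carrier R; a \<otimes>\<^bsub>R\<^esub> v \<in> J\<rbrakk> \<Longrightarrow> a \<odot>\<^bsub>E\<^esub> d = \<zero>\<^bsub>E\<^esub>"
  obtains c where "c \<in> C" "\<And>a. a \<in> J \<Longrightarrow> a \<odot>\<^bsub>E\<^esub> c = \<zero>\<^bsub>E\<^esub>" "d = v \<odot>\<^bsub>E\<^esub> c"
  using assms unfolding principally_injective_def by metis

lemma (in cring) ideal_add_principal:
  assumes J: "ideal J R" and v: "v \<in> carrier R"
  shows "ideal {j \<oplus> a \<otimes> v | j a. j \<in> J \<and> a \<in> carrier R} R" (is "ideal ?K R")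
    and "J \<subseteq> {j \<oplus> a \<otimes> v | j a. j \<in> J \<and> a \<in> carrier R}"
    and "v \<in> {j \<oplus> a \<otimes> v | j a. j \<in> J \<and> a \<in> carrier R}"
proof -
  note DJ = idealD[OF J]
  have cl: "j \<in> carrier R" if "j \<in> J" for j using DJ(1) that by blast
  show "J \<subseteq> ?K"
  proof
    fix j assume j: "j \<in> J"
    then have "j = j \<oplus> \<zero> \<otimes> v" using v cl by simp
    then show "j \<in> ?K" using j by blast
  qed
  then have 0: "\<zero> \<in> ?K" using DJ(2) by blast
  have "v = \<zero> \<oplus> \<one> \<otimes> v" using v by simp
  then show "v \<in> ?K" using DJ(2) by blast
  show "ideal ?K R"
  proof (rule idealI'[OF _ 0])
    show "?K \<subseteq> carrier R" using cl v by auto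
  next
    fix x y assume "x \<in> ?K" "y \<in> ?K"
    then obtain j a k b where *: "j \<in> J" "a \<in> carrier R" "k \<in> J" "b \<in> carrier R"
      "x = j \<oplus> a \<otimes> v" "y = k \<oplus> b \<otimes> v" by blast
    then have "x \<oplus> y = (j \<oplus> k) \<oplus> (a \<oplus> b) \<otimes> v" using cl v by (simp add: l_distr a_ac)
    then show "x \<oplus> y \<in> ?K" using * DJ(3) by blast
  next
    fix r x assume r: "r \<in> carrier R" and "x \<in> ?K"
    then obtain j a where *: "j \<in> J" "a \<in> carrier R" "x = j \<oplus> a \<otimes> v" by blast
    then have "r \<otimes> x = r \<otimes> j \<oplus> (r \<otimes> a) \<otimes> v" using cl v r by (simp add: r_distr m_assoc)
    then show "r \<otimes> x \<in> ?K" using * DJ(5) r by blast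
  qed
qed

text \<open>The map j + a v \<mapsto> a d is well defined because a v \<in> J forces a d = 0; its
  extension is multiplication by the required c.\<close>

lemma injective_principally_injective:
  fixes R (structure)
  assumes R: "cring R" and E: "injective_module R E"
  shows "principally_injective R E (carrier E)"
  unfolding principally_injective_def
proof (intro allI impI)
  interpret cring R by (rule R)
  interpret E: module R E using E by (simp add: injective_module_def)
  fix J v d
  assume J: "ideal J R" and v: "v \<in> carrier R" and d: "d \<in> carrier E"
    and ann: "\<forall>a\<in>carrier R. a \<otimes> v \<in> J \<longrightarrow> a \<odot>\<^bsub>E\<^esub> d = \<zero>\<^bsub>E\<^esub>"
  let ?K = "{j \<oplus> a \<otimes> v | j a. j \<in> J \<and> a \<in> carrier R}"
  note DJ = idealD[OF J] and K = ideal_add_principal[OF J v]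
  have clJ: "j \<in> carrier R" if "j \<in> J" for j using DJ(1) that by blast
  define f where "f b = (SOME a. a \<in> carrier R \<and> b \<ominus> a \<otimes> v \<in> J) \<odot>\<^bsub>E\<^esub> d" for b
  have f: "f (j \<oplus> a \<otimes> v) = a \<odot>\<^bsub>E\<^esub> d" if j: "j \<in> J" and a: "a \<in> carrier R" for j a
  proof -
    define a' where "a' = (SOME a'. a' \<in> carrier R \<and> (j \<oplus> a \<otimes> v) \<ominus> a' \<otimes> v \<in> J)"
    have a': "a' \<in> carrier R" "(j \<oplus> a \<otimes> v) \<ominus> a' \<otimes> v \<in> J"
      using someI[of "\<lambda>a'. a' \<in> carrier R \<and> (j \<oplus> a \<otimes> v) \<ominus> a' \<otimes> v \<in> J" a] j a v clJ
      by (auto simp: a'_def add_minus_cancel)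
    have "(j \<oplus> a \<otimes> v) \<ominus> a' \<otimes> v \<ominus> j = (a \<ominus> a') \<otimes> v"
      using j clJ a a'(1) v by algebra
    then have "(a \<ominus> a') \<otimes> v \<in> J" using DJ(4)[OF a'(2) j] by simp
    then have "(a \<ominus> a') \<odot>\<^bsub>E\<^esub> d = \<zero>\<^bsub>E\<^esub>" using ann a a'(1) by simp
    then have "a \<odot>\<^bsub>E\<^esub> d = a' \<odot>\<^bsub>E\<^esub> d" using a a'(1) d by (simp add: E.minus_smult_l E.minus_eq_zero_iff)
    then show ?thesis by (simp add: f_def a'_def)
  qed
  have "is_module_hom R (ideal_module R ?K) E f"
  proof (rule is_module_homI, unfold ideal_module_simps)
    fix x assume "x \<in> ?K" then show "f x \<in> carrier E" using f d by auto
  next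
    fix x y assume "x \<in> ?K" "y \<in> ?K"
    then obtain j a k b where *: "j \<in> J" "a \<in> carrier R" "k \<in> J" "b \<in> carrier R"
      "x = j \<oplus> a \<otimes> v" "y = k \<oplus> b \<otimes> v" by blast
    then have "x \<oplus> y = (j \<oplus> k) \<oplus> (a \<oplus> b) \<otimes> v" using clJ v by (simp add: l_distr a_ac)
    then show "f (x \<oplus> y) = f x \<oplus>\<^bsub>E\<^esub> f y" using * f DJ(3) d by (simp add: E.smult_l_distr)
  next
    fix r x assume r: "r \<in> carrier R" and "x \<in> ?K"
    then obtain j a where *: "j \<in> J" "a \<in> carrier R" "x = j \<oplus> a \<otimes> v" by blast
    then have "r \<otimes> x = r \<otimes> j \<oplus> (r \<otimes> a) \<otimes> v" using clJ v r by (simp add: r_distr m_assoc)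
    then show "f (r \<otimes> x) = r \<odot>\<^bsub>E\<^esub> f x" using * f DJ(5) r d by (simp add: E.smult_assoc1)
  qed
  from injective_ideal_extend[OF R E K(1) this] obtain c
    where c: "c \<in> carrier E" "\<And>a. a \<in> ?K \<Longrightarrow> f a = a \<odot>\<^bsub>E\<^esub> c" by blast
  have "a \<odot>\<^bsub>E\<^esub> c = \<zero>\<^bsub>E\<^esub>" if a: "a \<in> J" for a
  proof -
    have "a = a \<oplus> \<zero> \<otimes> v" using a clJ v by simp
    then have "f a = \<zero>\<^bsub>E\<^esub>" using f[OF a zero_closed] d by simp
    then show ?thesis using c(2)[OF subsetD[OF K(2) a]] by simp
  qed
  moreover have "d = v \<odot>\<^bsub>E\<^esub> c"
  proof -
    have "v = \<zero> \<oplus> \<one> \<otimes> v" using v by simp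
    then have "f v = d" using f[OF DJ(2) one_closed] d by simp
    then show ?thesis using c(2)[OF K(3)] by simp
  qed
  ultimately show "\<exists>c\<in>carrier E. (\<forall>a\<in>J. a \<odot>\<^bsub>E\<^esub> c = \<zero>\<^bsub>E\<^esub>) \<and> d = v \<odot>\<^bsub>E\<^esub> c" using c(1) by blast
qed

text \<open>Surjectivity of \<open>(0 :\<^sub>E J) \<rightarrow> (0 :\<^sub>E\<^sub>/\<^sub>C J)\<close>, that is,
  vanishing of \<open>Ext\<^sup>1(R/J, C)\<close> when \<open>E\<close> is injective.\<close>

definition annihilator_lifting ::
    "('a, 'e) module \<Rightarrow> 'e set \<Rightarrow> 'a set \<Rightarrow> bool" where
  "annihilator_lifting E C J \<longleftrightarrow>
    (\<forall>u\<in>carrier E. (\<forall>a\<in>J. a \<odot>\<^bsub>E\<^esub> u \<in> C) \<longrightarrow>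
      (\<exists>w\<in>carrier E. (\<forall>a\<in>J. a \<odot>\<^bsub>E\<^esub> w = \<zero>\<^bsub>E\<^esub>) \<and> u \<ominus>\<^bsub>E\<^esub> w \<in> C))"

lemma annihilator_liftingE:
  assumes "annihilator_lifting E C J" "u \<in> carrier E" "\<And>a. a \<in> J \<Longrightarrow> a \<odot>\<^bsub>E\<^esub> u \<in> C"
  obtains w where "w \<in> carrier E" "\<And>a. a \<in> J \<Longrightarrow> a \<odot>\<^bsub>E\<^esub> w = \<zero>\<^bsub>E\<^esub>" "u \<ominus>\<^bsub>E\<^esub> w \<in> C"
  using assms unfolding annihilator_lifting_def by metis

text \<open>A solution u in E satisfies J u = 0 and v u = d, hence (J + R v) u \<subseteq> C.
  Lifting for the ideal J + R v corrects u by some w that J + R v annihilates, so u - w lies in C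
  and still solves both equations.\<close>

lemma principally_injective_submodule:
  fixes R (structure)
  assumes E: "module R E" and pinj: "principally_injective R E (carrier E)"
    and C: "submodule C R E" and lift: "\<And>J. ideal J R \<Longrightarrow> annihilator_lifting E C J"
  shows "principally_injective R E C"
  unfolding principally_injective_def
proof (intro allI impI)
  interpret E: module R E by (rule E)
  note DC = E.submoduleD[OF C]
  fix J v d
  assume J: "ideal J R" and v: "v \<in> carrier R" and d: "d \<in> C"
    and ann: "\<forall>a\<in>carrier R. a \<otimes> v \<in> J \<longrightarrow> a \<odot>\<^bsub>E\<^esub> d = \<zero>\<^bsub>E\<^esub>"
  let ?K = "{j \<oplus> a \<otimes> v | j a. j \<in> J \<and> a \<in> carrier R}"
  note DJ = E.R.idealD[OF J] and K = E.R.ideal_add_principal[OF J v]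
  have "d \<in> carrier E" using d DC(1) by blast
  from principally_injectiveE[OF pinj J v this] ann obtain u
    where u: "u \<in> carrier E" "\<And>a. a \<in> J \<Longrightarrow> a \<odot>\<^bsub>E\<^esub> u = \<zero>\<^bsub>E\<^esub>" "d = v \<odot>\<^bsub>E\<^esub> u" by blast
  have Ku: "b \<odot>\<^bsub>E\<^esub> u \<in> C" if "b \<in> ?K" for b
  proof -
    obtain j a where *: "j \<in> J" "a \<in> carrier R" "b = j \<oplus> a \<otimes> v" using \<open>b \<in> ?K\<close> by blast
    have "j \<in> carrier R" using * DJ(1) by blast
    then have "b \<odot>\<^bsub>E\<^esub> u = a \<odot>\<^bsub>E\<^esub> d" using * u v by (simp add: E.smult_l_distr E.smult_assoc1)
    then show ?thesis using DC(5) * d by simp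
  qed
  obtain w where w: "w \<in> carrier E" "\<And>a. a \<in> ?K \<Longrightarrow> a \<odot>\<^bsub>E\<^esub> w = \<zero>\<^bsub>E\<^esub>" "u \<ominus>\<^bsub>E\<^esub> w \<in> C"
    by (rule annihilator_liftingE[OF lift[OF K(1)] u(1) Ku]) (assumption, rule that)
  have "a \<odot>\<^bsub>E\<^esub> (u \<ominus>\<^bsub>E\<^esub> w) = \<zero>\<^bsub>E\<^esub>" if a: "a \<in> J" for a
  proof -
    have "a \<in> ?K" "a \<in> carrier R" using a K(2) DJ(1) by blast+
    then show ?thesis using u w a by (simp add: E.minus_smult_r E.minus_eq_zero_iff)
  qed
  moreover have "v \<odot>\<^bsub>E\<^esub> (u \<ominus>\<^bsub>E\<^esub> w) = d \<ominus>\<^bsub>E\<^esub> \<zero>\<^bsub>E\<^esub>" using u w v K(3) by (simp add: E.minus_smult_r)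
  moreover have "d \<ominus>\<^bsub>E\<^esub> \<zero>\<^bsub>E\<^esub> = d" using \<open>d \<in> carrier E\<close> by (simp add: a_minus_def)
  ultimately show "\<exists>c\<in>C. (\<forall>a\<in>J. a \<odot>\<^bsub>E\<^esub> c = \<zero>\<^bsub>E\<^esub>) \<and> d = v \<odot>\<^bsub>E\<^esub> c" using w(3) by metis
qed

text \<open>Noetherian induction: a maximal ideal among those without the lifting property is prime.\<close>

lemma annihilator_lifting_from_primes:
  fixes R (structure)
  assumes R: "noetherian_ring R" and E: "module R E"
    and pinj: "principally_injective R E (carrier E)" and C: "submodule C R E"
    and prime: "\<And>P. primeideal P R \<Longrightarrow> annihilator_lifting E C P" and J: "ideal J R"
  shows "annihilator_lifting E C J"
proof (rule ccontr)
  interpret E: module R E by (rule E)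
  interpret noetherian_ring R by (rule R)
  note DC = E.submoduleD[OF C]
  assume "\<not> annihilator_lifting E C J"
  then have "{J. ideal J R \<and> \<not> annihilator_lifting E C J} \<noteq> {}" using J by blast
  then obtain P where P: "ideal P R" "\<not> annihilator_lifting E C P"
    and max: "\<And>J. \<lbrakk>ideal J R; P \<subset> J\<rbrakk> \<Longrightarrow> annihilator_lifting E C J"
    by (rule exists_maximal_ideal_in) blast+
  note DP = E.R.idealD[OF P(1)]
  have "primeideal P R"
  proof (rule primeidealI[OF P(1) E.R.is_cring])
    show "carrier R \<noteq> P"
    proof
      assume P1: "carrier R = P"
      have "annihilator_lifting E C P"
        unfolding annihilator_lifting_def
      proof (intro ballI impI)
        fix u assume u: "u \<in> carrier E" "\<forall>a\<in>P. a \<odot>\<^bsub>E\<^esub> u \<in> C"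
        then have "u \<in> C" using P1 E.R.one_closed E.smult_one by metis
        then have "u \<ominus>\<^bsub>E\<^esub> \<zero>\<^bsub>E\<^esub> \<in> C" using DC(2,4) by blast
        then show "\<exists>w\<in>carrier E. (\<forall>a\<in>P. a \<odot>\<^bsub>E\<^esub> w = \<zero>\<^bsub>E\<^esub>) \<and> u \<ominus>\<^bsub>E\<^esub> w \<in> C"
          using DP(1) by (intro bexI[of _ "\<zero>\<^bsub>E\<^esub>"]) auto
      qed
      then show False using P(2) by blast
    qed
    fix a b assume a: "a \<in> carrier R" and b: "b \<in> carrier R" and ab: "a \<otimes> b \<in> P"
    show "a \<in> P \<or> b \<in> P"
    proof (rule ccontr)
      assume nin: "\<not> (a \<in> P \<or> b \<in> P)"
      \<comment> \<open>Both P : b and P + R b are strictly larger than P, so lifting holds for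
        them. It is carried to P along the exact sequence 0 \<rightarrow> R/(P : b) \<rightarrow>
        R/P \<rightarrow> R/(P + R b) \<rightarrow> 0.\<close>
      define Q where "Q = {r \<in> carrier R. r \<otimes> b \<in> P}"
      have Q: "ideal Q R"
      proof (rule E.R.idealI')
        fix r s assume "r \<in> Q" "s \<in> Q"
        then show "r \<oplus> s \<in> Q" using DP(3) b by (auto simp: Q_def E.R.l_distr)
      next
        fix r s assume "r \<in> carrier R" "s \<in> Q"
        then show "r \<otimes> s \<in> Q" using DP(5) b by (auto simp: Q_def E.R.m_assoc)
      qed (use DP(2) b in \<open>auto simp: Q_def\<close>)
      have "P \<subset> Q"
      proof -
        have "r \<otimes> b \<in> P" if r: "r \<in> P" for r
          using DP(5)[OF b r] E.R.m_comm[of r b] DP(1) b r by auto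
        then have "P \<subseteq> Q" using DP(1) by (auto simp: Q_def)
        moreover have "a \<in> Q" using a ab by (simp add: Q_def)
        ultimately show ?thesis using nin by blast
      qed
      let ?K = "{j \<oplus> r \<otimes> b | j r. j \<in> P \<and> r \<in> carrier R}"
      note K = E.R.ideal_add_principal[OF P(1) b]
      have PK: "P \<subset> ?K" using K(2,3) nin by blast
      have "annihilator_lifting E C P"
        unfolding annihilator_lifting_def
      proof (intro ballI impI)
        fix e assume e: "e \<in> carrier E" and Pe: "\<forall>a\<in>P. a \<odot>\<^bsub>E\<^esub> e \<in> C"
        have Qbe: "r \<odot>\<^bsub>E\<^esub> (b \<odot>\<^bsub>E\<^esub> e) \<in> C" if "r \<in> Q" for r
          using that Pe b e by (auto simp: Q_def E.smult_assoc1[symmetric])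
        obtain u where u: "u \<in> carrier E" "\<And>r. r \<in> Q \<Longrightarrow> r \<odot>\<^bsub>E\<^esub> u = \<zero>\<^bsub>E\<^esub>"
          "b \<odot>\<^bsub>E\<^esub> e \<ominus>\<^bsub>E\<^esub> u \<in> C"
          by (rule annihilator_liftingE[OF max[OF Q \<open>P \<subset> Q\<close>] E.smult_closed[OF b e] Qbe])
            (assumption, rule that)
        \<comment> \<open>Since P : b kills u, principal injectivity of E writes u = b v with P v =
          0. Subtracting v from e moves b (e - v) into C, and P + R b takes over.\<close>
        have "\<And>r. \<lbrakk>r \<in> carrier R; r \<otimes> b \<in> P\<rbrakk> \<Longrightarrow> r \<odot>\<^bsub>E\<^esub> u = \<zero>\<^bsub>E\<^esub>" using u(2) by (auto simp: Q_def)
        from principally_injectiveE[OF pinj P(1) b u(1) this] obtain v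
          where v: "v \<in> carrier E" "\<And>a. a \<in> P \<Longrightarrow> a \<odot>\<^bsub>E\<^esub> v = \<zero>\<^bsub>E\<^esub>" "u = b \<odot>\<^bsub>E\<^esub> v" by blast
        have be: "b \<odot>\<^bsub>E\<^esub> (e \<ominus>\<^bsub>E\<^esub> v) \<in> C" using u(3) v b e by (simp add: E.minus_smult_r)
        have Kev: "k \<odot>\<^bsub>E\<^esub> (e \<ominus>\<^bsub>E\<^esub> v) \<in> C" if "k \<in> ?K" for k
        proof -
          obtain j r where *: "j \<in> P" "r \<in> carrier R" "k = j \<oplus> r \<otimes> b" using \<open>k \<in> ?K\<close> by blast
          have j: "j \<in> carrier R" using * DP(1) by blast
          have "j \<odot>\<^bsub>E\<^esub> (e \<ominus>\<^bsub>E\<^esub> v) = j \<odot>\<^bsub>E\<^esub> e"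
            using j v e * by (simp add: E.minus_smult_r) (simp add: a_minus_def)
          then have "j \<odot>\<^bsub>E\<^esub> (e \<ominus>\<^bsub>E\<^esub> v) \<in> C" using Pe * by simp
          moreover have "r \<odot>\<^bsub>E\<^esub> (b \<odot>\<^bsub>E\<^esub> (e \<ominus>\<^bsub>E\<^esub> v)) \<in> C" using DC(5) be * by blast
          ultimately show ?thesis
            using * j b e v DC(3) by (simp add: E.smult_l_distr E.smult_assoc1)
        qed
        obtain w where w: "w \<in> carrier E" "\<And>a. a \<in> ?K \<Longrightarrow> a \<odot>\<^bsub>E\<^esub> w = \<zero>\<^bsub>E\<^esub>"
          "e \<ominus>\<^bsub>E\<^esub> v \<ominus>\<^bsub>E\<^esub> w \<in> C"
          by (rule annihilator_liftingE[OF max[OF K(1) PK] E.M.minus_closed[OF e v(1)] Kev])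
            (assumption, rule that)
        have "e \<ominus>\<^bsub>E\<^esub> (v \<oplus>\<^bsub>E\<^esub> w) = e \<ominus>\<^bsub>E\<^esub> v \<ominus>\<^bsub>E\<^esub> w"
          using e v w by (simp add: a_minus_def E.M.minus_add E.M.a_assoc)
        moreover have "a \<odot>\<^bsub>E\<^esub> (v \<oplus>\<^bsub>E\<^esub> w) = \<zero>\<^bsub>E\<^esub>" if "a \<in> P" for a
        proof -
          have "a \<in> carrier R" "a \<in> ?K" using that DP(1) K(2) by auto
          then show ?thesis using v w that by (simp add: E.smult_r_distr)
        qed
        ultimately show "\<exists>w\<in>carrier E. (\<forall>a\<in>P. a \<odot>\<^bsub>E\<^esub> w = \<zero>\<^bsub>E\<^esub>) \<and> e \<ominus>\<^bsub>E\<^esub> w \<in> C"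
          using w v by (intro bexI[of _ "v \<oplus>\<^bsub>E\<^esub> w"]) auto
      qed
      then show False using P(2) by blast
    qed
  qed
  then show False using prime P(2) by blast
qed

text \<open>The image of u in C' is killed by \<mm>, and a s \<in> (x) only for a in \<mm>; so
  principal injectivity writes this image as s c with x c = 0. Lift c to v; by \<open>div\<close>,
  an element of C can be subtracted to make x v = 0 hold in E itself. Then s v is killed by \<mm>,
  because \<mm> s \<subseteq> (x), and it has the same image as u.\<close>

lemma (in noetherian_local) annihilator_lifting_max_ideal:
  assumes E: "module R E" and E': "module R E'" and p: "is_module_hom R E E' p"
    and onto: "p ` carrier E = C'" and ker: "C = module_kernel E E' p"
    and pinj: "principally_injective R E' C'"
    and x: "x \<in> carrier R" and s: "s \<in> carrier R" "s \<notin> PIdl x" "\<And>a. a \<in> \<mm> \<Longrightarrow> a \<otimes> s \<in> PIdl x"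
    and div: "\<And>v. \<lbrakk>v \<in> carrier E; x \<odot>\<^bsub>E\<^esub> v \<in> C\<rbrakk> \<Longrightarrow> \<exists>w\<in>C. x \<odot>\<^bsub>E\<^esub> v = x \<odot>\<^bsub>E\<^esub> w"
  shows "annihilator_lifting E C \<mm>"
  unfolding annihilator_lifting_def
proof (intro ballI impI)
  interpret E: module R E by (rule E)
  interpret E': module R E' by (rule E')
  note Dp = is_module_homD[OF p] and pm = is_module_hom_zero_minus(2)[OF E E' p]
  have C: "c \<in> C \<longleftrightarrow> c \<in> carrier E \<and> p c = \<zero>\<^bsub>E'\<^esub>" for c by (auto simp: ker module_kernel_def)
  fix u assume u: "u \<in> carrier E" and mu: "\<forall>a\<in>\<mm>. a \<odot>\<^bsub>E\<^esub> u \<in> C"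
  have x_in: "x \<in> PIdl x" using cgenideal_self[OF x] .
  have "a \<odot>\<^bsub>E'\<^esub> p u = \<zero>\<^bsub>E'\<^esub>" if a: "a \<in> carrier R" "a \<otimes> s \<in> PIdl x" for a
  proof -
    have "a \<in> \<mm>"
    proof (rule ccontr)
      assume "a \<notin> \<mm>"
      then have U: "a \<in> Units R" using a units by blast
      then have "inv a \<otimes> (a \<otimes> s) \<in> PIdl x" using idealD(5)[OF cgenideal_ideal[OF x]] a(2) by simp
      moreover have "inv a \<otimes> (a \<otimes> s) = s" using U a s by (simp flip: m_assoc)
      ultimately show False using s(2) by simp
    qed
    then show ?thesis using mu C Dp(3)[OF a(1) u] by simp
  qed
  from principally_injectiveE[OF pinj cgenideal_ideal[OF x] s(1) _ this] onto u
  obtain c where c: "c \<in> C'" "\<And>a. a \<in> PIdl x \<Longrightarrow> a \<odot>\<^bsub>E'\<^esub> c = \<zero>\<^bsub>E'\<^esub>" "p u = s \<odot>\<^bsub>E'\<^esub> c" by blast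
  obtain v where v: "v \<in> carrier E" "c = p v" using c(1) onto by blast
  have "x \<odot>\<^bsub>E\<^esub> v \<in> C" using C v x c(2)[OF x_in] Dp(3) by simp
  then obtain w0 where w0: "w0 \<in> C" "x \<odot>\<^bsub>E\<^esub> v = x \<odot>\<^bsub>E\<^esub> w0" using div v by blast
  define v' where "v' = v \<ominus>\<^bsub>E\<^esub> w0"
  have v': "v' \<in> carrier E" "x \<odot>\<^bsub>E\<^esub> v' = \<zero>\<^bsub>E\<^esub>" "p v' = c"
    using v w0 C x Dp(1) by (auto simp: v'_def E.minus_smult_r E.minus_eq_zero_iff pm)
      (simp add: a_minus_def)
  have "a \<odot>\<^bsub>E\<^esub> (s \<odot>\<^bsub>E\<^esub> v') = \<zero>\<^bsub>E\<^esub>" if a: "a \<in> \<mm>" for a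
  proof -
    obtain b where b: "b \<in> carrier R" "a \<otimes> s = b \<otimes> x" using s(3)[OF a] by (auto simp: cgenideal_def)
    have "a \<odot>\<^bsub>E\<^esub> (s \<odot>\<^bsub>E\<^esub> v') = (a \<otimes> s) \<odot>\<^bsub>E\<^esub> v'"
      using max_ideal_sub[OF a] s(1) v' by (simp add: E.smult_assoc1)
    also have "\<dots> = \<zero>\<^bsub>E\<^esub>" using b x v' by (simp add: E.smult_assoc1)
    finally show ?thesis .
  qed
  moreover have "u \<ominus>\<^bsub>E\<^esub> s \<odot>\<^bsub>E\<^esub> v' \<in> C"
    using C u v' s(1) c(3) Dp E'.smult_closed[OF s(1), of c]
    by (simp add: pm E'.minus_eq_zero_iff) (metis E'.minus_eq_zero_iff Dp(1) v'(1,3))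
  ultimately show "\<exists>w\<in>carrier E. (\<forall>a\<in>\<mm>. a \<odot>\<^bsub>E\<^esub> w = \<zero>\<^bsub>E\<^esub>) \<and> u \<ominus>\<^bsub>E\<^esub> w \<in> C"
    using v' s(1) by blast
qed

section \<open>Dimension shifting\<close>

text \<open>The cohomology of \<open>Hom(F, C)\<close> for a submodule \<open>C\<close> of \<open>E\<close> and a complex \<open>F\<close> of free modules
  of ranks \<open>b\<close> with differentials \<open>d\<close>.\<close>

definition cochain ::
    "('a, 'b) ring_scheme \<Rightarrow> (nat \<Rightarrow> nat) \<Rightarrow> ('a, 'e) module \<Rightarrow> 'e set \<Rightarrow> nat \<Rightarrow>
     ((nat \<Rightarrow> 'a) \<Rightarrow> 'e) \<Rightarrow> bool" where
  "cochain R b E C i f \<longleftrightarrow>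
    is_module_hom R (free_module R (b i)) E f \<and> (\<forall>z\<in>carrier (free_module R (b i)). f z \<in> C)"

definition cocycle ::
    "('a, 'b) ring_scheme \<Rightarrow> (nat \<Rightarrow> nat) \<Rightarrow> (nat \<Rightarrow> (nat \<Rightarrow> 'a) \<Rightarrow> (nat \<Rightarrow> 'a)) \<Rightarrow>
     ('a, 'e) module \<Rightarrow> 'e set \<Rightarrow> nat \<Rightarrow> ((nat \<Rightarrow> 'a) \<Rightarrow> 'e) \<Rightarrow> bool" where
  "cocycle R b d E C i f \<longleftrightarrow>
    cochain R b E C i f \<and> (\<forall>z\<in>carrier (free_module R (b (Suc i))). f (d i z) = \<zero>\<^bsub>E\<^esub>)"

text \<open>The index i refers to degree i + 1, so that coboundaries always come from degree i and
  degree zero needs no separate treatment.\<close>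

definition cohomology_vanishes ::
    "('a, 'b) ring_scheme \<Rightarrow> (nat \<Rightarrow> nat) \<Rightarrow> (nat \<Rightarrow> (nat \<Rightarrow> 'a) \<Rightarrow> (nat \<Rightarrow> 'a)) \<Rightarrow>
     ('a, 'e) module \<Rightarrow> 'e set \<Rightarrow> nat \<Rightarrow> bool" where
  "cohomology_vanishes R b d E C i \<longleftrightarrow>
    (\<forall>f. cocycle R b d E C (Suc i) f \<longrightarrow>
      (\<exists>h. cochain R b E C i h \<and> (\<forall>z\<in>carrier (free_module R (b (Suc i))). f z = h (d i z))))"

text \<open>This is H = x H for the cohomology H in degree i + 1, stated on cocycles to avoid
  forming a quotient.\<close>

definition cohomology_divisible ::
    "('a, 'b) ring_scheme \<Rightarrow> (nat \<Rightarrow> nat) \<Rightarrow> (nat \<Rightarrow> (nat \<Rightarrow> 'a) \<Rightarrow> (nat \<Rightarrow> 'a)) \<Rightarrow>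
     ('a, 'e) module \<Rightarrow> 'e set \<Rightarrow> 'a \<Rightarrow> nat \<Rightarrow> bool" where
  "cohomology_divisible R b d E C x i \<longleftrightarrow>
    (\<forall>f. cocycle R b d E C (Suc i) f \<longrightarrow>
      (\<exists>g h. cocycle R b d E C (Suc i) g \<and> cochain R b E C i h \<and>
        (\<forall>z\<in>carrier (free_module R (b (Suc i))). f z = x \<odot>\<^bsub>E\<^esub> g z \<oplus>\<^bsub>E\<^esub> h (d i z))))"

text \<open>Exactness is required in positive degrees only: the complex resolves the cokernel of
  \<open>d 0\<close>, whatever that is.\<close>

locale free_complex = noetherian_local +
  fixes b :: "nat \<Rightarrow> nat" and d :: "nat \<Rightarrow> (nat \<Rightarrow> 'a) \<Rightarrow> (nat \<Rightarrow> 'a)"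
  assumes d_hom: "is_module_hom R (free_module R (b (Suc i))) (free_module R (b i)) (d i)"
    and exact: "d (Suc i) ` carrier (free_module R (b (Suc (Suc i)))) =
      module_kernel (free_module R (b (Suc i))) (free_module R (b i)) (d i)"
begin

abbreviation F :: "nat \<Rightarrow> ('a, nat \<Rightarrow> 'a) module" where "F i \<equiv> free_module R (b i)"

lemma F_module: "module R (F i)" by (rule free_module_module)

lemma d_closed: "z \<in> carrier (F (Suc i)) \<Longrightarrow> d i z \<in> carrier (F i)"
  using is_module_homD(1)[OF d_hom] .

lemma d_d: "z \<in> carrier (F (Suc (Suc i))) \<Longrightarrow> d i (d (Suc i) z) = \<zero>\<^bsub>F i\<^esub>"
  using exact[of i] by (auto simp: module_kernel_def)

lemma exactE:
  assumes "y \<in> carrier (F (Suc i))" "d i y = \<zero>\<^bsub>F i\<^esub>"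
  obtains z where "z \<in> carrier (F (Suc (Suc i)))" "y = d (Suc i) z"
  using exact[of i] assms unfolding module_kernel_def by blast

text \<open>By exactness q kills the kernel of \<open>d i\<close>. In other words, cohomology with
  values in an injective module vanishes in positive degrees, which drives both dimension
  shifts.\<close>

lemma factor_d:
  assumes E: "injective_module R E" and q: "is_module_hom R (F (Suc i)) E q"
    and ker: "\<And>z. z \<in> carrier (F (Suc (Suc i))) \<Longrightarrow> q (d (Suc i) z) = \<zero>\<^bsub>E\<^esub>"
  obtains h where "is_module_hom R (F i) E h"
    "\<And>z. z \<in> carrier (F (Suc i)) \<Longrightarrow> h (d i z) = q z"
  by (rule injective_factor[OF is_cring E F_module d_hom q])
    (use ker in \<open>auto elim: exactE intro: that\<close>)

context
  fixes E :: "('a, 'e) module" and E' :: "('a, 'e) module" and p C C'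
  assumes E: "injective_module R E" and E': "module R E'" and p: "is_module_hom R E E' p"
    and onto: "p ` carrier E = C'" and ker: "C = module_kernel E E' p"
begin

lemma E_module: "module R E" using E by (simp add: injective_module_def)

lemma in_C: "c \<in> C \<longleftrightarrow> c \<in> carrier E \<and> p c = \<zero>\<^bsub>E'\<^esub>" by (auto simp: ker module_kernel_def)

lemma lift_p:
  assumes "cochain R b E' C' i f"
  obtains g where "is_module_hom R (F i) E g" "\<And>z. z \<in> carrier (F i) \<Longrightarrow> p (g z) = f z"
  using free_module_lift[OF E_module E' p, of "b i" f] assms onto
  by (auto simp: cochain_def)

text \<open>For 0 \<rightarrow> C \<rightarrow> E \<rightarrow> C' \<rightarrow> 0 with E injective,
  the connecting map from degree i + 1 over C' to degree i + 2 over C is onto, so divisibility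
  passes along it.\<close>

lemma cohomology_divisible_shift:
  assumes x: "x \<in> carrier R" and div: "cohomology_divisible R b d E' C' x i"
  shows "cohomology_divisible R b d E C x (Suc i)"
  unfolding cohomology_divisible_def
proof (intro allI impI)
  interpret E: module R E by (rule E_module)
  interpret E': module R E' by (rule E')
  note Dp = is_module_homD[OF p] and pm = is_module_hom_zero_minus(2)[OF E_module E' p]
  fix f assume f: "cocycle R b d E C (Suc (Suc i)) f"
  then have f_hom: "is_module_hom R (F (Suc (Suc i))) E f"
    and f_C: "\<And>z. z \<in> carrier (F (Suc (Suc i))) \<Longrightarrow> f z \<in> C"
    and f_d: "\<And>z. z \<in> carrier (F (Suc (Suc (Suc i)))) \<Longrightarrow> f (d (Suc (Suc i)) z) = \<zero>\<^bsub>E\<^esub>"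
    by (auto simp: cocycle_def cochain_def)
  obtain h0 where h0: "is_module_hom R (F (Suc i)) E h0"
    "\<And>z. z \<in> carrier (F (Suc (Suc i))) \<Longrightarrow> h0 (d (Suc i) z) = f z"
    using factor_d[OF E f_hom f_d] by blast
  \<comment> \<open>The connecting map sends the class of p h0 to the class of f.\<close>
  have "cocycle R b d E' C' (Suc i) (\<lambda>y. p (h0 y))"
    using is_module_hom_compose[OF h0(1) p] is_module_homD(1)[OF h0(1)] onto f_C in_C
    by (auto simp: cocycle_def cochain_def h0(2))
  then obtain g' h' where g': "cocycle R b d E' C' (Suc i) g'" and h': "cochain R b E' C' i h'"
    and eq: "\<And>z. z \<in> carrier (F (Suc i)) \<Longrightarrow> p (h0 z) = x \<odot>\<^bsub>E'\<^esub> g' z \<oplus>\<^bsub>E'\<^esub> h' (d i z)"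
    using div unfolding cohomology_divisible_def by blast
  have g'_cochain: "cochain R b E' C' (Suc i) g'" using g' by (simp add: cocycle_def)
  obtain g where g: "is_module_hom R (F (Suc i)) E g"
    "\<And>z. z \<in> carrier (F (Suc i)) \<Longrightarrow> p (g z) = g' z" using lift_p[OF g'_cochain] by blast
  obtain h where h: "is_module_hom R (F i) E h"
    "\<And>z. z \<in> carrier (F i) \<Longrightarrow> p (h z) = h' z" using lift_p[OF h'] by blast
  note cl = is_module_homD(1)[OF g(1)] is_module_homD(1)[OF h(1)] is_module_homD(1)[OF h0(1)]
  \<comment> \<open>\<open>?g\<close> represents the image of g' under the connecting map.
    \<open>?h\<close> is what x g + h d leaves of h0; it takes values in C because p maps it to
    zero. The term with h disappears after composition with the next differential.\<close>
  let ?g = "\<lambda>z. g (d (Suc i) z)"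
  let ?h = "\<lambda>y. h0 y \<ominus>\<^bsub>E\<^esub> (x \<odot>\<^bsub>E\<^esub> g y \<oplus>\<^bsub>E\<^esub> h (d i y))"
  have "cocycle R b d E C (Suc (Suc i)) ?g"
    using is_module_hom_compose[OF d_hom g(1)] g' in_C cl(1) d_closed g(2)
      d_d is_module_hom_zero_minus(1)[OF F_module E_module g(1)]
    by (auto simp: cocycle_def cochain_def)
  moreover have "cochain R b E C (Suc i) ?h"
  proof -
    have "is_module_hom R (F (Suc i)) E ?h"
      by (intro is_module_hom_minus is_module_hom_add is_module_hom_smult E_module h0(1) g(1) x
          is_module_hom_compose[OF d_hom h(1)])
    moreover have "?h y \<in> C" if y: "y \<in> carrier (F (Suc i))" for y
    proof -
      have "x \<odot>\<^bsub>E\<^esub> g y \<oplus>\<^bsub>E\<^esub> h (d i y) \<in> carrier E" using cl x y d_closed by simp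
      moreover have "p (x \<odot>\<^bsub>E\<^esub> g y \<oplus>\<^bsub>E\<^esub> h (d i y)) = p (h0 y)"
        using cl x y d_closed by (simp add: Dp g h eq)
      ultimately show ?thesis using cl(3)[OF y] Dp(1) by (simp add: in_C pm E'.minus_eq_zero_iff)
    qed
    ultimately show ?thesis by (simp add: cochain_def)
  qed
  moreover have "f z = x \<odot>\<^bsub>E\<^esub> ?g z \<oplus>\<^bsub>E\<^esub> ?h (d (Suc i) z)" if z: "z \<in> carrier (F (Suc (Suc i)))" for z
  proof -
    have "h (d i (d (Suc i) z)) = \<zero>\<^bsub>E\<^esub>"
      using d_d[OF z] is_module_hom_zero_minus(1)[OF F_module E_module h(1)] by simp
    then have "?h (d (Suc i) z) = f z \<ominus>\<^bsub>E\<^esub> x \<odot>\<^bsub>E\<^esub> ?g z"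
      using cl(1) d_closed[OF z] x z by (simp add: h0(2))
    moreover have "f z \<in> carrier E" "x \<odot>\<^bsub>E\<^esub> ?g z \<in> carrier E"
      using is_module_homD(1)[OF f_hom z] cl(1) d_closed[OF z] x by auto
    ultimately show ?thesis using E.minus_cancel E.a_comm by (metis E.minus_closed)
  qed
  ultimately show "\<exists>g h. cocycle R b d E C (Suc (Suc i)) g \<and> cochain R b E C (Suc i) h \<and>
      (\<forall>z\<in>carrier (F (Suc (Suc i))). f z = x \<odot>\<^bsub>E\<^esub> g z \<oplus>\<^bsub>E\<^esub> h (d (Suc i) z))"
    by (intro exI[of _ ?g] exI[of _ ?h]) simp
qed

text \<open>The same connecting map is also injective, so vanishing travels in the opposite
  direction.\<close>

lemma cohomology_vanishes_shift:
  assumes van: "cohomology_vanishes R b d E C (Suc i)"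
  shows "cohomology_vanishes R b d E' C' i"
  unfolding cohomology_vanishes_def
proof (intro allI impI)
  interpret E: module R E by (rule E_module)
  interpret E': module R E' by (rule E')
  note Dp = is_module_homD[OF p] and pm = is_module_hom_zero_minus(2)[OF E_module E' p]
  fix f assume f: "cocycle R b d E' C' (Suc i) f"
  then have f_d: "\<And>z. z \<in> carrier (F (Suc (Suc i))) \<Longrightarrow> f (d (Suc i) z) = \<zero>\<^bsub>E'\<^esub>"
    and f_cochain: "cochain R b E' C' (Suc i) f"
    by (auto simp: cocycle_def)
  obtain g where g: "is_module_hom R (F (Suc i)) E g"
    "\<And>z. z \<in> carrier (F (Suc i)) \<Longrightarrow> p (g z) = f z" using lift_p[OF f_cochain] by blast
  have "cocycle R b d E C (Suc (Suc i)) (\<lambda>z. g (d (Suc i) z))"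
    using is_module_hom_compose[OF d_hom g(1)] in_C is_module_homD(1)[OF g(1)] d_closed g(2) f_d
      d_d is_module_hom_zero_minus(1)[OF F_module E_module g(1)]
    by (auto simp: cocycle_def cochain_def)
  then obtain h where h: "cochain R b E C (Suc i) h"
    "\<And>z. z \<in> carrier (F (Suc (Suc i))) \<Longrightarrow> g (d (Suc i) z) = h (d (Suc i) z)"
    using van unfolding cohomology_vanishes_def by blast
  have h_hom: "is_module_hom R (F (Suc i)) E h" and h_C: "\<And>z. z \<in> carrier (F (Suc i)) \<Longrightarrow> h z \<in> C"
    using h(1) by (auto simp: cochain_def)
  \<comment> \<open>The difference g - h kills the image of the differential and hence factors
    through \<open>d i\<close>; applying p removes h and leaves f.\<close>
  have "g (d (Suc i) z) \<ominus>\<^bsub>E\<^esub> h (d (Suc i) z) = \<zero>\<^bsub>E\<^esub>" if "z \<in> carrier (F (Suc (Suc i)))" for z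
    using h(2)[OF that] is_module_homD(1)[OF h_hom d_closed[OF that]]
    by (simp add: E.minus_eq_zero_iff)
  from factor_d[OF E is_module_hom_minus[OF E_module g(1) h_hom] this] obtain k
    where k: "is_module_hom R (F i) E k"
      "\<And>z. z \<in> carrier (F (Suc i)) \<Longrightarrow> k (d i z) = g z \<ominus>\<^bsub>E\<^esub> h z" by blast
  have "cochain R b E' C' i (\<lambda>y. p (k y))"
    using is_module_hom_compose[OF k(1) p] is_module_homD(1)[OF k(1)] onto by (auto simp: cochain_def)
  moreover have "f z = p (k (d i z))" if z: "z \<in> carrier (F (Suc i))" for z
    using is_module_homD(1)[OF g(1) z] h_C[OF z] Dp(1) z
    by (simp add: k(2) pm in_C g(2)[symmetric]) (simp add: a_minus_def)
  ultimately show "\<exists>h. cochain R b E' C' i h \<and> (\<forall>z\<in>carrier (F (Suc i)). f z = h (d i z))"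
    by blast
qed

end

text \<open>Here \<open>C\<close> is a copy of \<open>R\<close>, so that the cohomology is finitely generated and Nakayama's
  lemma applies.\<close>

lemma divisible_imp_vanishes:
  assumes E: "module R E" and e: "is_module_hom R (regular_module R) E e"
    and inj: "inj_on e (carrier R)" and C: "C = e ` carrier R"
    and x: "x \<in> \<mm>" and div: "cohomology_divisible R b d E C x i"
  shows "cohomology_vanishes R b d E C i"
proof -
  interpret E: module R E by (rule E)
  interpret RR: module R "regular_module R" by (rule regular_module_module)
  interpret FS: module R "F (Suc i)" by (rule F_module)
  note De = is_module_homD[OF e, unfolded regular_module_simps]
  have e0: "e \<zero> = \<zero>\<^bsub>E\<^esub>"
    using is_module_hom_zero_minus(1)[OF RR.module_axioms E e] by (simp add: regular_module_simps)
  have Csub: "submodule C R E"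
    using submodule_image[OF RR.module_axioms E e RR.carrier_is_submodule]
    by (simp add: C regular_module_simps)
  note DC = E.submoduleD[OF Csub]
  let ?N = "b (Suc i)"
  \<comment> \<open>A cochain with values in the copy C of R is recorded by its values on the unit
    vectors, pulled back along e. Cocycles and coboundaries thus become submodules Z and B of one
    free module of finite rank.\<close>
  define coord where "coord f v \<longleftrightarrow> v \<in> carrier (F (Suc i)) \<and> (\<forall>j<?N. e (v j) = f (unit_vector R j))"
    for f v
  have coord_ex: "\<exists>v. coord f v" if "cochain R b E C (Suc i) f" for f
  proof -
    have "\<exists>r. r \<in> carrier R \<and> e r = f (unit_vector R j)" if "j < ?N" for j
      using \<open>cochain R b E C (Suc i) f\<close> unit_vector_closed[OF that] by (force simp: cochain_def C)
    then obtain v where v: "\<And>j. j < ?N \<Longrightarrow> v j \<in> carrier R \<and> e (v j) = f (unit_vector R j)" by metis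
    then have "coord f (\<lambda>j. if j < ?N then v j else \<zero>)" by (auto simp: coord_def free_module_simps)
    then show ?thesis by blast
  qed
  have coord_sub: "submodule {v. \<exists>f. P f \<and> coord f v} R (F (Suc i))" (is "submodule ?S _ _")
    if 0: "P (\<lambda>z. \<zero>\<^bsub>E\<^esub>)" and add: "\<And>f g. P f \<Longrightarrow> P g \<Longrightarrow> P (\<lambda>z. f z \<oplus>\<^bsub>E\<^esub> g z)"
      and smult: "\<And>a f. a \<in> carrier R \<Longrightarrow> P f \<Longrightarrow> P (\<lambda>z. a \<odot>\<^bsub>E\<^esub> f z)" for P
  proof (rule FS.submoduleI')
    show "?S \<subseteq> carrier (F (Suc i))" by (auto simp: coord_def)
    show "\<zero>\<^bsub>F (Suc i)\<^esub> \<in> ?S" using 0 e0 by (auto simp: coord_def free_module_simps)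
  next
    fix v w assume "v \<in> ?S" "w \<in> ?S"
    then obtain f g where fg: "P f" "P g" "coord f v" "coord g w" by blast
    then have "coord (\<lambda>z. f z \<oplus>\<^bsub>E\<^esub> g z) (v \<oplus>\<^bsub>F (Suc i)\<^esub> w)"
      using FS.a_closed De(2) by (auto simp: coord_def free_module_closed) (auto simp: free_module_simps De)
    then show "v \<oplus>\<^bsub>F (Suc i)\<^esub> w \<in> ?S" using add fg(1,2) by blast
  next
    fix a v assume a: "a \<in> carrier R" and "v \<in> ?S"
    then obtain f where f: "P f" "coord f v" by blast
    then have "coord (\<lambda>z. a \<odot>\<^bsub>E\<^esub> f z) (a \<odot>\<^bsub>F (Suc i)\<^esub> v)"
      using FS.smult_closed a by (auto simp: coord_def) (auto simp: free_module_simps De)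
    then show "a \<odot>\<^bsub>F (Suc i)\<^esub> v \<in> ?S" using smult a f(1) by blast
  qed
  have zero_hom: "is_module_hom R M E (\<lambda>z. \<zero>\<^bsub>E\<^esub>)" for M :: "('a, nat \<Rightarrow> 'a) module"
    by (rule is_module_homI) auto
  define Z where "Z = {v. \<exists>f. cocycle R b d E C (Suc i) f \<and> coord f v}"
  have Z: "submodule Z R (F (Suc i))"
    unfolding Z_def
  proof (rule coord_sub)
    fix f g assume "cocycle R b d E C (Suc i) f" "cocycle R b d E C (Suc i) g"
    then show "cocycle R b d E C (Suc i) (\<lambda>z. f z \<oplus>\<^bsub>E\<^esub> g z)"
      using DC by (auto simp: cocycle_def cochain_def intro: is_module_hom_add[OF E])
  next
    fix a f assume "a \<in> carrier R" "cocycle R b d E C (Suc i) f"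
    then show "cocycle R b d E C (Suc i) (\<lambda>z. a \<odot>\<^bsub>E\<^esub> f z)"
      using DC by (auto simp: cocycle_def cochain_def intro: is_module_hom_smult[OF E])
  qed (use DC zero_hom in \<open>auto simp: cocycle_def cochain_def\<close>)
  define B where "B = {v. \<exists>f. (\<exists>h. cochain R b E C i h \<and>
    (\<forall>z\<in>carrier (F (Suc i)). f z = h (d i z))) \<and> coord f v}"
  have B: "submodule B R (F (Suc i))"
    unfolding B_def
  proof (rule coord_sub)
    fix f g
    assume "\<exists>h. cochain R b E C i h \<and> (\<forall>z\<in>carrier (F (Suc i)). f z = h (d i z))"
      "\<exists>h. cochain R b E C i h \<and> (\<forall>z\<in>carrier (F (Suc i)). g z = h (d i z))"
    then obtain h k where "cochain R b E C i h" "\<forall>z\<in>carrier (F (Suc i)). f z = h (d i z)"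
      "cochain R b E C i k" "\<forall>z\<in>carrier (F (Suc i)). g z = k (d i z)" by blast
    then show "\<exists>h. cochain R b E C i h \<and> (\<forall>z\<in>carrier (F (Suc i)). f z \<oplus>\<^bsub>E\<^esub> g z = h (d i z))"
      using DC by (intro exI[of _ "\<lambda>z. h z \<oplus>\<^bsub>E\<^esub> k z"]) (auto simp: cochain_def intro: is_module_hom_add[OF E])
  next
    fix a f
    assume a: "a \<in> carrier R"
      and "\<exists>h. cochain R b E C i h \<and> (\<forall>z\<in>carrier (F (Suc i)). f z = h (d i z))"
    then obtain h where "cochain R b E C i h" "\<forall>z\<in>carrier (F (Suc i)). f z = h (d i z)" by blast
    then show "\<exists>h. cochain R b E C i h \<and> (\<forall>z\<in>carrier (F (Suc i)). a \<odot>\<^bsub>E\<^esub> f z = h (d i z))"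
      using DC a by (intro exI[of _ "\<lambda>z. a \<odot>\<^bsub>E\<^esub> h z"]) (auto simp: cochain_def intro: is_module_hom_smult[OF E])
  next
    show "\<exists>h. cochain R b E C i h \<and> (\<forall>z\<in>carrier (F (Suc i)). \<zero>\<^bsub>E\<^esub> = h (d i z))"
      using DC zero_hom by (intro exI[of _ "\<lambda>z. \<zero>\<^bsub>E\<^esub>"]) (auto simp: cochain_def)
  qed
  have xR: "x \<in> carrier R" using x by (rule max_ideal_sub)
  \<comment> \<open>Divisibility gives Z \<subseteq> B + x Z, which is Nakayama's condition as x
    lies in \<mm>.\<close>
  have "Z \<subseteq> B"
  proof (rule nakayama[OF F_module fin_gen_free[OF is_cring noetherian_ring_axioms Z] Z B])
    fix L assume L: "submodule L R (F (Suc i))" "B \<subseteq> L"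
      "\<And>a k. \<lbrakk>a \<in> \<mm>; k \<in> Z\<rbrakk> \<Longrightarrow> a \<odot>\<^bsub>F (Suc i)\<^esub> k \<in> L"
    show "Z \<subseteq> L"
    proof
      fix v assume "v \<in> Z"
      then obtain f where f: "cocycle R b d E C (Suc i) f" "coord f v" by (auto simp: Z_def)
      then obtain g h where gh: "cocycle R b d E C (Suc i) g" "cochain R b E C i h"
        "\<And>z. z \<in> carrier (F (Suc i)) \<Longrightarrow> f z = x \<odot>\<^bsub>E\<^esub> g z \<oplus>\<^bsub>E\<^esub> h (d i z)"
        using div unfolding cohomology_divisible_def by blast
      let ?h = "\<lambda>z. h (d i z)"
      have h_cochain: "cochain R b E C (Suc i) ?h"
        using gh(2) is_module_hom_compose[OF d_hom] d_closed by (auto simp: cochain_def)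
      obtain w where w: "coord g w" using coord_ex gh(1) by (auto simp: cocycle_def)
      obtain u where u: "coord ?h u" using coord_ex[OF h_cochain] by blast
      have "w \<in> Z" "u \<in> B" using w u gh by (auto simp: Z_def B_def)
      have "v j = (x \<odot>\<^bsub>F (Suc i)\<^esub> w \<oplus>\<^bsub>F (Suc i)\<^esub> u) j" for j
      proof (cases "j < ?N")
        case True
        have cl: "v j \<in> carrier R" "w j \<in> carrier R" "u j \<in> carrier R"
          using f(2) w u by (auto simp: coord_def intro: free_module_closed)
        have "e (v j) = e (x \<otimes> w j \<oplus> u j)"
          using True f(2) w u cl xR unit_vector_closed[OF True] by (simp add: coord_def gh(3) De)
        then show ?thesis using inj cl xR by (simp add: free_module_simps inj_on_def)
      next
        case False
        then show ?thesis using f(2) w u xR by (simp add: coord_def free_module_simps)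
      qed
      then have "v = x \<odot>\<^bsub>F (Suc i)\<^esub> w \<oplus>\<^bsub>F (Suc i)\<^esub> u" by blast
      moreover have "x \<odot>\<^bsub>F (Suc i)\<^esub> w \<in> L" using L(3)[OF x \<open>w \<in> Z\<close>] .
      moreover have "u \<in> L" using L(2) \<open>u \<in> B\<close> by blast
      ultimately show "v \<in> L" using FS.submoduleD(3)[OF L(1)] by simp
    qed
  qed
  show ?thesis
    unfolding cohomology_vanishes_def
  proof (intro allI impI)
    fix f assume f: "cocycle R b d E C (Suc i) f"
    obtain v where v: "coord f v" using coord_ex f by (auto simp: cocycle_def)
    then have "v \<in> B" using \<open>Z \<subseteq> B\<close> f by (auto simp: Z_def)
    then obtain f' h where h: "cochain R b E C i h" "\<forall>z\<in>carrier (F (Suc i)). f' z = h (d i z)"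
      "coord f' v" by (auto simp: B_def)
    have h_hom: "is_module_hom R (F (Suc i)) E (\<lambda>z. h (d i z))"
      using h(1) is_module_hom_compose[OF d_hom] by (auto simp: cochain_def)
    have f_hom: "is_module_hom R (F (Suc i)) E f" using f by (auto simp: cocycle_def cochain_def)
    have "f z = h (d i z)" if z: "z \<in> carrier (F (Suc i))" for z
      by (rule hom_free_cong[OF E f_hom h_hom _ z])
        (use v h unit_vector_closed in \<open>auto simp: coord_def\<close>)
    then show "\<exists>h. cochain R b E C i h \<and> (\<forall>z\<in>carrier (F (Suc i)). f z = h (d i z))" using h(1) by blast
  qed
qed

end

section \<open>Degree one of a resolution of R/P\<close>

context free_complex
begin

context
  fixes P :: "'a set"
  assumes b0: "b 0 = 1" and P: "primeideal P R"
    and image: "d 0 ` carrier (free_module R (b 1)) = {w \<in> carrier (free_module R 1). w 0 \<in> P}"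
begin

lemma P_closed: "a \<in> P \<Longrightarrow> a \<in> carrier R"
  using idealD(1)[OF primeideal.axioms(1)[OF P]] by blast

lemma d0_in_P: "z \<in> carrier (F 1) \<Longrightarrow> d 0 z 0 \<in> P"
  using image by auto

lemma d0E:
  assumes "a \<in> P"
  obtains z where "z \<in> carrier (F 1)" "d 0 z = a \<odot>\<^bsub>F 0\<^esub> unit_vector R 0"
proof -
  have "a \<odot>\<^bsub>F 0\<^esub> unit_vector R 0 \<in> {w \<in> carrier (free_module R 1). w 0 \<in> P}"
    using assms P_closed by (auto simp: b0 free_module_simps unit_vector_def)
  then show thesis using that unfolding image[symmetric] by auto
qed

lemma hom_F0:
  assumes E: "module R E" and h: "is_module_hom R (F 0) E h" and w: "w \<in> carrier (F 0)"
  shows "h w = w 0 \<odot>\<^bsub>E\<^esub> h (unit_vector R 0)"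
proof -
  have "w = w 0 \<odot>\<^bsub>F 0\<^esub> unit_vector R 0"
    using w by (auto simp: b0 free_module_simps unit_vector_def fun_eq_iff)
  then have "h w = h (w 0 \<odot>\<^bsub>F 0\<^esub> unit_vector R 0)" by simp
  also have "\<dots> = w 0 \<odot>\<^bsub>E\<^esub> h (unit_vector R 0)"
    using is_module_homD(3)[OF h free_module_closed[OF w]] unit_vector_closed[of 0 1] b0 by simp
  finally show ?thesis .
qed

lemma smult_hom_F0:
  assumes E: "module R E" and u: "u \<in> carrier E"
  shows "is_module_hom R (F 0) E (\<lambda>w. w 0 \<odot>\<^bsub>E\<^esub> u)"
proof -
  interpret E: module R E by (rule E)
  show ?thesis
    by (rule is_module_homI) (use u in \<open>auto simp: b0 free_module_simps E.smult_l_distr E.smult_assoc1\<close>)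
qed

text \<open>This is the connecting map from the elements of E/C killed by P to the first Ext module
  of R/P with values in C, written on representatives.\<close>

lemma smult_d0_cocycle:
  assumes E: "module R E" and u: "u \<in> carrier E" and C: "\<And>a. a \<in> P \<Longrightarrow> a \<odot>\<^bsub>E\<^esub> u \<in> C"
  shows "cocycle R b d E C (Suc 0) (\<lambda>z. d 0 z 0 \<odot>\<^bsub>E\<^esub> u)"
proof -
  interpret E: module R E by (rule E)
  show ?thesis
    using is_module_hom_compose[OF d_hom[of 0] smult_hom_F0[OF E u]] C d0_in_P d_d[of _ 0] u
    by (auto simp: cocycle_def cochain_def free_module_simps)
qed

text \<open>Since E is injective, a cocycle has the form z \<mapsto> (d 0 z) e with P e \<subseteq>
  C. As x lies outside the prime P, a x \<in> P forces a \<in> P, and principal injectivity of C'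
  divides the class of e by x among the elements killed by P.\<close>

lemma divisible_degree_one:
  assumes E: "injective_module R E" and E': "module R E'" and p: "is_module_hom R E E' p"
    and onto: "p ` carrier E = C'" and ker: "C = module_kernel E E' p"
    and pinj: "principally_injective R E' C'" and x: "x \<in> carrier R" "x \<notin> P"
  shows "cohomology_divisible R b d E C x 0"
  unfolding cohomology_divisible_def
proof (intro allI impI)
  interpret E: module R E using E by (simp add: injective_module_def)
  interpret E': module R E' by (rule E')
  interpret P: primeideal P R by (rule P)
  note Dp = is_module_homD[OF p] and pm = is_module_hom_zero_minus(2)[OF E.module_axioms E' p]
  have C: "c \<in> C \<longleftrightarrow> c \<in> carrier E \<and> p c = \<zero>\<^bsub>E'\<^esub>" for c by (auto simp: ker module_kernel_def)
  have u: "unit_vector R 0 \<in> carrier (F 0)" using unit_vector_closed[of 0 1] b0 by simp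
  fix f assume f: "cocycle R b d E C (Suc 0) f"
  then have f_hom: "is_module_hom R (F (Suc 0)) E f"
    and f_C: "\<And>z. z \<in> carrier (F (Suc 0)) \<Longrightarrow> f z \<in> C"
    and f_d: "\<And>z. z \<in> carrier (F (Suc (Suc 0))) \<Longrightarrow> f (d (Suc 0) z) = \<zero>\<^bsub>E\<^esub>"
    by (auto simp: cocycle_def cochain_def)
  obtain h0 where h0: "is_module_hom R (F 0) E h0" "\<And>z. z \<in> carrier (F 1) \<Longrightarrow> h0 (d 0 z) = f z"
    using factor_d[OF E f_hom f_d] by auto
  define e where "e = h0 (unit_vector R 0)"
  have e: "e \<in> carrier E" using is_module_homD(1)[OF h0(1) u] by (simp add: e_def)
  have fe: "f z = d 0 z 0 \<odot>\<^bsub>E\<^esub> e" if "z \<in> carrier (F 1)" for z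
    using h0(2)[OF that] hom_F0[OF E.module_axioms h0(1) d_closed[of z 0]] that by (simp add: e_def)
  have Pe: "a \<odot>\<^bsub>E\<^esub> e \<in> C" if a: "a \<in> P" for a
  proof -
    obtain z where z: "z \<in> carrier (F 1)" "d 0 z = a \<odot>\<^bsub>F 0\<^esub> unit_vector R 0" using d0E[OF a] .
    have "d 0 z 0 = a" using z(2) P_closed[OF a] by (simp add: free_module_simps unit_vector_def)
    then show ?thesis using fe[OF z(1)] f_C[of z] z(1) by simp
  qed
  have "a \<odot>\<^bsub>E'\<^esub> p e = \<zero>\<^bsub>E'\<^esub>" if a: "a \<in> carrier R" "a \<otimes> x \<in> P" for a
    using P.I_prime[OF a(1) x(1) a(2)] x(2) Pe C Dp(3) a(1) e by auto
  from principally_injectiveE[OF pinj P.is_ideal x(1) _ this] onto e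
  obtain c where c: "c \<in> C'" "\<And>a. a \<in> P \<Longrightarrow> a \<odot>\<^bsub>E'\<^esub> c = \<zero>\<^bsub>E'\<^esub>" "p e = x \<odot>\<^bsub>E'\<^esub> c" by blast
  obtain v where v: "v \<in> carrier E" "c = p v" using c(1) onto by blast
  \<comment> \<open>In e = x v + (e - x v) the first term gives the multiple of a cocycle; the
    second lies in C and gives the coboundary.\<close>
  let ?g = "\<lambda>z. d 0 z 0 \<odot>\<^bsub>E\<^esub> v" and ?h = "\<lambda>w. w 0 \<odot>\<^bsub>E\<^esub> (e \<ominus>\<^bsub>E\<^esub> x \<odot>\<^bsub>E\<^esub> v)"
  have "cocycle R b d E C (Suc 0) ?g"
    using smult_d0_cocycle[OF E.module_axioms v(1)] C c(2) v Dp P_closed by auto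
  moreover have "cochain R b E C 0 ?h"
  proof -
    have "e \<ominus>\<^bsub>E\<^esub> x \<odot>\<^bsub>E\<^esub> v \<in> C"
      using e v x c Dp(1)[OF e] by (simp add: C pm Dp(3) E'.minus_eq_zero_iff)
    then show ?thesis
      using smult_hom_F0[OF E.module_axioms, of "e \<ominus>\<^bsub>E\<^esub> x \<odot>\<^bsub>E\<^esub> v"] C free_module_closed
      by (auto simp: cochain_def Dp(3))
  qed
  moreover have "f z = x \<odot>\<^bsub>E\<^esub> ?g z \<oplus>\<^bsub>E\<^esub> ?h (d 0 z)" if z: "z \<in> carrier (F 1)" for z
  proof -
    have r: "d 0 z 0 \<in> carrier R" using d0_in_P[OF z] P_closed by blast
    have "x \<odot>\<^bsub>E\<^esub> ?g z \<oplus>\<^bsub>E\<^esub> ?h (d 0 z) =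
        x \<odot>\<^bsub>E\<^esub> ?g z \<oplus>\<^bsub>E\<^esub> (d 0 z 0 \<odot>\<^bsub>E\<^esub> e \<ominus>\<^bsub>E\<^esub> x \<odot>\<^bsub>E\<^esub> ?g z)"
      using r e v x by (simp add: E.minus_smult_r E.smult_left_commute[of x])
    also have "\<dots> = d 0 z 0 \<odot>\<^bsub>E\<^esub> e"
      using E.minus_cancel[of "d 0 z 0 \<odot>\<^bsub>E\<^esub> e" "x \<odot>\<^bsub>E\<^esub> ?g z"] r e v x by (simp add: E.a_comm)
    finally show ?thesis using fe[OF z] by simp
  qed
  ultimately show "\<exists>g h. cocycle R b d E C (Suc 0) g \<and> cochain R b E C 0 h \<and>
      (\<forall>z\<in>carrier (F (Suc 0)). f z = x \<odot>\<^bsub>E\<^esub> g z \<oplus>\<^bsub>E\<^esub> h (d 0 z))"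
    by (intro exI[of _ ?g] exI[of _ ?h]) simp
qed

text \<open>If the cocycle attached to u is a coboundary, some c in C satisfies a u = a c for all a
  in P, and u - c is the element annihilated by P.\<close>

lemma vanishes_annihilator_lifting:
  assumes E: "module R E" and C: "submodule C R E" and van: "cohomology_vanishes R b d E C 0"
  shows "annihilator_lifting E C P"
  unfolding annihilator_lifting_def
proof (intro ballI impI)
  interpret E: module R E by (rule E)
  note DC = E.submoduleD[OF C]
  fix u assume u: "u \<in> carrier E" "\<forall>a\<in>P. a \<odot>\<^bsub>E\<^esub> u \<in> C"
  have "cocycle R b d E C (Suc 0) (\<lambda>z. d 0 z 0 \<odot>\<^bsub>E\<^esub> u)"
    by (rule smult_d0_cocycle[OF E]) (use u in auto)
  then obtain h where h: "cochain R b E C 0 h"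
    "\<And>z. z \<in> carrier (F 1) \<Longrightarrow> d 0 z 0 \<odot>\<^bsub>E\<^esub> u = h (d 0 z)"
    using van unfolding cohomology_vanishes_def by auto
  define c where "c = h (unit_vector R 0)"
  have c: "c \<in> C" using h(1) unit_vector_closed[of 0 1] b0 by (auto simp: cochain_def c_def)
  then have cE: "c \<in> carrier E" using DC(1) by blast
  have "a \<odot>\<^bsub>E\<^esub> (u \<ominus>\<^bsub>E\<^esub> c) = \<zero>\<^bsub>E\<^esub>" if a: "a \<in> P" for a
  proof -
    have aR: "a \<in> carrier R" using a by (rule P_closed)
    obtain z where z: "z \<in> carrier (F 1)" "d 0 z = a \<odot>\<^bsub>F 0\<^esub> unit_vector R 0" using d0E[OF a] .
    have "d 0 z 0 = a" using z(2) aR by (simp add: free_module_simps unit_vector_def)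
    moreover have "h (d 0 z) = d 0 z 0 \<odot>\<^bsub>E\<^esub> c"
      unfolding c_def by (rule hom_F0[OF E]) (use h(1) d_closed[of z 0] z in \<open>auto simp: cochain_def\<close>)
    ultimately have "a \<odot>\<^bsub>E\<^esub> u = a \<odot>\<^bsub>E\<^esub> c" using h(2)[OF z(1)] by simp
    then show ?thesis using aR u cE by (simp add: E.minus_smult_r E.minus_eq_zero_iff)
  qed
  moreover have "u \<ominus>\<^bsub>E\<^esub> (u \<ominus>\<^bsub>E\<^esub> c) = c"
    using u cE by (simp add: a_minus_def E.minus_add E.M.a_assoc[symmetric] E.r_neg)
  ultimately show "\<exists>w\<in>carrier E. (\<forall>a\<in>P. a \<odot>\<^bsub>E\<^esub> w = \<zero>\<^bsub>E\<^esub>) \<and> u \<ominus>\<^bsub>E\<^esub> w \<in> C"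
    using u cE c by (intro bexI[of _ "u \<ominus>\<^bsub>E\<^esub> c"]) auto
qed

end

end

section \<open>Descent along an injective resolution\<close>

locale finite_injdim = noetherian_local +
  fixes E :: "nat \<Rightarrow> ('a, 'e) module" and \<delta> :: "nat \<Rightarrow> 'e \<Rightarrow> 'e" and \<epsilon> :: "'a \<Rightarrow> 'e" and n :: nat
  assumes resolution: "injective_resolution R (regular_module R) E \<delta> \<epsilon>"
    and eventually_zero: "\<And>i. i > n \<Longrightarrow> carrier (E i) = {\<zero>\<^bsub>E i\<^esub>}"
begin

text \<open>Taking kernels makes index 0 uniform: it yields the copy of R in \<open>E 0\<close>, and
  at index i + 1 the image of \<open>\<delta> i\<close>.\<close>

definition cosyzygy :: "nat \<Rightarrow> 'e set" where
  "cosyzygy i = module_kernel (E i) (E (Suc i)) (\<delta> i)"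

lemma E_injective: "injective_module R (E i)" and \<delta>_hom: "is_module_hom R (E i) (E (Suc i)) (\<delta> i)"
  and \<epsilon>_hom: "is_module_hom R (regular_module R) (E 0) \<epsilon>" and \<epsilon>_inj: "inj_on \<epsilon> (carrier R)"
  and cosyzygy_0: "cosyzygy 0 = \<epsilon> ` carrier R"
  and cosyzygy_Suc: "\<delta> i ` carrier (E i) = cosyzygy (Suc i)"
  using resolution by (auto simp: injective_resolution_def cosyzygy_def regular_module_def)

lemma E_module: "module R (E i)" using E_injective by (auto simp: injective_module_def)

lemma cosyzygy_submodule: "submodule (cosyzygy i) R (E i)"
  unfolding cosyzygy_def by (rule submodule_kernel[OF E_module E_module \<delta>_hom])

text \<open>Divisibility by some x in \<mm> outside P starts in degree one over the cosyzygy j and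
  is shifted to degree j + 1 over R. There the cohomology is finitely generated and vanishes by
  Nakayama's lemma; the vanishing is shifted back up to degree one over the cosyzygy j.\<close>

lemma annihilator_lifting_prime:
  assumes P: "primeideal P R" "P \<noteq> \<mm>"
    and pinj: "principally_injective R (E (Suc j)) (cosyzygy (Suc j))"
  shows "annihilator_lifting (E j) (cosyzygy j) P"
proof -
  interpret P: primeideal P R by (rule P)
  have "P \<subseteq> \<mm>" using proper_ideal_sub[OF P.is_ideal] P.I_notcarr by simp
  then obtain x where x: "x \<in> \<mm>" "x \<notin> P" using P(2) by blast
  have xR: "x \<in> carrier R" using x(1) by (rule max_ideal_sub)
  have hom0: "is_module_hom R (free_module R 1) (regular_module R) (\<lambda>v. v 0)"
    by (rule is_module_homI) (auto simp: free_module_simps regular_module_simps)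
  have K: "submodule {w \<in> carrier (free_module R 1). w 0 \<in> P} R (free_module R 1)"
    using submodule_vimage[OF free_module_module regular_module_module hom0] P.is_ideal
    by (simp add: submodule_regular_iff)
  from free_resolution_of_submodule[OF is_cring noetherian_ring_axioms K] obtain b d where b0: "b 0 = 1"
    and hom: "\<And>i. is_module_hom R (free_module R (b (Suc i))) (free_module R (b i)) (d i)"
    and image: "d 0 ` carrier (free_module R (b 1)) = {w \<in> carrier (free_module R 1). w 0 \<in> P}"
    and exact: "\<And>i. d (Suc i) ` carrier (free_module R (b (Suc (Suc i)))) =
       module_kernel (free_module R (b (Suc i))) (free_module R (b i)) (d i)" by blast
  note step = E_injective E_module \<delta>_hom cosyzygy_Suc cosyzygy_def and E_mod = E_module
  interpret free_complex R \<mm> b d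
    by unfold_locales (rule hom, rule exact)
  have "cohomology_divisible R b d (E (j - k)) (cosyzygy (j - k)) x k" if "k \<le> j" for k
    using that
  proof (induction k)
    case 0
    show ?case using divisible_degree_one[OF b0 P(1) image step pinj xR x(2)] by simp
  next
    case (Suc k)
    then have "Suc (j - Suc k) = j - k" by simp
    then show ?case
      using cohomology_divisible_shift[OF step xR, of "j - Suc k" k] Suc by simp
  qed
  from this[of j] have "cohomology_divisible R b d (E 0) (cosyzygy 0) x j" by simp
  then have "cohomology_vanishes R b d (E 0) (cosyzygy 0) j"
    by (rule divisible_imp_vanishes[OF E_mod \<epsilon>_hom \<epsilon>_inj cosyzygy_0 x(1)])
  then have "cohomology_vanishes R b d (E k) (cosyzygy k) (j - k)" if "k \<le> j" for k
    using that
  proof (induction k)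
    case (Suc k)
    then have "Suc (j - Suc k) = j - k" by simp
    then show ?case
      using cohomology_vanishes_shift[OF step, of k "j - Suc k"] Suc by simp
  qed simp
  from this[of j] have "cohomology_vanishes R b d (E j) (cosyzygy j) 0" by simp
  then show ?thesis
    by (rule vanishes_annihilator_lifting[OF b0 P(1) image E_mod cosyzygy_submodule])
qed

text \<open>The recursion starts where the resolution has ended and runs down to j. The case of
  \<mm> is left to the caller, since it rests on different arguments with and without a regular
  element.\<close>

lemma descent:
  assumes lift: "\<And>i. \<lbrakk>i \<ge> j; principally_injective R (E (Suc i)) (cosyzygy (Suc i))\<rbrakk> \<Longrightarrow>
      annihilator_lifting (E i) (cosyzygy i) \<mm>"
  shows "principally_injective R (E j) (cosyzygy j)"
proof -
  have step: "principally_injective R (E i) (cosyzygy i)"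
    if "i \<ge> j" and pinj: "principally_injective R (E (Suc i)) (cosyzygy (Suc i))" for i
  proof (rule principally_injective_submodule[OF E_module
        injective_principally_injective[OF is_cring E_injective] cosyzygy_submodule])
    fix J assume J: "ideal J R"
    have "annihilator_lifting (E i) (cosyzygy i) P" if "primeideal P R" for P
      using annihilator_lifting_prime[OF that _ pinj] lift[OF \<open>i \<ge> j\<close> pinj] by blast
    then show "annihilator_lifting (E i) (cosyzygy i) J"
      by (rule annihilator_lifting_from_primes[OF noetherian_ring_axioms E_module
          injective_principally_injective[OF is_cring E_injective] cosyzygy_submodule _ J])
  qed
  \<comment> \<open>The index n + j + 1 exceeds both n and j, so the cosyzygy is zero there and j
    can be reached from it.\<close>
  have top: "principally_injective R (E (Suc (n + j))) (cosyzygy (Suc (n + j)))" (is "principally_injective R ?E ?C")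
  proof -
    interpret M: module R ?E by (rule E_module)
    have "?C = {\<zero>\<^bsub>?E\<^esub>}"
      using M.submoduleD(1,2)[OF cosyzygy_submodule] eventually_zero[of "Suc (n + j)"] by auto
    then show ?thesis
      unfolding principally_injective_def using idealD(1) M.smult_r_null
      by (metis singletonD singletonI subsetD)
  qed
  have "principally_injective R (E (Suc (n + j) - k)) (cosyzygy (Suc (n + j) - k))" if "k \<le> Suc n" for k
    using that
  proof (induction k)
    case (Suc k)
    then have "Suc (Suc (n + j) - Suc k) = Suc (n + j) - k" "Suc (n + j) - Suc k \<ge> j" by auto
    then show ?case using step[of "Suc (n + j) - Suc k"] Suc by simp
  qed (simp add: top)
  from this[of "Suc n"] show ?thesis by simp
qed

end

section \<open>Primes and regular elements\<close>

definition colon :: "('a, 'b) ring_scheme \<Rightarrow> 'a set \<Rightarrow> 'a \<Rightarrow> 'a set" where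
  "colon R J a = {r \<in> carrier R. r \<otimes>\<^bsub>R\<^esub> a \<in> J}"

definition regular_element :: "('a, 'b) ring_scheme \<Rightarrow> 'a \<Rightarrow> bool" where
  "regular_element R w \<longleftrightarrow>
    w \<in> carrier R \<and> (\<forall>r\<in>carrier R. w \<otimes>\<^bsub>R\<^esub> r = \<zero>\<^bsub>R\<^esub> \<longrightarrow> r = \<zero>\<^bsub>R\<^esub>)"

context cring
begin

lemma colon_ideal:
  assumes J: "ideal J R" and a: "a \<in> carrier R"
  shows "ideal (colon R J a) R"
proof (rule idealI')
  note DJ = idealD[OF J]
  show "colon R J a \<subseteq> carrier R" by (auto simp: colon_def)
  show "\<zero> \<in> colon R J a" using DJ(2) a by (simp add: colon_def)
  show "r \<oplus> s \<in> colon R J a" if "r \<in> colon R J a" "s \<in> colon R J a" for r s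
    using that a DJ(3) by (simp add: colon_def l_distr)
  show "r \<otimes> s \<in> colon R J a" if "r \<in> carrier R" "s \<in> colon R J a" for r s
    using that a DJ(5) by (simp add: colon_def m_assoc)
qed

text \<open>If s a lies outside J, its colon ideal contains that of a, hence equals it by
  maximality; then r s a \<in> J gives r a \<in> J.\<close>

lemma maximal_colon_prime:
  assumes J: "ideal J R" and a: "a \<in> carrier R" "a \<notin> J"
    and max: "\<And>b. \<lbrakk>b \<in> carrier R; b \<notin> J; colon R J a \<subseteq> colon R J b\<rbrakk> \<Longrightarrow> colon R J b = colon R J a"
  shows "primeideal (colon R J a) R"
proof (rule primeidealI[OF colon_ideal[OF J a(1)] is_cring])
  note DJ = idealD[OF J]
  show "carrier R \<noteq> colon R J a"
  proof
    assume "carrier R = colon R J a"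
    then have "\<one> \<in> colon R J a" using one_closed by simp
    then show False using a by (simp add: colon_def)
  qed
  fix r s assume r: "r \<in> carrier R" and s: "s \<in> carrier R" and rs: "r \<otimes> s \<in> colon R J a"
  show "r \<in> colon R J a \<or> s \<in> colon R J a"
  proof (rule disjCI)
    assume "s \<notin> colon R J a"
    then have sa: "s \<otimes> a \<notin> J" "s \<otimes> a \<in> carrier R" using s a by (auto simp: colon_def)
    have "colon R J a \<subseteq> colon R J (s \<otimes> a)"
    proof
      fix t assume t: "t \<in> colon R J a"
      then have "s \<otimes> (t \<otimes> a) \<in> J" "t \<in> carrier R" using DJ(5) s by (auto simp: colon_def)
      then show "t \<in> colon R J (s \<otimes> a)" using s a by (simp add: colon_def m_lcomm)
    qed
    then have "colon R J (s \<otimes> a) = colon R J a" using max sa by blast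
    moreover have "r \<in> colon R J (s \<otimes> a)" using rs r s a by (simp add: colon_def m_assoc)
    ultimately show "r \<in> colon R J a" by simp
  qed
qed

lemma regular_cancel:
  assumes "regular_element R w" "a \<in> carrier R" "b \<in> carrier R" "w \<otimes> a = w \<otimes> b"
  shows "a = b"
proof -
  have w: "w \<in> carrier R" using assms(1) by (simp add: regular_element_def)
  have "w \<otimes> (a \<ominus> b) = w \<otimes> a \<ominus> w \<otimes> b" using assms(2,3) w by algebra
  also have "\<dots> = \<zero>" using assms w by (simp add: r_right_minus_eq)
  finally have "a \<ominus> b = \<zero>" using assms by (simp add: regular_element_def)
  then show ?thesis using assms by (simp add: r_right_minus_eq)
qed

lemma regular_mult:
  assumes "regular_element R v" "regular_element R w"
  shows "regular_element R (v \<otimes> w)"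
  unfolding regular_element_def
proof (intro conjI ballI impI)
  have v: "v \<in> carrier R" and w: "w \<in> carrier R" using assms by (simp_all add: regular_element_def)
  then show "v \<otimes> w \<in> carrier R" by simp
  fix r assume r: "r \<in> carrier R" "v \<otimes> w \<otimes> r = \<zero>"
  then have "w \<otimes> r = \<zero>" using assms(1) v w by (simp add: regular_element_def m_assoc)
  then show "r = \<zero>" using assms(2) r(1) by (simp add: regular_element_def)
qed

lemma regular_power:
  assumes "regular_element R w"
  shows "regular_element R (w [^] (n::nat))"
proof (induction n)
  case 0
  then show ?case by (simp add: regular_element_def)
next
  case (Suc n)
  then show ?case using regular_mult[OF Suc assms] by simp
qed

lemma exists_avoiding_prime:
  assumes P: "primeideal P R" and "finite \<Q>"
    and "\<And>Q. Q \<in> \<Q> \<Longrightarrow> ideal Q R" "\<And>Q. Q \<in> \<Q> \<Longrightarrow> \<not> Q \<subseteq> P"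
  obtains y where "y \<in> carrier R" "y \<notin> P" "\<And>Q. Q \<in> \<Q> \<Longrightarrow> y \<in> Q"
proof -
  interpret P: primeideal P R by (rule P)
  have "\<exists>y\<in>carrier R. y \<notin> P \<and> (\<forall>Q\<in>\<Q>. y \<in> Q)"
    using assms(2-4)
  proof (induction \<Q> rule: finite_induct)
    case empty
    have "\<one> \<notin> P" using P.I_notcarr P.one_imp_carrier by blast
    then show ?case by auto
  next
    case (insert Q \<Q>)
    then obtain y where y: "y \<in> carrier R" "y \<notin> P" "\<forall>Q\<in>\<Q>. y \<in> Q" by auto
    have Q: "ideal Q R" "\<not> Q \<subseteq> P" using insert.prems by auto
    then obtain z where z: "z \<in> Q" "z \<notin> P" by blast
    have zR: "z \<in> carrier R" using z idealD(1)[OF Q(1)] by blast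
    have "z \<otimes> y \<notin> P" using P.I_prime[OF zR y(1)] z y by blast
    moreover have "z \<otimes> y \<in> Q" using idealD(5)[OF Q(1) y(1) z(1)] zR y(1) by (simp add: m_comm)
    moreover have "z \<otimes> y \<in> Q'" if "Q' \<in> \<Q>" for Q'
      using idealD(5)[of Q' z y] insert.prems(1) that zR y by auto
    ultimately show ?case using zR y(1) by (intro bexI[of _ "z \<otimes> y"]) auto
  qed
  then show thesis using that by blast
qed

text \<open>If the element x found for the smaller family falls into the new prime P, add some y
  outside P that lies in J and in all other primes. Such a y exists because the primes are pairwise
  incomparable.\<close>

lemma prime_avoidance:
  assumes J: "ideal J R" and "finite \<P>"
    and "\<And>P. P \<in> \<P> \<Longrightarrow> primeideal P R" "\<And>P. P \<in> \<P> \<Longrightarrow> \<not> J \<subseteq> P"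
    and "\<And>P Q. \<lbrakk>P \<in> \<P>; Q \<in> \<P>; P \<subseteq> Q\<rbrakk> \<Longrightarrow> P = Q"
  obtains x where "x \<in> J" "x \<notin> \<Union>\<P>"
proof -
  note DJ = idealD[OF J]
  have "\<exists>x\<in>J. x \<notin> \<Union>\<P>"
    using assms(2-5)
  proof (induction \<P> rule: finite_induct)
    case empty
    then show ?case using DJ(2) by auto
  next
    case (insert P \<P>)
    have "\<exists>x\<in>J. x \<notin> \<Union>\<P>"
      by (rule insert.IH) (use insert.prems in blast)+
    then obtain x where x: "x \<in> J" "x \<notin> \<Union>\<P>" by blast
    show ?case
    proof (cases "x \<in> P")
      case True
      have P: "primeideal P R" using insert.prems by blast
      have id: "ideal Q R" if "Q \<in> insert J \<P>" for Q
        using that J insert.prems(1) primeideal.axioms(1) by blast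
      have "\<not> Q \<subseteq> P" if "Q \<in> insert J \<P>" for Q
        using that insert.prems(2,3) insert.hyps(2) by blast
      then obtain y where y: "y \<in> carrier R" "y \<notin> P" "\<And>Q. Q \<in> insert J \<P> \<Longrightarrow> y \<in> Q"
        using exists_avoiding_prime[OF P, of "insert J \<P>"] insert.hyps(1) id by blast
      have xR: "x \<in> carrier R" using x DJ(1) by blast
      have "x \<oplus> y \<notin> Q" if Q: "Q \<in> insert P \<P>" for Q
      proof
        assume xy: "x \<oplus> y \<in> Q"
        have idQ: "ideal Q R" using Q insert.prems(1) primeideal.axioms(1) by blast
        show False
        proof (cases "Q = P")
          case True
          then have "x \<oplus> y \<ominus> x \<in> P" using idealD(4)[OF idQ xy] \<open>x \<in> P\<close> by simp
          then show False using y xR by (simp add: add_minus_cancel_left)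
        next
          case False
          then have "x \<oplus> y \<ominus> y \<in> Q" using idealD(4)[OF idQ xy] y(3) Q by auto
          then show False using x(2) y xR False Q by (auto simp: add_minus_cancel)
        qed
      qed
      then show ?thesis using DJ(3) x(1) y(3) by (intro bexI[of _ "x \<oplus> y"]) auto
    qed (use x in blast)
  qed
  then show thesis using that by blast
qed

end

lemma (in noetherian_ring) maximal_colon_above:
  assumes R: "cring R" and J: "ideal J R" and a: "a \<in> carrier R" "a \<notin> J"
  obtains b where "b \<in> carrier R" "b \<notin> J" "colon R J a \<subseteq> colon R J b"
    "\<And>c. \<lbrakk>c \<in> carrier R; c \<notin> J; colon R J b \<subseteq> colon R J c\<rbrakk> \<Longrightarrow> colon R J c = colon R J b"
proof -
  interpret cring R by (rule R)
  let ?\<I> = "{colon R J b | b. b \<in> carrier R \<and> b \<notin> J \<and> colon R J a \<subseteq> colon R J b}"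
  have "?\<I> \<noteq> {}" using a by blast
  then obtain M where M: "M \<in> ?\<I>" "\<And>N. \<lbrakk>N \<in> ?\<I>; M \<subseteq> N\<rbrakk> \<Longrightarrow> N = M"
    by (rule exists_maximal_ideal_in) (use colon_ideal[OF J] in blast)+
  from M(1) obtain b where b: "M = colon R J b" "b \<in> carrier R" "b \<notin> J" "colon R J a \<subseteq> M" by blast
  show thesis
  proof (rule that[OF b(2,3)])
    show "colon R J a \<subseteq> colon R J b" using b by simp
    fix c assume "c \<in> carrier R" "c \<notin> J" "colon R J b \<subseteq> colon R J c"
    then show "colon R J c = colon R J b" using M(2)[of "colon R J c"] b by blast
  qed
qed

text \<open>If \<mm> consisted of zero divisors, it would be covered by the maximal annihilators of
  nonzero elements. These are finitely many primes, so by prime avoidance one of them contains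
  \<mm>, and the element it annihilates is a nonzero socle element.\<close>

lemma (in noetherian_local) exists_regular_element:
  assumes soc: "\<And>s. \<lbrakk>s \<in> carrier R; \<And>a. a \<in> \<mm> \<Longrightarrow> a \<otimes> s = \<zero>\<rbrakk> \<Longrightarrow> s = \<zero>"
  obtains x where "x \<in> \<mm>" "regular_element R x"
proof (rule ccontr)
  note regularI = that
  assume no: "\<not> thesis"
  have zd: "\<exists>r\<in>carrier R. x \<otimes> r = \<zero> \<and> r \<noteq> \<zero>" if x: "x \<in> \<mm>" for x
  proof -
    have "\<not> regular_element R x" using no regularI[OF x] by blast
    then show ?thesis using max_ideal_sub[OF x] unfolding regular_element_def by blast
  qed
  let ?ann = "colon R {\<zero>}"
  define Y where "Y = {y \<in> carrier R. y \<noteq> \<zero> \<and>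
    (\<forall>b\<in>carrier R. b \<noteq> \<zero> \<longrightarrow> ?ann y \<subseteq> ?ann b \<longrightarrow> ?ann b = ?ann y)}"
  have Y_prime: "primeideal (?ann y) R" if "y \<in> Y" for y
    by (rule maximal_colon_prime[OF zeroideal]) (use that in \<open>auto simp: Y_def\<close>)
  have cover: "\<exists>y\<in>Y. x \<in> ?ann y" if x: "x \<in> \<mm>" for x
  proof -
    obtain r where r: "r \<in> carrier R" "x \<otimes> r = \<zero>" "r \<noteq> \<zero>" using zd[OF x] by blast
    obtain y where y: "y \<in> carrier R" "y \<notin> {\<zero>}" "?ann r \<subseteq> ?ann y"
      "\<And>c. \<lbrakk>c \<in> carrier R; c \<notin> {\<zero>}; ?ann y \<subseteq> ?ann c\<rbrakk> \<Longrightarrow> ?ann c = ?ann y"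
      using maximal_colon_above[OF is_cring zeroideal r(1)] r(3) by blast
    have "x \<in> ?ann r" using r max_ideal_sub[OF x] by (simp add: colon_def)
    then have "x \<in> ?ann y" using y(3) by blast
    moreover have "y \<in> Y" using y(1,2,4) by (simp add: Y_def)
    ultimately show ?thesis by blast
  qed
  have Y_sub: "Y \<subseteq> carrier R" by (auto simp: Y_def)
  \<comment> \<open>Finiteness of the set of maximal annihilators: finitely many elements Y0 of Y
    generate an ideal containing Y. Were the annihilator of y different from all those of Y0, some r
    outside it would kill Y0, and hence also y.\<close>
  let ?\<I> = "{Idl Y0 | Y0. finite Y0 \<and> Y0 \<subseteq> Y}"
  have nonempty: "?\<I> \<noteq> {}" by blast
  have ideals: "ideal J R" if "J \<in> ?\<I>" for J using that Y_sub genideal_ideal by blast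
  obtain M where M: "M \<in> ?\<I>" "\<And>J. \<lbrakk>J \<in> ?\<I>; M \<subseteq> J\<rbrakk> \<Longrightarrow> J = M"
    by (rule exists_maximal_ideal_in[OF nonempty ideals]) (assumption, rule that)
  from M(1) obtain Y0 where Y0: "M = Idl Y0" "finite Y0" "Y0 \<subseteq> Y" by blast
  have Y0_sub: "Y0 \<subseteq> carrier R" using Y0(3) Y_sub by blast
  have Y_in: "y \<in> Idl Y0" if "y \<in> Y" for y
  proof -
    have sub: "insert y Y0 \<subseteq> carrier R" using that Y0_sub Y_sub by blast
    have "Idl Y0 \<subseteq> Idl (insert y Y0)" by (rule subset_Idl_subset[OF sub]) blast
    then have "Idl (insert y Y0) = Idl Y0"
      using M(2)[of "Idl (insert y Y0)"] that Y0 by blast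
    then show ?thesis using genideal_self[OF sub] by blast
  qed
  have incomparable: "?ann z = ?ann y" if "z \<in> Y" "y \<in> Y" "?ann z \<subseteq> ?ann y" for z y
    using that by (auto simp: Y_def)
  have finite_many: "\<exists>z\<in>Y0. ?ann y = ?ann z" if y: "y \<in> Y" for y
  proof (rule ccontr)
    assume no: "\<not> (\<exists>z\<in>Y0. ?ann y = ?ann z)"
    have "\<not> ?ann z \<subseteq> ?ann y" if "z \<in> Y0" for z
      using incomparable[of z y] that y no Y0(3) by blast
    moreover have "ideal (?ann z) R" if "z \<in> Y0" for z
      using colon_ideal[OF zeroideal] that Y0_sub by blast
    ultimately obtain r where r: "r \<in> carrier R" "r \<notin> ?ann y" "\<And>Q. Q \<in> ?ann ` Y0 \<Longrightarrow> r \<in> Q"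
      using exists_avoiding_prime[OF Y_prime[OF y], of "?ann ` Y0"] Y0(2) by blast
    have "Y0 \<subseteq> ?ann r"
    proof
      fix z assume z: "z \<in> Y0"
      then have "r \<in> ?ann z" using r(3) by blast
      then show "z \<in> ?ann r" using z Y0_sub by (auto simp: colon_def m_comm)
    qed
    then have "Idl Y0 \<subseteq> ?ann r" by (rule genideal_minimal[OF colon_ideal[OF zeroideal r(1)]])
    then have "y \<in> ?ann r" using Y_in[OF y] by blast
    then show False using r by (auto simp: colon_def m_comm)
  qed
  have not_sub: "\<not> \<mm> \<subseteq> P" if P: "P \<in> ?ann ` Y0" for P
  proof
    assume "\<mm> \<subseteq> P"
    moreover obtain z where "z \<in> Y0" "P = ?ann z" using P by blast
    ultimately show False using soc[of z] Y0(3) by (auto simp: Y_def colon_def)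
  qed
  have "P = Q" if "P \<in> ?ann ` Y0" "Q \<in> ?ann ` Y0" "P \<subseteq> Q" for P Q
    using that incomparable Y0(3) by blast
  then obtain x where x: "x \<in> \<mm>" "x \<notin> \<Union>(?ann ` Y0)"
    using prime_avoidance[OF max_ideal_ideal, of "?ann ` Y0"] Y0(2,3) Y_prime not_sub by blast
  obtain y where "y \<in> Y" "x \<in> ?ann y" using cover[OF x(1)] by blast
  then show False using finite_many x(2) by blast
qed

text \<open>\<open>Q\<close> is maximal among the ideals that avoid the multiplicative set generated by \<open>w\<close> and the
  complement of \<open>P\<close>.\<close>

lemma exists_smaller_prime:
  fixes R (structure)
  assumes R: "noetherian_ring R" and P: "primeideal P R" and w: "regular_element R w"
  obtains Q where "primeideal Q R" "Q \<subseteq> P" "w \<notin> Q"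
proof -
  interpret P: primeideal P R by (rule P)
  interpret noetherian_ring R by (rule R)
  have wR: "w \<in> carrier R" using w by (simp add: regular_element_def)
  define T where "T = {w [^] (n::nat) \<otimes> t | n t. t \<in> carrier R \<and> t \<notin> P}"
  have TR: "t \<in> carrier R" if "t \<in> T" for t using that wR by (auto simp: T_def)
  have one: "\<one> \<notin> P" using P.I_notcarr P.one_imp_carrier by blast
  have T_mult: "s \<otimes> t \<in> T" if "s \<in> T" "t \<in> T" for s t
  proof -
    obtain m n :: nat and u v where *: "s = w [^] m \<otimes> u" "u \<in> carrier R" "u \<notin> P"
      "t = w [^] n \<otimes> v" "v \<in> carrier R" "v \<notin> P"
      using \<open>s \<in> T\<close> \<open>t \<in> T\<close> unfolding T_def by blast
    then have "u \<otimes> v \<notin> P" using P.I_prime by blast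
    moreover have "s \<otimes> t = w [^] (m + n) \<otimes> (u \<otimes> v)"
      using * wR by (simp add: P.m_ac flip: P.nat_pow_mult)
    ultimately show ?thesis using * unfolding T_def by blast
  qed
  \<comment> \<open>Regularity of w keeps zero out of T, so that the zero ideal is a candidate for
    Q.\<close>
  have "\<zero> \<notin> T"
  proof
    assume "\<zero> \<in> T"
    then obtain n :: nat and t where t: "\<zero> = w [^] n \<otimes> t" "t \<in> carrier R" "t \<notin> P" by (auto simp: T_def)
    then have "t = \<zero>" using P.regular_power[OF w, of n] by (simp add: regular_element_def)
    then show False using t(3) P.zero_closed by simp
  qed
  then have "{J. ideal J R \<and> J \<inter> T = {}} \<noteq> {}" using P.zeroideal by blast
  then obtain Q where Q: "ideal Q R" "Q \<inter> T = {}"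
    and max: "\<And>J. \<lbrakk>ideal J R; J \<inter> T = {}; Q \<subseteq> J\<rbrakk> \<Longrightarrow> J = Q"
    by (rule exists_maximal_ideal_in) blast+
  note DQ = P.idealD[OF Q(1)]
  have compl: "t \<in> T" if "t \<in> carrier R" "t \<notin> P" for t
  proof -
    have "t = w [^] (0::nat) \<otimes> t" using that by simp
    then show ?thesis unfolding T_def using that by blast
  qed
  have "w = w [^] (1::nat) \<otimes> \<one>" using wR by simp
  then have "w \<in> T" unfolding T_def using one P.one_closed by blast
  have "primeideal Q R"
  proof (rule primeidealI[OF Q(1) P.is_cring])
    show "carrier R \<noteq> Q" using Q(2) \<open>w \<in> T\<close> wR by blast
    fix a b assume a: "a \<in> carrier R" and b: "b \<in> carrier R" and ab: "a \<otimes> b \<in> Q"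
    show "a \<in> Q \<or> b \<in> Q"
    proof (rule ccontr)
      assume "\<not> (a \<in> Q \<or> b \<in> Q)"
      then have meets: "{j \<oplus> r \<otimes> c | j r. j \<in> Q \<and> r \<in> carrier R} \<inter> T \<noteq> {}" if "c \<in> {a, b}" for c
        using max[OF P.ideal_add_principal(1)[OF Q(1), of c]] P.ideal_add_principal(2,3)[OF Q(1), of c]
          that a b by blast
      obtain j r where jr: "j \<in> Q" "r \<in> carrier R" "j \<oplus> r \<otimes> a \<in> T" using meets[of a] by blast
      obtain k s where ks: "k \<in> Q" "s \<in> carrier R" "k \<oplus> s \<otimes> b \<in> T" using meets[of b] by blast
      have cl: "j \<in> carrier R" "k \<in> carrier R" using jr ks DQ(1) by auto
      \<comment> \<open>This product lies in Q because a b does, but also in T, which is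
        multiplicatively closed.\<close>
      have "(j \<oplus> r \<otimes> a) \<otimes> (k \<oplus> s \<otimes> b) = (k \<oplus> s \<otimes> b) \<otimes> j \<oplus> ((r \<otimes> a) \<otimes> k \<oplus> (r \<otimes> s) \<otimes> (a \<otimes> b))"
        using cl a b jr ks by (simp add: P.l_distr P.r_distr P.m_ac P.a_ac)
      also have "\<dots> \<in> Q"
        using DQ(3,5) jr ks ab a b cl P.m_closed P.a_closed by meson
      finally show False using T_mult[OF jr(3) ks(3)] Q(2) by blast
    qed
  qed
  moreover have "Q \<subseteq> P" using Q(2) compl DQ(1) by blast
  moreover have "w \<notin> Q" using Q(2) \<open>w \<in> T\<close> by blast
  ultimately show thesis using that by blast
qed

section \<open>Gorenstein local rings of dimension one\<close>

locale gorenstein_one = finite_injdim +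
  assumes dim: "krull_dim R = 1"
begin

lemma no_long_chain:
  assumes "primeideal P R" "primeideal Q R" "primeideal N R" "P \<subset> Q" "Q \<subset> N"
  shows False
proof -
  have "enat 2 \<le> chain_length {P. primeideal P R}"
    using assms by (intro chain_length_upper[where N = "\<lambda>i. if i = 0 then P else if i = 1 then Q else N"])
      (auto simp: less_2_cases_iff)
  then show False using dim by (simp add: krull_dim_chain one_enat_def)
qed

lemma max_ideal_prime: "primeideal \<mm> R"
  by (rule maximalideal_prime[OF maximalideal_max_ideal])

lemma exists_other_prime: "\<exists>P. primeideal P R \<and> P \<noteq> \<mm>"
proof (rule ccontr)
  assume no: "\<not> (\<exists>P. primeideal P R \<and> P \<noteq> \<mm>)"
  have "chain_length {P. primeideal P R} \<le> enat 0"
  proof (rule chain_length_least)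
    fix n and N :: "nat \<Rightarrow> _"
    assume N: "\<And>i. i \<le> n \<Longrightarrow> N i \<in> {P. primeideal P R}" "\<And>i. i < n \<Longrightarrow> N i \<subset> N (Suc i)"
    have "n = 0"
    proof (rule ccontr)
      assume "n \<noteq> 0"
      then have "N 0 = \<mm>" "N 1 = \<mm>" "N 0 \<subset> N 1" using N(1)[of 0] N(1)[of 1] N(2)[of 0] no by auto
      then show False by simp
    qed
    then show "enat n \<le> enat 0" by simp
  qed
  then show False using dim by (simp add: krull_dim_chain one_enat_def)
qed

lemma \<epsilon>_props:
  "a \<in> carrier R \<Longrightarrow> \<epsilon> a \<in> carrier (E 0)"
  "\<lbrakk>a \<in> carrier R; b \<in> carrier R\<rbrakk> \<Longrightarrow> \<epsilon> (a \<oplus> b) = \<epsilon> a \<oplus>\<^bsub>E 0\<^esub> \<epsilon> b"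
  "\<lbrakk>a \<in> carrier R; b \<in> carrier R\<rbrakk> \<Longrightarrow> \<epsilon> (a \<otimes> b) = a \<odot>\<^bsub>E 0\<^esub> \<epsilon> b"
  "\<lbrakk>a \<in> carrier R; b \<in> carrier R; \<epsilon> a = \<epsilon> b\<rbrakk> \<Longrightarrow> a = b"
  "\<epsilon> \<zero> = \<zero>\<^bsub>E 0\<^esub>"
  using is_module_homD[OF \<epsilon>_hom] \<epsilon>_inj is_module_hom_zero_minus(1)[OF regular_module_module E_module \<epsilon>_hom]
  by (auto simp: regular_module_simps inj_on_def)

text \<open>With a nonzero socle element the maximal ideal can be handled with x = 0 in every
  degree, so the descent reaches R itself. This makes every element of \<mm> nilpotent, so that
  \<mm> is the only prime, against dimension one.\<close>

lemma socle_zero: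
  assumes s: "s \<in> carrier R" "\<And>a. a \<in> \<mm> \<Longrightarrow> a \<otimes> s = \<zero>"
  shows "s = \<zero>"
proof (rule ccontr)
  assume "s \<noteq> \<zero>"
  have zero: "PIdl \<zero> = {\<zero>}" using cgenideal_self[OF zero_closed] by (auto simp: cgenideal_def)
  have "principally_injective R (E 0) (cosyzygy 0)"
  proof (rule descent)
    fix i
    assume pinj: "principally_injective R (E (Suc i)) (cosyzygy (Suc i))"
    interpret Ei: module R "E i" by (rule E_module)
    show "annihilator_lifting (E i) (cosyzygy i) \<mm>"
      by (rule annihilator_lifting_max_ideal[OF E_module E_module \<delta>_hom cosyzygy_Suc cosyzygy_def pinj
            zero_closed s(1)])
        (use s \<open>s \<noteq> \<zero>\<close> zero Ei.submoduleD(1,2)[OF cosyzygy_submodule] in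
          \<open>auto intro!: bexI[of _ "\<zero>\<^bsub>E i\<^esub>"]\<close>)
  qed
  note pinj = principally_injectiveE[OF this]
  have nil: "\<exists>k::nat. y [^] k = \<zero>" if y: "y \<in> \<mm>" for y
  proof -
    have yR: "y \<in> carrier R" using y by (rule max_ideal_sub)
    let ?ann = "\<lambda>k::nat. colon R {\<zero>} (y [^] k)"
    \<comment> \<open>The annihilators of the powers of y become stationary at N.\<close>
    obtain M where M: "M \<in> range ?ann" "\<And>J. \<lbrakk>J \<in> range ?ann; M \<subseteq> J\<rbrakk> \<Longrightarrow> J = M"
      by (rule exists_maximal_ideal_in[of "range ?ann"]) (use colon_ideal[OF zeroideal] yR in auto)
    then obtain N where N: "M = ?ann N" by blast
    have eq: "?ann (N + k) = ?ann N" for k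
    proof -
      have "r \<otimes> y [^] (N + k) = \<zero>" if "r \<in> carrier R" "r \<otimes> y [^] N = \<zero>" for r
        using that yR by (simp flip: nat_pow_mult m_assoc)
      then show ?thesis using M(2)[of "?ann (N + k)"] N by (auto simp: colon_def)
    qed
    have J: "ideal (?ann N) R" using colon_ideal[OF zeroideal] yR by simp
    have yN: "y [^] N \<in> carrier R" using yR by simp
    \<comment> \<open>Principal injectivity is applied with J the annihilator of the N-th power of y
      and with that power as both v and d. By stationarity, an element killing the 2N-th power
      already kills the N-th. The resulting c is killed by J and fixes the N-th power of y.\<close>
    have "a \<odot>\<^bsub>E 0\<^esub> \<epsilon> (y [^] N) = \<zero>\<^bsub>E 0\<^esub>" if a: "a \<in> carrier R" "a \<otimes> y [^] N \<in> ?ann N" for a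
    proof -
      have "a \<in> ?ann (N + N)" using a yR by (simp add: colon_def m_assoc nat_pow_mult)
      then have "a \<otimes> y [^] N = \<zero>" using eq by (auto simp: colon_def)
      then show ?thesis using \<epsilon>_props(3)[OF a(1) yN] \<epsilon>_props(5) by simp
    qed
    from pinj[OF J yN _ this] yN obtain c' where c': "c' \<in> cosyzygy 0"
      "\<And>a. a \<in> ?ann N \<Longrightarrow> a \<odot>\<^bsub>E 0\<^esub> c' = \<zero>\<^bsub>E 0\<^esub>" "\<epsilon> (y [^] N) = y [^] N \<odot>\<^bsub>E 0\<^esub> c'"
      by (auto simp: cosyzygy_0)
    then obtain c where c: "c \<in> carrier R" "c' = \<epsilon> c" by (auto simp: cosyzygy_0)
    have cJ: "a \<otimes> c = \<zero>" if "a \<in> ?ann N" for a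
      using c'(2)[OF that] that c \<epsilon>_props(3,5) by (intro \<epsilon>_props(4)) (auto simp: colon_def)
    have yc: "y [^] N = y [^] N \<otimes> c"
      using c'(3) c yN \<epsilon>_props(3) by (intro \<epsilon>_props(4)) auto
    have "(\<one> \<ominus> c) \<otimes> y [^] N = y [^] N \<ominus> y [^] N \<otimes> c" using c yN by algebra
    then have "(\<one> \<ominus> c) \<otimes> y [^] N = \<zero>" using yc yN by (simp add: r_right_minus_eq)
    show ?thesis
    proof (cases "c \<in> \<mm>")
      case True
      then have U: "\<one> \<ominus> c \<in> Units R" by (rule one_minus_unit)
      then have "inv (\<one> \<ominus> c) \<otimes> ((\<one> \<ominus> c) \<otimes> y [^] N) = y [^] N"
        using yN c by (simp flip: m_assoc)
      then have "y [^] N = \<zero>" using \<open>(\<one> \<ominus> c) \<otimes> y [^] N = \<zero>\<close> U by simp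
      then show ?thesis by blast
    next
      case False
      then have U: "c \<in> Units R" using c(1) units by blast
      \<comment> \<open>A socle element kills the power N + 1, hence belongs to the stationary
        annihilator and is killed by c; a unit c would make s zero.\<close>
      have "s \<otimes> y [^] Suc N = \<zero>" using s(1) s(2)[OF y] yR yN by (simp add: m_comm[of s] m_assoc)
      then have "s \<in> ?ann N" using eq[of 1] s(1) by (auto simp: colon_def)
      then have "s \<otimes> c = \<zero>" by (rule cJ)
      moreover have "s \<otimes> c \<otimes> inv c = s" using U s c(1) by (simp add: m_assoc)
      ultimately have "s = \<zero>" using U by simp
      then show ?thesis using \<open>s \<noteq> \<zero>\<close> by blast
    qed
  qed
  obtain P where P: "primeideal P R" "P \<noteq> \<mm>" using exists_other_prime by blast
  interpret P: primeideal P R by (rule P)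
  have pow: "y \<in> P" if "y \<in> carrier R" "y [^] (k::nat) \<in> P" for y k
    using that
  proof (induction k)
    case 0
    then show ?case using P.I_notcarr P.one_imp_carrier by auto
  next
    case (Suc k)
    then show ?case using P.I_prime[of "y [^] k" y] by auto
  qed
  have "\<mm> \<subseteq> P"
  proof
    fix y assume y: "y \<in> \<mm>"
    obtain k :: nat where "y [^] k = \<zero>" using nil[OF y] by blast
    then show "y \<in> P" using pow[of y k] max_ideal_sub[OF y] P.zero_closed by simp
  qed
  moreover have "P \<subseteq> \<mm>" using proper_ideal_sub[OF P.is_ideal] P.I_notcarr by simp
  ultimately show False using P(2) by simp
qed

lemma regular_exists: obtains x where "x \<in> \<mm>" "regular_element R x"
  using exists_regular_element[OF socle_zero] by blast

text \<open>A maximal colon ideal over (w) is a prime P containing w. Below P there is a prime that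
  misses w, so if P differed from \<mm> there would be a chain of three primes.\<close>

lemma quotient_socle_nonzero:
  assumes w: "w \<in> \<mm>" "regular_element R w"
  obtains s where "s \<in> carrier R" "s \<notin> PIdl w" "\<And>a. a \<in> \<mm> \<Longrightarrow> a \<otimes> s \<in> PIdl w"
proof -
  have wR: "w \<in> carrier R" using w(1) by (rule max_ideal_sub)
  have I: "ideal (PIdl w) R" by (rule cgenideal_ideal[OF wR])
  have "PIdl w \<subseteq> \<mm>" by (rule cgenideal_minimal[OF max_ideal_ideal w(1)])
  then have "\<one> \<notin> PIdl w" using one_notin by blast
  then obtain s where s: "s \<in> carrier R" "s \<notin> PIdl w"
    "\<And>c. \<lbrakk>c \<in> carrier R; c \<notin> PIdl w; colon R (PIdl w) s \<subseteq> colon R (PIdl w) c\<rbrakk> \<Longrightarrow>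
      colon R (PIdl w) c = colon R (PIdl w) s"
    using maximal_colon_above[OF is_cring I one_closed] by metis
  let ?P = "colon R (PIdl w) s"
  have P: "primeideal ?P R" by (rule maximal_colon_prime[OF I s(1,2)]) (rule s(3))
  have "w \<in> ?P" using wR s(1) by (auto simp: colon_def cgenideal_def m_comm)
  have "?P = \<mm>"
  proof (rule ccontr)
    assume "?P \<noteq> \<mm>"
    moreover have "?P \<subseteq> \<mm>"
      using proper_ideal_sub[OF primeideal.axioms(1)[OF P]] primeideal.I_notcarr[OF P] by simp
    moreover obtain Q where "primeideal Q R" "Q \<subseteq> ?P" "w \<notin> Q"
      using exists_smaller_prime[OF noetherian_ring_axioms P w(2)] .
    ultimately show False using no_long_chain[OF _ P max_ideal_prime] \<open>w \<in> ?P\<close> by blast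
  qed
  then show thesis using that[OF s(1,2)] by (auto simp: colon_def)
qed

text \<open>In positive degree, w v in the cosyzygy is the image of some y in the preceding
  injective module. As w is regular, y = w z there, and the image of z is the element demanded by
  the division property.\<close>

lemma cosyzygy_1_principally_injective: "principally_injective R (E 1) (cosyzygy 1)"
proof -
  obtain w where w: "w \<in> \<mm>" "regular_element R w" by (rule regular_exists)
  have wR: "w \<in> carrier R" using w(1) by (rule max_ideal_sub)
  obtain s where s: "s \<in> carrier R" "s \<notin> PIdl w" "\<And>a. a \<in> \<mm> \<Longrightarrow> a \<otimes> s \<in> PIdl w"
    using quotient_socle_nonzero[OF w] by metis
  show ?thesis
  proof (rule descent)
    fix i assume i: "i \<ge> (1::nat)"
      and pinj: "principally_injective R (E (Suc i)) (cosyzygy (Suc i))"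
    obtain j where j: "i = Suc j" using i by (cases i) auto
    interpret Ej: module R "E j" by (rule E_module)
    show "annihilator_lifting (E i) (cosyzygy i) \<mm>"
    proof (rule annihilator_lifting_max_ideal[OF E_module E_module \<delta>_hom cosyzygy_Suc cosyzygy_def pinj
            wR s])
      fix v assume "v \<in> carrier (E i)" and "w \<odot>\<^bsub>E i\<^esub> v \<in> cosyzygy i"
      then obtain y where y: "y \<in> carrier (E j)" "w \<odot>\<^bsub>E i\<^esub> v = \<delta> j y"
        using cosyzygy_Suc[of j] j by auto
      have "a \<odot>\<^bsub>E j\<^esub> y = \<zero>\<^bsub>E j\<^esub>" if "a \<in> carrier R" "a \<otimes> w \<in> {\<zero>}" for a
        using that w(2) y(1) wR by (auto simp: regular_element_def m_comm)
      from principally_injectiveE[OF injective_principally_injective[OF is_cring E_injective]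
          zeroideal wR y(1) this]
      obtain z where z: "z \<in> carrier (E j)" "y = w \<odot>\<^bsub>E j\<^esub> z" by blast
      then have "\<delta> j z \<in> cosyzygy i" "\<delta> j y = w \<odot>\<^bsub>E i\<^esub> \<delta> j z"
        using cosyzygy_Suc[of j] j is_module_homD(3)[OF \<delta>_hom wR] by auto
      then show "\<exists>u\<in>cosyzygy i. w \<odot>\<^bsub>E i\<^esub> v = w \<odot>\<^bsub>E i\<^esub> u" using y(2) by auto
    qed
  qed
qed

text \<open>The socle element of \<open>R/(w)\<close> gives an element of
  \<open>E 0\<close> whose image in the cosyzygy is annihilated by \<open>\<mm>\<close>; principal injectivity of the
  cosyzygy extends the map \<open>v \<mapsto>\<close> this image.\<close>

lemma separating_annihilator:
  assumes w: "w \<in> \<mm>" "regular_element R w"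
    and J: "ideal J R" "w \<in> J" and v: "v \<in> carrier R" "v \<notin> J"
  obtains y where "y \<in> carrier R" "\<And>j. j \<in> J \<Longrightarrow> y \<otimes> j \<in> PIdl w" "y \<otimes> v \<notin> PIdl w"
proof -
  have wR: "w \<in> carrier R" using w(1) by (rule max_ideal_sub)
  obtain s where s: "s \<in> carrier R" "s \<notin> PIdl w" "\<And>a. a \<in> \<mm> \<Longrightarrow> a \<otimes> s \<in> PIdl w"
    using quotient_socle_nonzero[OF w] by metis
  interpret E0: module R "E 0" by (rule E_module)
  interpret E1: module R "E 1" by (rule E_module)
  note D\<delta> = is_module_homD[OF \<delta>_hom[of 0], folded One_nat_def]
  have ker: "\<delta> 0 z = \<zero>\<^bsub>E 1\<^esub> \<longleftrightarrow> z \<in> \<epsilon> ` carrier R" if "z \<in> carrier (E 0)" for z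
    using cosyzygy_0 that by (auto simp: cosyzygy_def module_kernel_def)
  \<comment> \<open>q is multiplication by the fraction s/w, which maps \<mm> to R. Its extension to
    \<open>E 0\<close> gives an element e that behaves like s/w.\<close>
  define q where "q a = (THE b. b \<in> carrier R \<and> a \<otimes> s = w \<otimes> b)" for a
  have q: "q a \<in> carrier R \<and> a \<otimes> s = w \<otimes> q a" if a: "a \<in> \<mm>" for a
  proof -
    obtain b where "b \<in> carrier R" "a \<otimes> s = w \<otimes> b"
      using s(3)[OF a] wR by (auto simp: cgenideal_def m_comm)
    then have "\<exists>!b. b \<in> carrier R \<and> a \<otimes> s = w \<otimes> b" using regular_cancel[OF w(2)] by metis
    then show ?thesis unfolding q_def by (rule theI')
  qed
  have q_eq: "q a = b" if "a \<in> \<mm>" "b \<in> carrier R" "a \<otimes> s = w \<otimes> b" for a b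
    using q[OF that(1)] that regular_cancel[OF w(2)] by metis
  have "is_module_hom R (ideal_module R \<mm>) (E 0) (\<lambda>a. \<epsilon> (q a))"
  proof (rule is_module_homI, unfold ideal_module_simps)
    show "\<epsilon> (q a) \<in> carrier (E 0)" if "a \<in> \<mm>" for a using q[OF that] \<epsilon>_props(1) by blast
    show "\<epsilon> (q (a \<oplus> b)) = \<epsilon> (q a) \<oplus>\<^bsub>E 0\<^esub> \<epsilon> (q b)" if ab: "a \<in> \<mm>" "b \<in> \<mm>" for a b
    proof -
      have "q (a \<oplus> b) = q a \<oplus> q b"
      proof (rule q_eq[OF idealD(3)[OF max_ideal_ideal ab]])
        show "q a \<oplus> q b \<in> carrier R" using q ab by blast
        have "(a \<oplus> b) \<otimes> s = a \<otimes> s \<oplus> b \<otimes> s" using ab max_ideal_sub s(1) by (simp add: l_distr)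
        also have "\<dots> = w \<otimes> q a \<oplus> w \<otimes> q b" using q[OF ab(1)] q[OF ab(2)] by simp
        also have "\<dots> = w \<otimes> (q a \<oplus> q b)" using q ab wR by (simp add: r_distr)
        finally show "(a \<oplus> b) \<otimes> s = w \<otimes> (q a \<oplus> q b)" .
      qed
      then show ?thesis using q ab \<epsilon>_props(2) by simp
    qed
    show "\<epsilon> (q (r \<otimes> a)) = r \<odot>\<^bsub>E 0\<^esub> \<epsilon> (q a)" if ra: "r \<in> carrier R" "a \<in> \<mm>" for r a
    proof -
      have "q (r \<otimes> a) = r \<otimes> q a"
      proof (rule q_eq[OF idealD(5)[OF max_ideal_ideal ra]])
        show "r \<otimes> q a \<in> carrier R" using q ra by blast
        have "r \<otimes> a \<otimes> s = r \<otimes> (w \<otimes> q a)" using q[OF ra(2)] ra max_ideal_sub s(1) by (simp add: m_assoc)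
        then show "r \<otimes> a \<otimes> s = w \<otimes> (r \<otimes> q a)" using q ra wR by (simp add: m_lcomm)
      qed
      then show ?thesis using q ra \<epsilon>_props(3) by simp
    qed
  qed
  from injective_ideal_extend[OF is_cring E_injective max_ideal_ideal this]
  obtain e where e: "e \<in> carrier (E 0)" "\<And>a. a \<in> \<mm> \<Longrightarrow> \<epsilon> (q a) = a \<odot>\<^bsub>E 0\<^esub> e" by blast
  have qw: "q w = s" using w(1) s(1) by (intro q_eq) auto
  \<comment> \<open>As v lies outside J, every such a is a nonunit, and \<mm> e is contained in the
    copy of R.\<close>
  have "a \<odot>\<^bsub>E 1\<^esub> \<delta> 0 e = \<zero>\<^bsub>E 1\<^esub>" if a: "a \<in> carrier R" "a \<otimes> v \<in> J" for a
  proof -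
    have "a \<in> \<mm>"
    proof (rule ccontr)
      assume "a \<notin> \<mm>"
      then have U: "a \<in> Units R" using a units by blast
      then have "inv a \<otimes> (a \<otimes> v) \<in> J" using idealD(5)[OF J(1) _ a(2)] by simp
      then show False using U v a by (simp flip: m_assoc)
    qed
    then have "a \<odot>\<^bsub>E 0\<^esub> e \<in> \<epsilon> ` carrier R" using e(2) q by (metis image_eqI)
    then have "\<delta> 0 (a \<odot>\<^bsub>E 0\<^esub> e) = \<zero>\<^bsub>E 1\<^esub>" using ker[OF E0.smult_closed[OF a(1) e(1)]] by simp
    then show ?thesis using D\<delta>(3) a e by simp
  qed
  moreover have "\<delta> 0 e \<in> cosyzygy 1" using e(1) cosyzygy_Suc[of 0] by auto
  ultimately obtain c where c: "c \<in> cosyzygy 1" "\<And>a. a \<in> J \<Longrightarrow> a \<odot>\<^bsub>E 1\<^esub> c = \<zero>\<^bsub>E 1\<^esub>"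
    "\<delta> 0 e = v \<odot>\<^bsub>E 1\<^esub> c"
    using principally_injectiveE[OF cosyzygy_1_principally_injective J(1) v(1)] by metis
  then obtain e' where e': "e' \<in> carrier (E 0)" "c = \<delta> 0 e'" using cosyzygy_Suc[of 0] by auto
  have JR: "j \<in> carrier R" if "j \<in> J" for j using that idealD(1)[OF J(1)] by blast
  have Je': "\<exists>b\<in>carrier R. j \<odot>\<^bsub>E 0\<^esub> e' = \<epsilon> b" if j: "j \<in> J" for j
  proof -
    have "\<delta> 0 (j \<odot>\<^bsub>E 0\<^esub> e') = \<zero>\<^bsub>E 1\<^esub>" using c(2)[OF j] e' D\<delta>(3) JR[OF j] by simp
    then show ?thesis using ker[OF E0.smult_closed[OF JR[OF j] e'(1)]] by blast
  qed
  \<comment> \<open>Since w \<in> J, the element w e' comes from R; y is its preimage. The relation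
    between v e' and e then becomes v y = w z + s, and s is not in (w).\<close>
  obtain y where y: "y \<in> carrier R" "w \<odot>\<^bsub>E 0\<^esub> e' = \<epsilon> y" using Je'[OF J(2)] by blast
  show thesis
  proof (rule that[OF y(1)])
    fix j assume j: "j \<in> J"
    obtain b where b: "b \<in> carrier R" "j \<odot>\<^bsub>E 0\<^esub> e' = \<epsilon> b" using Je'[OF j] by blast
    have "\<epsilon> (j \<otimes> y) = \<epsilon> (w \<otimes> b)"
      using \<epsilon>_props(3) y b JR[OF j] wR e'(1) E0.smult_left_commute by metis
    then have "j \<otimes> y = w \<otimes> b" using \<epsilon>_props(4) y b JR[OF j] wR by blast
    then show "y \<otimes> j \<in> PIdl w" using y b JR[OF j] wR by (auto simp: cgenideal_def m_comm)
  next
    have "\<delta> 0 (v \<odot>\<^bsub>E 0\<^esub> e') = \<delta> 0 e" using c(3) e' D\<delta>(3) v by simp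
    then have "\<delta> 0 (v \<odot>\<^bsub>E 0\<^esub> e' \<ominus>\<^bsub>E 0\<^esub> e) = \<zero>\<^bsub>E 1\<^esub>"
      using is_module_hom_zero_minus(2)[OF E_module E_module \<delta>_hom[of 0], of "v \<odot>\<^bsub>E 0\<^esub> e'" e]
        E1.minus_eq_zero_iff[of "\<delta> 0 e" "\<delta> 0 e"] E0.smult_closed[OF v(1) e'(1)] e(1) D\<delta>(1)[OF e(1)]
      by (metis One_nat_def)
    then obtain z where z: "z \<in> carrier R" "v \<odot>\<^bsub>E 0\<^esub> e' \<ominus>\<^bsub>E 0\<^esub> e = \<epsilon> z"
      using ker[OF E0.M.minus_closed[OF E0.smult_closed[OF v(1) e'(1)] e(1)]] by blast
    have "v \<odot>\<^bsub>E 0\<^esub> e' = \<epsilon> z \<oplus>\<^bsub>E 0\<^esub> e"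
      using E0.minus_cancel[of "v \<odot>\<^bsub>E 0\<^esub> e'" e] z(2) e e' v by simp
    have "\<epsilon> (v \<otimes> y) = w \<odot>\<^bsub>E 0\<^esub> (v \<odot>\<^bsub>E 0\<^esub> e')"
      using \<epsilon>_props(3)[OF v(1) y(1)] y(2) E0.smult_left_commute[OF v(1) wR e'(1)] by simp
    also have "\<dots> = w \<odot>\<^bsub>E 0\<^esub> (\<epsilon> z \<oplus>\<^bsub>E 0\<^esub> e)" using \<open>v \<odot>\<^bsub>E 0\<^esub> e' = \<epsilon> z \<oplus>\<^bsub>E 0\<^esub> e\<close> by simp
    also have "\<dots> = \<epsilon> (w \<otimes> z \<oplus> s)"
      using z(1) e(1) wR s(1) by (simp add: E0.smult_r_distr \<epsilon>_props(1-3) qw flip: e(2)[OF w(1)])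
    finally have vy: "v \<otimes> y = w \<otimes> z \<oplus> s"
      by (rule \<epsilon>_props(4)[rotated 2]) (use v(1) y(1) z(1) wR s(1) in simp_all)
    show "y \<otimes> v \<notin> PIdl w"
    proof
      assume "y \<otimes> v \<in> PIdl w"
      then have "w \<otimes> z \<oplus> s \<in> PIdl w" using vy v y by (simp add: m_comm)
      moreover have "w \<otimes> z \<in> PIdl w"
        using idealD(5)[OF cgenideal_ideal[OF wR] z(1) cgenideal_self[OF wR]] z(1) wR by (simp add: m_comm)
      ultimately have "w \<otimes> z \<oplus> s \<ominus> w \<otimes> z \<in> PIdl w" using idealD(4)[OF cgenideal_ideal[OF wR]] by blast
      then show False using s z wR by (simp add: add_minus_cancel_left)
    qed
  qed
qed

text \<open>If t were outside (w) + R s, duality would give y with y s \<in> (w) and y t \<notin>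
  (w). The latter makes y a unit, and then the former puts s into (w).\<close>

lemma quotient_socle_simple:
  assumes w: "w \<in> \<mm>" "regular_element R w"
    and s: "s \<in> carrier R" "s \<notin> PIdl w" "\<And>a. a \<in> \<mm> \<Longrightarrow> a \<otimes> s \<in> PIdl w"
    and t: "t \<in> carrier R" "\<And>a. a \<in> \<mm> \<Longrightarrow> a \<otimes> t \<in> PIdl w"
  obtains r where "r \<in> carrier R" "t \<ominus> r \<otimes> s \<in> PIdl w"
proof -
  have wR: "w \<in> carrier R" using w(1) by (rule max_ideal_sub)
  note I = cgenideal_ideal[OF wR]
  let ?K = "{j \<oplus> a \<otimes> s | j a. j \<in> PIdl w \<and> a \<in> carrier R}"
  note K = ideal_add_principal[OF I s(1)]
  have "t \<in> ?K"
  proof (rule ccontr)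
    assume "t \<notin> ?K"
    then obtain y where y: "y \<in> carrier R" "\<And>j. j \<in> ?K \<Longrightarrow> y \<otimes> j \<in> PIdl w" "y \<otimes> t \<notin> PIdl w"
      using separating_annihilator[OF w K(1) _ t(1)] K(2) cgenideal_self[OF wR] by (metis (no_types, lifting) subsetD)
    have "y \<notin> \<mm>" using y(3) t(2) by blast
    then have U: "y \<in> Units R" using y(1) units by blast
    then have "inv y \<otimes> (y \<otimes> s) \<in> PIdl w" using idealD(5)[OF I _ y(2)[OF K(3)]] by simp
    then show False using U s y by (simp flip: m_assoc)
  qed
  then obtain j a where ja: "j \<in> PIdl w" "a \<in> carrier R" "t = j \<oplus> a \<otimes> s" by blast
  have "j \<in> carrier R" using ja(1) idealD(1)[OF I] by blast
  then have "t \<ominus> a \<otimes> s = j" using ja s(1) by (simp add: add_minus_cancel)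
  then show thesis using that ja by simp
qed

end

section \<open>Lengths of subquotients\<close>

text \<open>The correspondence theorem for P \<rightarrow> W/K, with no quotient formed: p respects
  scalars only modulo K. The surjection \<rho> permits a change of rings, as for R/I and for the
  idealization, whose second projection is not linear.\<close>

lemma chain_length_correspondence:
  fixes \<rho> :: "'a \<Rightarrow> 'b" and p :: "'p \<Rightarrow> 'q"
  assumes P: "module A P" and Q: "module B Q" and \<rho>: "\<rho> ` carrier A = carrier B"
    and K: "submodule K B Q" and W: "submodule W B Q" "K \<subseteq> W"
    and p_W: "\<And>z. z \<in> carrier P \<Longrightarrow> p z \<in> W"
    and p_add: "\<And>y z. \<lbrakk>y \<in> carrier P; z \<in> carrier P\<rbrakk> \<Longrightarrow> p (y \<oplus>\<^bsub>P\<^esub> z) = p y \<oplus>\<^bsub>Q\<^esub> p z"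
    and p_smult: "\<And>a z. \<lbrakk>a \<in> carrier A; z \<in> carrier P\<rbrakk> \<Longrightarrow>
      \<exists>k\<in>K. p (a \<odot>\<^bsub>P\<^esub> z) = \<rho> a \<odot>\<^bsub>Q\<^esub> p z \<oplus>\<^bsub>Q\<^esub> k"
    and onto: "\<And>w. w \<in> W \<Longrightarrow> \<exists>z\<in>carrier P. \<exists>k\<in>K. w = p z \<oplus>\<^bsub>Q\<^esub> k"
  shows "chain_length {N. submodule N A P \<and> {z \<in> carrier P. p z \<in> K} \<subseteq> N} =
    chain_length {N. submodule N B Q \<and> K \<subseteq> N \<and> N \<subseteq> W}"
    (is "chain_length ?\<A> = chain_length ?\<B>")
proof (rule antisym)
  interpret P: module A P by (rule P)
  interpret Q: module B Q by (rule Q)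
  note DK = Q.submoduleD[OF K] and DW = Q.submoduleD[OF W(1)]
  have p_cl: "p z \<in> carrier Q" if "z \<in> carrier P" for z using p_W[OF that] DW(1) by blast
  have k_cl: "k \<in> carrier Q" if "k \<in> K" for k using that DK(1) by blast
  have p_minus: "p (y \<ominus>\<^bsub>P\<^esub> z) = p y \<ominus>\<^bsub>Q\<^esub> p z" if "y \<in> carrier P" "z \<in> carrier P" for y z
  proof -
    have "p y = p (y \<ominus>\<^bsub>P\<^esub> z) \<oplus>\<^bsub>Q\<^esub> p z"
      using p_add[of "y \<ominus>\<^bsub>P\<^esub> z" z] that by (simp add: P.minus_cancel)
    then show ?thesis using that p_cl by (simp add: Q.add_minus_cancel)
  qed
  have p_zero: "p \<zero>\<^bsub>P\<^esub> = \<zero>\<^bsub>Q\<^esub>"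
    using p_minus[of "\<zero>\<^bsub>P\<^esub>" "\<zero>\<^bsub>P\<^esub>"] p_cl by (simp add: P.minus_eq_zero_iff[THEN iffD2] Q.minus_eq_zero_iff[THEN iffD2])
  define up where "up N = {p z \<oplus>\<^bsub>Q\<^esub> k | z k. z \<in> N \<and> k \<in> K}" for N
  show "chain_length ?\<A> \<le> chain_length ?\<B>"
  proof (rule chain_length_mono_map[where F = up])
    fix N assume "N \<in> ?\<A>"
    then have N: "submodule N A P" "{z \<in> carrier P. p z \<in> K} \<subseteq> N" by auto
    note DN = P.submoduleD[OF N(1)]
    have n_cl: "z \<in> carrier P" if "z \<in> N" for z using that DN(1) by blast
    have "K \<subseteq> up N"
    proof
      fix k assume k: "k \<in> K"
      then have "k = p \<zero>\<^bsub>P\<^esub> \<oplus>\<^bsub>Q\<^esub> k" using p_zero k_cl by simp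
      then show "k \<in> up N" using k DN(2) unfolding up_def by blast
    qed
    moreover have "up N \<subseteq> W" using n_cl p_W W(2) DW(3) by (auto simp: up_def)
    moreover have "submodule (up N) B Q"
    proof (rule Q.submoduleI')
      show "up N \<subseteq> carrier Q" using \<open>up N \<subseteq> W\<close> DW(1) by blast
      show "\<zero>\<^bsub>Q\<^esub> \<in> up N" using \<open>K \<subseteq> up N\<close> DK(2) by blast
    next
      fix u v assume "u \<in> up N" "v \<in> up N"
      then obtain y z k l where *: "y \<in> N" "z \<in> N" "k \<in> K" "l \<in> K"
        "u = p y \<oplus>\<^bsub>Q\<^esub> k" "v = p z \<oplus>\<^bsub>Q\<^esub> l" by (auto simp: up_def)
      have "u \<oplus>\<^bsub>Q\<^esub> v = p (y \<oplus>\<^bsub>P\<^esub> z) \<oplus>\<^bsub>Q\<^esub> (k \<oplus>\<^bsub>Q\<^esub> l)"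
        using * n_cl p_cl k_cl by (simp add: p_add Q.a_ac)
      then show "u \<oplus>\<^bsub>Q\<^esub> v \<in> up N" unfolding up_def using * DN(3) DK(3) by blast
    next
      fix c u assume c: "c \<in> carrier B" and "u \<in> up N"
      then obtain z k where *: "z \<in> N" "k \<in> K" "u = p z \<oplus>\<^bsub>Q\<^esub> k" by (auto simp: up_def)
      obtain a where a: "a \<in> carrier A" "c = \<rho> a" using c \<rho> by blast
      obtain k' where k': "k' \<in> K" "p (a \<odot>\<^bsub>P\<^esub> z) = c \<odot>\<^bsub>Q\<^esub> p z \<oplus>\<^bsub>Q\<^esub> k'"
        using p_smult[OF a(1) n_cl[OF *(1)]] a by blast
      have "c \<odot>\<^bsub>Q\<^esub> u = p (a \<odot>\<^bsub>P\<^esub> z) \<oplus>\<^bsub>Q\<^esub> (c \<odot>\<^bsub>Q\<^esub> k \<ominus>\<^bsub>Q\<^esub> k')"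
      proof -
        have cl: "c \<odot>\<^bsub>Q\<^esub> p z \<in> carrier Q" "c \<odot>\<^bsub>Q\<^esub> k \<in> carrier Q" "k' \<in> carrier Q"
          using c p_cl n_cl k_cl * k' by auto
        then have "c \<odot>\<^bsub>Q\<^esub> p z \<oplus>\<^bsub>Q\<^esub> k' \<oplus>\<^bsub>Q\<^esub> (c \<odot>\<^bsub>Q\<^esub> k \<ominus>\<^bsub>Q\<^esub> k') =
            c \<odot>\<^bsub>Q\<^esub> p z \<oplus>\<^bsub>Q\<^esub> (c \<odot>\<^bsub>Q\<^esub> k \<oplus>\<^bsub>Q\<^esub> (k' \<ominus>\<^bsub>Q\<^esub> k'))"
          by (simp add: a_minus_def Q.a_ac)
        also have "\<dots> = c \<odot>\<^bsub>Q\<^esub> p z \<oplus>\<^bsub>Q\<^esub> c \<odot>\<^bsub>Q\<^esub> k"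
          using cl by (simp add: Q.minus_eq_zero_iff[THEN iffD2])
        also have "\<dots> = c \<odot>\<^bsub>Q\<^esub> u" using c p_cl n_cl k_cl * by (simp add: Q.smult_r_distr)
        finally show ?thesis using k' by simp
      qed
      then show "c \<odot>\<^bsub>Q\<^esub> u \<in> up N"
        unfolding up_def using * k' a c DN(5) DK(4,5) by blast
    qed
    ultimately show "up N \<in> ?\<B>" by simp
  next
    fix N N' assume "N \<in> ?\<A>" "N' \<in> ?\<A>" "N \<subset> N'"
    then have N: "submodule N A P" "{z \<in> carrier P. p z \<in> K} \<subseteq> N" and N': "submodule N' A P" by auto
    note DN = P.submoduleD[OF N(1)] and DN' = P.submoduleD[OF N']
    obtain z where z: "z \<in> N'" "z \<notin> N" using \<open>N \<subset> N'\<close> by blast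
    have zP: "z \<in> carrier P" using z DN'(1) by blast
    have "p z = p z \<oplus>\<^bsub>Q\<^esub> \<zero>\<^bsub>Q\<^esub>" using p_cl[OF zP] by simp
    then have "p z \<in> up N'" unfolding up_def using z(1) DK(2) by blast
    moreover have "p z \<notin> up N"
    proof
      assume "p z \<in> up N"
      then obtain y k where y: "y \<in> N" "k \<in> K" "p z = p y \<oplus>\<^bsub>Q\<^esub> k" by (auto simp: up_def)
      have yP: "y \<in> carrier P" using y DN(1) by blast
      have "p (z \<ominus>\<^bsub>P\<^esub> y) = k"
        using y zP yP p_cl k_cl by (simp add: p_minus Q.add_minus_cancel_left)
      then have "z \<ominus>\<^bsub>P\<^esub> y \<in> N" using N(2) y(2) zP yP by auto
      then have "z \<ominus>\<^bsub>P\<^esub> y \<oplus>\<^bsub>P\<^esub> y \<in> N" using DN(3) y(1) by blast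
      then show False using z(2) zP yP by (simp add: P.minus_cancel)
    qed
    moreover have "up N \<subseteq> up N'" using \<open>N \<subset> N'\<close> unfolding up_def by blast
    ultimately show "up N \<subset> up N'" by blast
  qed
  define dn where "dn N = {z \<in> carrier P. p z \<in> N}" for N
  show "chain_length ?\<B> \<le> chain_length ?\<A>"
  proof (rule chain_length_mono_map[where F = dn])
    fix N assume "N \<in> ?\<B>"
    then have N: "submodule N B Q" "K \<subseteq> N" by auto
    note DN = Q.submoduleD[OF N(1)]
    have "submodule (dn N) A P"
    proof (rule P.submoduleI')
      fix a z assume a: "a \<in> carrier A" and z: "z \<in> dn N"
      then obtain k where k: "k \<in> K" "p (a \<odot>\<^bsub>P\<^esub> z) = \<rho> a \<odot>\<^bsub>Q\<^esub> p z \<oplus>\<^bsub>Q\<^esub> k"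
        using p_smult by (auto simp: dn_def)
      have "\<rho> a \<in> carrier B" using a \<rho> by blast
      then have "p (a \<odot>\<^bsub>P\<^esub> z) \<in> N" using k N(2) z DN(3,5) by (auto simp: dn_def)
      then show "a \<odot>\<^bsub>P\<^esub> z \<in> dn N" using a z by (auto simp: dn_def)
    qed (use DN p_add p_zero in \<open>auto simp: dn_def\<close>)
    then show "dn N \<in> ?\<A>" using N(2) by (auto simp: dn_def)
  next
    fix N N' assume "N \<in> ?\<B>" "N' \<in> ?\<B>" "N \<subset> N'"
    then have N: "submodule N B Q" "K \<subseteq> N" and N': "submodule N' B Q" "K \<subseteq> N'" "N' \<subseteq> W" by auto
    obtain w where w: "w \<in> N'" "w \<notin> N" using \<open>N \<subset> N'\<close> by blast
    then obtain z k where z: "z \<in> carrier P" "k \<in> K" "w = p z \<oplus>\<^bsub>Q\<^esub> k" using onto N'(3) by blast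
    have "w \<ominus>\<^bsub>Q\<^esub> k = p z" using z p_cl k_cl by (simp add: Q.add_minus_cancel)
    moreover have "w \<ominus>\<^bsub>Q\<^esub> k \<in> N'" using Q.submoduleD(4)[OF N'(1)] w z N'(2) by blast
    ultimately have "z \<in> dn N'" using z by (simp add: dn_def)
    moreover have "z \<notin> dn N"
      using Q.submoduleD(3)[OF N(1), of "p z" k] w z N(2) by (auto simp: dn_def)
    ultimately show "dn N \<subset> dn N'" using \<open>N \<subset> N'\<close> by (auto simp: dn_def)
  qed
qed

lemma quotient_module_length:
  fixes M :: "('a, 'm) module"
  assumes M: "module R M" and N: "submodule N R M"
  shows "module_length R (quotient_module R M N) = chain_length {L. submodule L R M \<and> N \<subseteq> L}"
proof -
  let ?Q = "quotient_module R M N"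
  interpret M: module R M by (rule M)
  note simps = quotient_module_simps[OF M N] and Q = quotient_module_module[OF M N]
  interpret Q: module R ?Q by (rule Q)
  note h = is_module_homD[OF Q(2)]
  have "{z \<in> carrier M. N +>\<^bsub>M\<^esub> z \<in> {\<zero>\<^bsub>?Q\<^esub>}} = N"
  proof -
    have "N +>\<^bsub>M\<^esub> \<zero>\<^bsub>M\<^esub> = N" using M.submoduleD(1)[OF N] by simp
    then have "N +>\<^bsub>M\<^esub> z = N \<longleftrightarrow> z \<in> N" if "z \<in> carrier M" for z
      using simps(5)[OF that, of "\<zero>\<^bsub>M\<^esub>"] M.add_minus_cancel[of z "\<zero>\<^bsub>M\<^esub>"] that by simp
    then show ?thesis using M.submoduleD(1)[OF N] simps(2) by auto
  qed
  moreover have "chain_length {L. submodule L R M \<and> {z \<in> carrier M. N +>\<^bsub>M\<^esub> z \<in> {\<zero>\<^bsub>?Q\<^esub>}} \<subseteq> L} =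
      chain_length {L. submodule L R ?Q \<and> {\<zero>\<^bsub>?Q\<^esub>} \<subseteq> L \<and> L \<subseteq> carrier ?Q}"
  proof (rule chain_length_correspondence[OF M Q(1), where \<rho> = id])
    show "\<exists>k\<in>{\<zero>\<^bsub>?Q\<^esub>}. N +>\<^bsub>M\<^esub> (a \<odot>\<^bsub>M\<^esub> z) = id a \<odot>\<^bsub>?Q\<^esub> (N +>\<^bsub>M\<^esub> z) \<oplus>\<^bsub>?Q\<^esub> k"
      if "a \<in> carrier R" "z \<in> carrier M" for a z
      using that h by simp
    show "\<exists>z\<in>carrier M. \<exists>k\<in>{\<zero>\<^bsub>?Q\<^esub>}. w = (N +>\<^bsub>M\<^esub> z) \<oplus>\<^bsub>?Q\<^esub> k" if w: "w \<in> carrier ?Q" for w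
    proof -
      obtain z where "z \<in> carrier M" "w = N +>\<^bsub>M\<^esub> z" using w simps(1) by auto
      then show ?thesis using w by (intro bexI[of _ z]) auto
    qed
  qed (use h Q.carrier_is_submodule in \<open>auto intro: submodule_zero[OF Q(1)]\<close>)
  moreover have "{L. submodule L R ?Q \<and> {\<zero>\<^bsub>?Q\<^esub>} \<subseteq> L \<and> L \<subseteq> carrier ?Q} = {L. submodule L R ?Q}"
    using Q.submoduleD(1,2) by blast
  ultimately show ?thesis by (simp add: module_length_chain)
qed

text \<open>\<open>simple\<close> says that each element of C outside B generates C modulo B. For c
  in N outside B and y in N' outside N, the element y - r c lies in N' and B but not in N, which is
  the modular condition of \<open>chain_length_Suc\<close>.\<close>

lemma interval_length_Suc:
  assumes M: "module R M" and A: "submodule A R M" and B: "submodule B R M" and C: "submodule C R M"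
    and AB: "A \<subseteq> B" and BC: "B \<subset> C"
    and simple: "\<And>c y. \<lbrakk>c \<in> C; c \<notin> B; y \<in> C\<rbrakk> \<Longrightarrow> \<exists>r\<in>carrier R. y \<ominus>\<^bsub>M\<^esub> r \<odot>\<^bsub>M\<^esub> c \<in> B"
  shows "chain_length {N. submodule N R M \<and> A \<subseteq> N \<and> N \<subseteq> C} =
    1 + chain_length {N. submodule N R M \<and> A \<subseteq> N \<and> N \<subseteq> B}"
proof -
  interpret M: module R M by (rule M)
  note DB = M.submoduleD[OF B] and DC = M.submoduleD[OF C]
  let ?\<A> = "{N. submodule N R M \<and> A \<subseteq> N \<and> N \<subseteq> C}"
  have "chain_length ?\<A> = 1 + chain_length {N \<in> ?\<A>. N \<subseteq> B}"
  proof (rule chain_length_Suc[OF _ _ BC])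
    show "C \<in> ?\<A>" using C AB BC by blast
    show "N \<subseteq> C" if "N \<in> ?\<A>" for N using that by blast
    show "N \<inter> B \<in> ?\<A>" if "N \<in> ?\<A>" for N
    proof -
      have "submodule N R M" using that by blast
      note DN = M.submoduleD[OF this]
      have "submodule (N \<inter> B) R M"
        by (rule M.submoduleI') (use DN DB in auto)
      then show ?thesis using that AB by blast
    qed
    show "N \<inter> B \<subset> N' \<inter> B" if N: "N \<in> ?\<A>" "N' \<in> ?\<A>" "N \<subset> N'" "\<not> N \<subseteq> B" for N N'
    proof -
      have sub: "submodule N R M" "submodule N' R M" using N by auto
      note DN = M.submoduleD[OF sub(1)] and DN' = M.submoduleD[OF sub(2)]
      obtain y where y: "y \<in> N'" "y \<notin> N" using N(3) by blast
      obtain c where c: "c \<in> N" "c \<notin> B" using N(4) by blast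
      obtain r where r: "r \<in> carrier R" "y \<ominus>\<^bsub>M\<^esub> r \<odot>\<^bsub>M\<^esub> c \<in> B"
        using simple[of c y] c y N(1,2) by blast
      have cl: "y \<in> carrier M" "r \<odot>\<^bsub>M\<^esub> c \<in> carrier M" "r \<odot>\<^bsub>M\<^esub> c \<in> N"
        using y c r DN DN' by auto
      have "y \<ominus>\<^bsub>M\<^esub> r \<odot>\<^bsub>M\<^esub> c \<in> N'" using DN'(4) y(1) cl(3) N(3) by blast
      moreover have "y \<ominus>\<^bsub>M\<^esub> r \<odot>\<^bsub>M\<^esub> c \<notin> N"
        using DN(3)[of "y \<ominus>\<^bsub>M\<^esub> r \<odot>\<^bsub>M\<^esub> c" "r \<odot>\<^bsub>M\<^esub> c"] cl y(2) by (auto simp: M.minus_cancel)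
      ultimately show ?thesis using r(2) N(3) by blast
    qed
  qed
  moreover have "{N \<in> ?\<A>. N \<subseteq> B} = {N. submodule N R M \<and> A \<subseteq> N \<and> N \<subseteq> B}" using BC by blast
  ultimately show ?thesis by simp
qed

section \<open>The first Ext module of the residue field\<close>

lemma hom_module_simps:
  "f \<in> carrier (hom_module R P M) \<longleftrightarrow> f \<in> extensional (carrier P) \<and> is_module_hom R P M f"
  "\<zero>\<^bsub>hom_module R P M\<^esub> = (\<lambda>x\<in>carrier P. \<zero>\<^bsub>M\<^esub>)"
  "f \<oplus>\<^bsub>hom_module R P M\<^esub> g = (\<lambda>x\<in>carrier P. f x \<oplus>\<^bsub>M\<^esub> g x)"
  "a \<odot>\<^bsub>hom_module R P M\<^esub> f = (\<lambda>x\<in>carrier P. a \<odot>\<^bsub>M\<^esub> f x)"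
  by (simp_all add: hom_module_def)

lemma is_module_hom_restrict:
  assumes "module R P"
  shows "is_module_hom R P M (\<lambda>x\<in>carrier P. f x) \<longleftrightarrow> is_module_hom R P M f"
proof -
  interpret P: module R P by fact
  show ?thesis by (auto simp: is_module_hom_def Pi_iff)
qed

lemma hom_module_module:
  assumes P: "module R P" and M: "module R M"
  shows "module R (hom_module R P M)" (is "module R ?H")
proof -
  interpret P: module R P by (rule P)
  interpret M: module R M by (rule M)
  have cl: "f x \<in> carrier M" if "f \<in> carrier ?H" "x \<in> carrier P" for f x
    using that is_module_homD(1) by (auto simp: hom_module_simps)
  have eqI: "f = g" if "f \<in> extensional (carrier P)" "g \<in> extensional (carrier P)"
    "\<And>x. x \<in> carrier P \<Longrightarrow> f x = g x" for f g :: "'c \<Rightarrow> 'd"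
    using that by (rule extensionalityI)
  have zero_hom: "is_module_hom R P M (\<lambda>x. \<zero>\<^bsub>M\<^esub>)" by (rule is_module_homI) auto
  have add: "f \<oplus>\<^bsub>?H\<^esub> g \<in> carrier ?H" if "f \<in> carrier ?H" "g \<in> carrier ?H" for f g
    using that is_module_hom_add[OF M] by (auto simp: hom_module_simps is_module_hom_restrict[OF P])
  have smult: "a \<odot>\<^bsub>?H\<^esub> f \<in> carrier ?H" if "a \<in> carrier R" "f \<in> carrier ?H" for a f
    using that is_module_hom_smult[OF M] by (auto simp: hom_module_simps is_module_hom_restrict[OF P])
  have zero: "\<zero>\<^bsub>?H\<^esub> \<in> carrier ?H"
    using zero_hom by (simp add: hom_module_simps is_module_hom_restrict[OF P])
  have ext: "f \<in> extensional (carrier P)" if "f \<in> carrier ?H" for f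
    using that by (simp add: hom_module_simps)
  show ?thesis
  proof (rule moduleI[OF P.is_cring])
    show "abelian_group ?H"
    proof (rule abelian_groupI)
      fix f assume f: "f \<in> carrier ?H"
      have "(\<ominus>\<^bsub>R\<^esub> \<one>\<^bsub>R\<^esub>) \<odot>\<^bsub>?H\<^esub> f \<oplus>\<^bsub>?H\<^esub> f = \<zero>\<^bsub>?H\<^esub>"
        using cl[OF f] by (auto simp: hom_module_simps M.smult_l_minus M.l_neg intro!: restrict_ext)
      then show "\<exists>g\<in>carrier ?H. g \<oplus>\<^bsub>?H\<^esub> f = \<zero>\<^bsub>?H\<^esub>" using smult[OF _ f] by blast
      show "\<zero>\<^bsub>?H\<^esub> \<oplus>\<^bsub>?H\<^esub> f = f"
        by (rule eqI) (use ext[OF f] cl[OF f] in \<open>auto simp: hom_module_simps\<close>)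
    next
      fix f g h assume "f \<in> carrier ?H" "g \<in> carrier ?H" "h \<in> carrier ?H"
      note c = cl[OF this(1)] cl[OF this(2)] cl[OF this(3)]
      show "f \<oplus>\<^bsub>?H\<^esub> g \<oplus>\<^bsub>?H\<^esub> h = f \<oplus>\<^bsub>?H\<^esub> (g \<oplus>\<^bsub>?H\<^esub> h)"
        using c by (auto simp: hom_module_simps M.a_assoc intro!: restrict_ext)
    next
      fix f g assume "f \<in> carrier ?H" "g \<in> carrier ?H"
      then show "f \<oplus>\<^bsub>?H\<^esub> g = g \<oplus>\<^bsub>?H\<^esub> f"
        using cl by (auto simp: hom_module_simps M.a_comm intro!: restrict_ext)
    qed (use add zero in auto)
  next
    fix f assume f: "f \<in> carrier ?H"
    show "\<one>\<^bsub>R\<^esub> \<odot>\<^bsub>?H\<^esub> f = f"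
      by (rule eqI) (use ext[OF f] cl[OF f] in \<open>auto simp: hom_module_simps\<close>)
  next
    fix a b f assume "a \<in> carrier R" "b \<in> carrier R" "f \<in> carrier ?H"
    then show "(a \<oplus>\<^bsub>R\<^esub> b) \<odot>\<^bsub>?H\<^esub> f = a \<odot>\<^bsub>?H\<^esub> f \<oplus>\<^bsub>?H\<^esub> b \<odot>\<^bsub>?H\<^esub> f"
      "(a \<otimes>\<^bsub>R\<^esub> b) \<odot>\<^bsub>?H\<^esub> f = a \<odot>\<^bsub>?H\<^esub> (b \<odot>\<^bsub>?H\<^esub> f)"
      using cl by (auto simp: hom_module_simps M.smult_l_distr M.smult_assoc1 intro!: restrict_ext)
  next
    fix a f g assume "a \<in> carrier R" "f \<in> carrier ?H" "g \<in> carrier ?H"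
    then show "a \<odot>\<^bsub>?H\<^esub> (f \<oplus>\<^bsub>?H\<^esub> g) = a \<odot>\<^bsub>?H\<^esub> f \<oplus>\<^bsub>?H\<^esub> a \<odot>\<^bsub>?H\<^esub> g"
      using cl by (auto simp: hom_module_simps M.smult_r_distr intro!: restrict_ext)
  qed (use smult in auto)
qed

definition multiples :: "('a, 'm) module \<Rightarrow> 'a \<Rightarrow> 'm set" where
  "multiples M x = (\<lambda>y. x \<odot>\<^bsub>M\<^esub> y) ` carrier M"

lemma submodule_multiples:
  assumes M: "module R M" and x: "x \<in> carrier R"
  shows "submodule (multiples M x) R M"
proof -
  interpret M: module R M by (rule M)
  have "is_module_hom R M M (\<lambda>y. x \<odot>\<^bsub>M\<^esub> y)"
    by (rule is_module_homI) (use x in \<open>auto simp: M.smult_r_distr M.smult_left_commute\<close>)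
  then show ?thesis
    unfolding multiples_def by (rule submodule_image[OF M M _ M.carrier_is_submodule])
qed

text \<open>The preimage in M of the socle of M/xM.\<close>

definition socle_mod :: "'a set \<Rightarrow> ('a, 'm) module \<Rightarrow> 'a \<Rightarrow> 'm set" where
  "socle_mod \<mm> M x = {w \<in> carrier M. \<forall>a\<in>\<mm>. a \<odot>\<^bsub>M\<^esub> w \<in> multiples M x}"

context noetherian_local
begin

lemma submodule_socle_mod:
  assumes M: "module R M" and x: "x \<in> carrier R"
  shows "submodule (socle_mod \<mm> M x) R M" "multiples M x \<subseteq> socle_mod \<mm> M x"
proof -
  interpret M: module R M by (rule M)
  note D = M.submoduleD[OF submodule_multiples[OF M x]]
  show "submodule (socle_mod \<mm> M x) R M"
    by (rule M.submoduleI')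
      (use D max_ideal_sub in \<open>auto simp: socle_mod_def M.smult_r_distr M.smult_left_commute\<close>)
  show "multiples M x \<subseteq> socle_mod \<mm> M x"
    using D(1,5) max_ideal_sub by (auto simp: socle_mod_def)
qed

lemma residue_field_props:
  "module R (residue_field R)"
  "is_module_hom R (regular_module R) (residue_field R) ((+>\<^bsub>regular_module R\<^esub>) \<mm>)"
  "carrier (residue_field R) = (+>\<^bsub>regular_module R\<^esub>) \<mm> ` carrier R"
  "a \<in> carrier R \<Longrightarrow> \<mm> +>\<^bsub>regular_module R\<^esub> a = \<zero>\<^bsub>residue_field R\<^esub> \<longleftrightarrow> a \<in> \<mm>"
proof -
  have m: "submodule \<mm> R (regular_module R)" using max_ideal_ideal by (simp add: submodule_regular_iff)
  note Q = quotient_module_module[OF regular_module_module m]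
    and S = quotient_module_simps[OF regular_module_module m]
  interpret RR: module R "regular_module R" by (rule regular_module_module)
  show "module R (residue_field R)"
    "is_module_hom R (regular_module R) (residue_field R) ((+>\<^bsub>regular_module R\<^esub>) \<mm>)"
    using Q by (simp_all add: residue_field_def max_ideal_eq)
  show "carrier (residue_field R) = (+>\<^bsub>regular_module R\<^esub>) \<mm> ` carrier R"
    using S(1) by (simp add: residue_field_def max_ideal_eq regular_module_simps)
  have "\<mm> +>\<^bsub>regular_module R\<^esub> \<zero> = \<mm>"
    using RR.a_coset_add_zero[of \<mm>] max_ideal_sub by (auto simp: regular_module_simps)
  then show "\<mm> +>\<^bsub>regular_module R\<^esub> a = \<zero>\<^bsub>residue_field R\<^esub> \<longleftrightarrow> a \<in> \<mm>" if "a \<in> carrier R"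
    using S(2) S(5)[of a \<zero>] that
    by (simp add: residue_field_def max_ideal_eq regular_module_simps regular_module_minus)
      (simp add: a_minus_def)
qed

text \<open>Guarantees that the choice made in the definition of \<open>Ext\<close> really selects a
  resolution.\<close>

lemma residue_field_resolution: "\<exists>b d e. free_resolution R (residue_field R) b d e"
proof -
  have hom0: "is_module_hom R (free_module R 1) (regular_module R) (\<lambda>v. v 0)"
    by (rule is_module_homI) (auto simp: free_module_simps regular_module_simps)
  define e where "e v = \<mm> +>\<^bsub>regular_module R\<^esub> v 0" for v :: "nat \<Rightarrow> 'a"
  have e: "is_module_hom R (free_module R 1) (residue_field R) e"
    unfolding e_def by (rule is_module_hom_compose[OF hom0 residue_field_props(2)])
  have onto: "e ` carrier (free_module R 1) = carrier (residue_field R)"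
  proof
    show "e ` carrier (free_module R 1) \<subseteq> carrier (residue_field R)"
      using is_module_homD(1)[OF e] by blast
    show "carrier (residue_field R) \<subseteq> e ` carrier (free_module R 1)"
    proof
      fix y assume "y \<in> carrier (residue_field R)"
      then obtain a where a: "a \<in> carrier R" "y = \<mm> +>\<^bsub>regular_module R\<^esub> a"
        using residue_field_props(3) by auto
      then have "y = e (\<lambda>i. if i = 0 then a else \<zero>)" by (simp add: e_def)
      moreover have "(\<lambda>i. if i = 0 then a else \<zero>) \<in> carrier (free_module R 1)"
        using a by (auto simp: free_module_simps)
      ultimately show "y \<in> e ` carrier (free_module R 1)" by blast
    qed
  qed
  have K: "submodule (module_kernel (free_module R 1) (residue_field R) e) R (free_module R 1)"
    by (rule submodule_kernel[OF free_module_module residue_field_props(1) e])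
  from free_resolution_of_submodule[OF is_cring noetherian_ring_axioms K] obtain b d where "b 0 = 1"
    "\<And>i. is_module_hom R (free_module R (b (Suc i))) (free_module R (b i)) (d i)"
    "d 0 ` carrier (free_module R (b 1)) = module_kernel (free_module R 1) (residue_field R) e"
    "\<And>i. d (Suc i) ` carrier (free_module R (b (Suc (Suc i)))) =
       module_kernel (free_module R (b (Suc i))) (free_module R (b i)) (d i)" by blast
  then have "free_resolution R (residue_field R) b d e" using e onto by (simp add: free_resolution_def)
  then show ?thesis by blast
qed

text \<open>Multiplication by \<open>x\<close> annihilates the residue field, so that a cocycle \<open>f\<close> can be evaluated
  at a preimage of \<open>x u\<close>, where \<open>u\<close> maps to the residue class of one. This identifies the first Ext
  module with the socle of \<open>M/xM\<close>.\<close>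

lemma ext_residue_field_length:
  fixes M :: "('a, 'm) module"
  assumes M: "module R M" and x: "x \<in> \<mm>"
    and reg: "\<And>y. \<lbrakk>y \<in> carrier M; x \<odot>\<^bsub>M\<^esub> y = \<zero>\<^bsub>M\<^esub>\<rbrakk> \<Longrightarrow> y = \<zero>\<^bsub>M\<^esub>"
  shows "module_length R (Ext R (residue_field R) M 1) =
    chain_length {N. submodule N R M \<and> multiples M x \<subseteq> N \<and> N \<subseteq> socle_mod \<mm> M x}"
proof -
  note [simp del] = One_nat_def
  interpret M: module R M by (rule M)
  have xR: "x \<in> carrier R" using x by (rule max_ideal_sub)
  have cancel: "y = z" if "y \<in> carrier M" "z \<in> carrier M" "x \<odot>\<^bsub>M\<^esub> y = x \<odot>\<^bsub>M\<^esub> z" for y z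
    using reg[of "y \<ominus>\<^bsub>M\<^esub> z"] that xR
    by (simp add: M.minus_smult_r M.minus_eq_zero_iff)
  let ?k = "residue_field R" and ?RR = "regular_module R"
  \<comment> \<open>The selected resolution stays abstract; in particular its rank in degree zero
    may differ from one.\<close>
  define s where "s = (SOME (b, d, e). free_resolution R ?k b d e)"
  have "case s of (b, d, e) \<Rightarrow> free_resolution R ?k b d e"
    unfolding s_def using residue_field_resolution by (intro someI_ex[of "\<lambda>(b, d, e). free_resolution R ?k b d e"]) auto
  then obtain b d e where s: "s = (b, d, e)" and res: "free_resolution R ?k b d e" by (cases s) auto
  let ?H = "(hom_module R (free_module R (b 1)) M)\<lparr>carrier := cocycles R b d M 1\<rparr>"
  let ?B = "coboundaries R b d M 1"
  have Ext: "Ext R ?k M 1 = quotient_module R ?H ?B"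
    unfolding Ext_def s_def[symmetric] s by simp
  have e: "is_module_hom R (free_module R (b 0)) ?k e"
    and e_onto: "e ` carrier (free_module R (b 0)) = carrier ?k"
    and d0: "d 0 ` carrier (free_module R (b 1)) = module_kernel (free_module R (b 0)) ?k e"
    using res by (auto simp: free_resolution_def)
  interpret free_complex R \<mm> b d
    by unfold_locales (use res in \<open>auto simp: free_resolution_def\<close>)
  let ?F0 = "F 0" and ?F1 = "F 1" and ?F2 = "F 2"
  interpret F0: module R ?F0 by (rule F_module)
  interpret F1: module R ?F1 by (rule F_module)
  interpret k: module R ?k by (rule residue_field_props)
  note De = is_module_homD[OF e] and Dd = is_module_homD[OF d_hom[of 0], folded One_nat_def]
  note e_minus = is_module_hom_zero_minus(2)[OF F_module residue_field_props(1) e]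
  note d_minus = is_module_hom_zero_minus(2)[OF F_module F_module d_hom[of 0], folded One_nat_def]
  have d1: "d 1 z \<in> carrier ?F1" "d 0 (d 1 z) = \<zero>\<^bsub>?F0\<^esub>" if "z \<in> carrier ?F2" for z
    using d_closed[of z 1] d_d[of z 0] that by (simp_all add: numeral_2_eq_2 One_nat_def)
  have exact1: "\<exists>z\<in>carrier ?F2. y = d 1 z" if "y \<in> carrier ?F1" "d 0 y = \<zero>\<^bsub>?F0\<^esub>" for y
    using exactE[of y 0] that by (auto simp: numeral_2_eq_2 One_nat_def)
  have ed: "e (d 0 y) = \<zero>\<^bsub>?k\<^esub>" if "y \<in> carrier ?F1" for y
    using d0 that by (auto simp: module_kernel_def)
  have exact0: "\<exists>y\<in>carrier ?F1. u = d 0 y" if "u \<in> carrier ?F0" "e u = \<zero>\<^bsub>?k\<^esub>" for u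
    using d0 that by (auto simp: module_kernel_def)
  have kill: "a \<odot>\<^bsub>?k\<^esub> t = \<zero>\<^bsub>?k\<^esub>" if a: "a \<in> \<mm>" and t: "t \<in> carrier ?k" for a t
  proof -
    obtain r where r: "r \<in> carrier R" "t = \<mm> +>\<^bsub>?RR\<^esub> r" using t residue_field_props(3) by auto
    have "a \<odot>\<^bsub>?k\<^esub> t = \<mm> +>\<^bsub>?RR\<^esub> (a \<otimes> r)"
      using is_module_homD(3)[OF residue_field_props(2) max_ideal_sub[OF a], of r] r
      by (simp add: regular_module_simps)
    moreover have "a \<otimes> r \<in> \<mm>"
      using idealD(5)[OF max_ideal_ideal r(1) a] r a max_ideal_sub by (simp add: m_comm)
    ultimately show ?thesis using residue_field_props(4)[of "a \<otimes> r"] r a max_ideal_sub by simp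
  qed
  have ker_mult: "\<exists>y\<in>carrier ?F1. a \<odot>\<^bsub>?F0\<^esub> u = d 0 y" if "a \<in> \<mm>" "u \<in> carrier ?F0" for a u
    using that De(1,3) kill max_ideal_sub by (intro exact0) auto
  define one where "one = \<mm> +>\<^bsub>?RR\<^esub> \<one>"
  have one: "one \<in> carrier ?k" using residue_field_props(3) by (auto simp: one_def)
  have one_gen: "\<exists>r\<in>carrier R. t = r \<odot>\<^bsub>?k\<^esub> one" if t: "t \<in> carrier ?k" for t
  proof -
    obtain r where "r \<in> carrier R" "t = \<mm> +>\<^bsub>?RR\<^esub> r" using t residue_field_props(3) by auto
    then show ?thesis
      using is_module_homD(3)[OF residue_field_props(2), of r \<one>]
      by (intro bexI[of _ r]) (simp_all add: regular_module_simps one_def)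
  qed
  obtain u0 where u0: "u0 \<in> carrier ?F0" "e u0 = one" using one e_onto by (metis imageE)
  obtain y0 where y0: "y0 \<in> carrier ?F1" "x \<odot>\<^bsub>?F0\<^esub> u0 = d 0 y0" using ker_mult[OF x u0(1)] by blast

  have H_mod: "module R (hom_module R ?F1 M)" by (rule hom_module_module[OF F_module M])
  interpret HM: module R "hom_module R ?F1 M" by (rule H_mod)
  have Z: "f \<in> cocycles R b d M 1 \<longleftrightarrow> f \<in> extensional (carrier ?F1) \<and> is_module_hom R ?F1 M f \<and>
      (\<forall>z\<in>carrier ?F2. f (d 1 z) = \<zero>\<^bsub>M\<^esub>)" for f
    by (auto simp: cocycles_def hom_module_simps numeral_2_eq_2 One_nat_def)
  have Z_sub: "submodule (cocycles R b d M 1) R (hom_module R ?F1 M)"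
  proof (rule HM.submoduleI')
    show "cocycles R b d M 1 \<subseteq> carrier (hom_module R ?F1 M)" by (auto simp: cocycles_def)
    show "\<zero>\<^bsub>hom_module R ?F1 M\<^esub> \<in> cocycles R b d M 1"
      using HM.zero_closed d1(1) by (auto simp: cocycles_def) (auto simp: hom_module_simps numeral_2_eq_2 One_nat_def)
    fix f g assume fg: "f \<in> cocycles R b d M 1" "g \<in> cocycles R b d M 1"
    then show "f \<oplus>\<^bsub>hom_module R ?F1 M\<^esub> g \<in> cocycles R b d M 1"
      using HM.a_closed[of f g] d1(1)
      by (auto simp: cocycles_def) (auto simp: hom_module_simps numeral_2_eq_2 One_nat_def)
  next
    fix a f assume "a \<in> carrier R" "f \<in> cocycles R b d M 1"
    then show "a \<odot>\<^bsub>hom_module R ?F1 M\<^esub> f \<in> cocycles R b d M 1"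
      using HM.smult_closed[of a f] d1(1)
      by (auto simp: cocycles_def) (auto simp: hom_module_simps numeral_2_eq_2 One_nat_def)
  qed
  have H: "module R ?H" by (rule submodule.submodule_is_module[OF Z_sub H_mod])
  interpret H: module R ?H by (rule H)
  note DK = M.submoduleD[OF submodule_multiples[OF M xR]]
  note W = submodule_socle_mod[OF M xR]
  have f_cl: "f y \<in> carrier M" if "f \<in> cocycles R b d M 1" "y \<in> carrier ?F1" for f y
    using that is_module_homD(1)[of R ?F1 M f y] by (simp add: Z)

  have same_image: "f y = f y'" if f: "f \<in> cocycles R b d M 1"
    and y: "y \<in> carrier ?F1" "y' \<in> carrier ?F1" "d 0 y = d 0 y'" for f y y'
  proof -
    have f_hom: "is_module_hom R ?F1 M f" using f by (simp add: Z)
    have "d 0 (y \<ominus>\<^bsub>?F1\<^esub> y') = \<zero>\<^bsub>?F0\<^esub>"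
      using y Dd(1) by (simp add: d_minus F0.minus_eq_zero_iff)
    then obtain z where "z \<in> carrier ?F2" "y \<ominus>\<^bsub>?F1\<^esub> y' = d 1 z"
      using exact1[OF F1.M.minus_closed[OF y(1,2)]] by blast
    then have "f (y \<ominus>\<^bsub>?F1\<^esub> y') = \<zero>\<^bsub>M\<^esub>" using f by (simp add: Z)
    then have "f y \<ominus>\<^bsub>M\<^esub> f y' = \<zero>\<^bsub>M\<^esub>"
      using is_module_hom_zero_minus(2)[OF F_module M f_hom y(1,2)] by simp
    then show ?thesis using f_cl[OF f] y by (simp add: M.minus_eq_zero_iff)
  qed

  have B_def: "?B = (\<lambda>g. compose (carrier ?F1) g (d 0)) ` carrier (hom_module R ?F0 M)"
    by (simp add: One_nat_def)
  have B_iff: "f \<in> ?B \<longleftrightarrow> f \<in> cocycles R b d M 1 \<and> f y0 \<in> multiples M x" for f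
  proof
    assume "f \<in> ?B"
    then obtain g where g: "is_module_hom R ?F0 M g" "f = compose (carrier ?F1) g (d 0)"
      by (auto simp: B_def hom_module_simps)
    have f_eq: "f y = g (d 0 y)" if "y \<in> carrier ?F1" for y using g(2) that by (simp add: compose_def)
    have "is_module_hom R ?F1 M f"
      using is_module_hom_compose[OF d_hom[of 0, folded One_nat_def] g(1)] is_module_hom_restrict[OF F_module[of 1], of M "\<lambda>y. g (d 0 y)"]
      by (simp add: g(2) compose_def)
    moreover have "f (d 1 z) = \<zero>\<^bsub>M\<^esub>" if "z \<in> carrier ?F2" for z
      using d1[OF that] is_module_hom_zero_minus(1)[OF F_module M g(1)] by (simp add: f_eq)
    ultimately have "f \<in> cocycles R b d M 1" using g(2) by (simp add: Z compose_extensional)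
    moreover have "f y0 = x \<odot>\<^bsub>M\<^esub> g u0"
      using is_module_homD(3)[OF g(1) xR u0(1)] y0 by (simp add: f_eq)
    then have "f y0 \<in> multiples M x" using is_module_homD(1)[OF g(1) u0(1)] by (auto simp: multiples_def)
    ultimately show "f \<in> cocycles R b d M 1 \<and> f y0 \<in> multiples M x" by blast
  next
    assume *: "f \<in> cocycles R b d M 1 \<and> f y0 \<in> multiples M x"
    then have f: "f \<in> cocycles R b d M 1" by blast
    have f_hom: "is_module_hom R ?F1 M f" using f by (simp add: Z)
    note Df = is_module_homD[OF f_hom]
    obtain m0 where m0: "m0 \<in> carrier M" "f y0 = x \<odot>\<^bsub>M\<^esub> m0" using * by (auto simp: multiples_def)
    \<comment> \<open>A cocycle f depends only on the image under \<open>d 0\<close>, and x u lies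
      in that image. \<open>P u m\<close> says that m is the quotient of the value of f at x u by x;
      this will be the map g with f = g d.\<close>
    define P where "P u m \<longleftrightarrow> m \<in> carrier M \<and> (\<exists>y\<in>carrier ?F1. d 0 y = x \<odot>\<^bsub>?F0\<^esub> u \<and> f y = x \<odot>\<^bsub>M\<^esub> m)" for u m
    have P_ex: "\<exists>m. P u m" if u: "u \<in> carrier ?F0" for u
    proof -
      obtain r where r: "r \<in> carrier R" "e u = r \<odot>\<^bsub>?k\<^esub> one" using one_gen De(1)[OF u] by blast
      have "e (u \<ominus>\<^bsub>?F0\<^esub> r \<odot>\<^bsub>?F0\<^esub> u0) = \<zero>\<^bsub>?k\<^esub>"
        using u u0 r one De(3) by (simp add: e_minus k.minus_eq_zero_iff)
      then obtain y' where y': "y' \<in> carrier ?F1" "u \<ominus>\<^bsub>?F0\<^esub> r \<odot>\<^bsub>?F0\<^esub> u0 = d 0 y'"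
        using exact0[OF F0.M.minus_closed[OF u F0.smult_closed[OF r(1) u0(1)]]] by blast
      \<comment> \<open>Split u as (u - r u0) + r u0. Multiplied by x, the first part is the
        boundary of x y', and the second is the boundary of r y0, where f is divisible by x by
        assumption.\<close>
      let ?y = "x \<odot>\<^bsub>?F1\<^esub> y' \<oplus>\<^bsub>?F1\<^esub> r \<odot>\<^bsub>?F1\<^esub> y0"
      have y: "?y \<in> carrier ?F1" using xR r(1) y' y0 by simp
      have "d 0 ?y = x \<odot>\<^bsub>?F0\<^esub> (u \<ominus>\<^bsub>?F0\<^esub> r \<odot>\<^bsub>?F0\<^esub> u0) \<oplus>\<^bsub>?F0\<^esub> r \<odot>\<^bsub>?F0\<^esub> (x \<odot>\<^bsub>?F0\<^esub> u0)"
        using xR r(1) y' y0 Dd by simp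
      also have "\<dots> = x \<odot>\<^bsub>?F0\<^esub> (u \<ominus>\<^bsub>?F0\<^esub> r \<odot>\<^bsub>?F0\<^esub> u0 \<oplus>\<^bsub>?F0\<^esub> r \<odot>\<^bsub>?F0\<^esub> u0)"
        using xR r(1) u u0(1) by (simp add: F0.smult_r_distr F0.smult_left_commute[of x])
      also have "\<dots> = x \<odot>\<^bsub>?F0\<^esub> u" using u u0(1) r(1) by (simp add: F0.minus_cancel)
      finally have "d 0 ?y = x \<odot>\<^bsub>?F0\<^esub> u" .
      moreover have "f ?y = x \<odot>\<^bsub>M\<^esub> (f y' \<oplus>\<^bsub>M\<^esub> r \<odot>\<^bsub>M\<^esub> m0)"
        using xR r(1) y' y0(1) m0 Df by (simp add: M.smult_r_distr M.smult_left_commute[of x])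
      moreover have "f y' \<oplus>\<^bsub>M\<^esub> r \<odot>\<^bsub>M\<^esub> m0 \<in> carrier M" using Df(1)[OF y'(1)] r(1) m0(1) by simp
      ultimately have "P u (f y' \<oplus>\<^bsub>M\<^esub> r \<odot>\<^bsub>M\<^esub> m0)" unfolding P_def using y by blast
      then show ?thesis by blast
    qed
    have P_unique: "m = m'" if P: "P u m" "P u m'" for u m m'
    proof -
      obtain y y' where "y \<in> carrier ?F1" "d 0 y = x \<odot>\<^bsub>?F0\<^esub> u" "f y = x \<odot>\<^bsub>M\<^esub> m"
        "y' \<in> carrier ?F1" "d 0 y' = x \<odot>\<^bsub>?F0\<^esub> u" "f y' = x \<odot>\<^bsub>M\<^esub> m'" using P unfolding P_def by blast
      then show ?thesis using same_image[OF f, of y y'] cancel P by (simp add: P_def)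
    qed
    define g where "g = (\<lambda>u\<in>carrier ?F0. SOME m. P u m)"
    have g: "P u (g u)" if "u \<in> carrier ?F0" for u
      using someI_ex[OF P_ex[OF that]] that by (simp add: g_def)
    have g_hom: "is_module_hom R ?F0 M g"
    proof (rule is_module_homI)
      show "g u \<in> carrier M" if "u \<in> carrier ?F0" for u using g[OF that] by (simp add: P_def)
    next
      fix u v assume uv: "u \<in> carrier ?F0" "v \<in> carrier ?F0"
      obtain y z where yz: "y \<in> carrier ?F1" "d 0 y = x \<odot>\<^bsub>?F0\<^esub> u" "f y = x \<odot>\<^bsub>M\<^esub> g u"
        "z \<in> carrier ?F1" "d 0 z = x \<odot>\<^bsub>?F0\<^esub> v" "f z = x \<odot>\<^bsub>M\<^esub> g v" "g u \<in> carrier M" "g v \<in> carrier M"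
        using g[OF uv(1)] g[OF uv(2)] unfolding P_def by blast
      have "d 0 (y \<oplus>\<^bsub>?F1\<^esub> z) = x \<odot>\<^bsub>?F0\<^esub> (u \<oplus>\<^bsub>?F0\<^esub> v)" "f (y \<oplus>\<^bsub>?F1\<^esub> z) = x \<odot>\<^bsub>M\<^esub> (g u \<oplus>\<^bsub>M\<^esub> g v)"
        using yz uv xR Dd(2) Df(2) by (simp_all add: F0.smult_r_distr M.smult_r_distr)
      then have "P (u \<oplus>\<^bsub>?F0\<^esub> v) (g u \<oplus>\<^bsub>M\<^esub> g v)"
        unfolding P_def using F1.a_closed[OF yz(1,4)] yz(7,8) by blast
      then show "g (u \<oplus>\<^bsub>?F0\<^esub> v) = g u \<oplus>\<^bsub>M\<^esub> g v" using P_unique g uv by blast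
    next
      fix a u assume a: "a \<in> carrier R" and u: "u \<in> carrier ?F0"
      obtain y where y: "y \<in> carrier ?F1" "d 0 y = x \<odot>\<^bsub>?F0\<^esub> u" "f y = x \<odot>\<^bsub>M\<^esub> g u" "g u \<in> carrier M"
        using g[OF u] unfolding P_def by blast
      have "d 0 (a \<odot>\<^bsub>?F1\<^esub> y) = x \<odot>\<^bsub>?F0\<^esub> (a \<odot>\<^bsub>?F0\<^esub> u)" "f (a \<odot>\<^bsub>?F1\<^esub> y) = x \<odot>\<^bsub>M\<^esub> (a \<odot>\<^bsub>M\<^esub> g u)"
        using y u a xR Dd(3) Df(3) by (simp_all add: F0.smult_left_commute[of x] M.smult_left_commute[of x])
      then have "P (a \<odot>\<^bsub>?F0\<^esub> u) (a \<odot>\<^bsub>M\<^esub> g u)"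
        unfolding P_def using F1.smult_closed[OF a y(1)] y(4) a by blast
      then show "g (a \<odot>\<^bsub>?F0\<^esub> u) = a \<odot>\<^bsub>M\<^esub> g u" using P_unique g u a F0.smult_closed by blast
    qed
    have "f y = g (d 0 y)" if y: "y \<in> carrier ?F1" for y
    proof -
      have "d 0 (x \<odot>\<^bsub>?F1\<^esub> y) = x \<odot>\<^bsub>?F0\<^esub> d 0 y" "f (x \<odot>\<^bsub>?F1\<^esub> y) = x \<odot>\<^bsub>M\<^esub> f y"
        using Dd(3) Df(3) xR y by auto
      then have "P (d 0 y) (f y)" unfolding P_def using F1.smult_closed[OF xR y] Df(1)[OF y] by blast
      then show ?thesis using P_unique g Dd(1)[OF y] by blast
    qed
    then have "f = compose (carrier ?F1) g (d 0)"
      using f by (intro extensionalityI[of _ "carrier ?F1"]) (auto simp: Z compose_def)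
    moreover have "g \<in> carrier (hom_module R ?F0 M)"
      using g_hom by (simp add: hom_module_simps) (simp add: g_def)
    ultimately show "f \<in> ?B" unfolding B_def by blast
  qed

  have onto: "\<exists>f\<in>cocycles R b d M 1. \<exists>k\<in>multiples M x. w = f y0 \<oplus>\<^bsub>M\<^esub> k"
    if w: "w \<in> socle_mod \<mm> M x" for w
  proof -
    have wM: "w \<in> carrier M" and mw: "\<And>a. a \<in> \<mm> \<Longrightarrow> a \<odot>\<^bsub>M\<^esub> w \<in> multiples M x"
      using w by (auto simp: socle_mod_def)
    have "e ` carrier (free_module R (b 0)) \<subseteq> (+>\<^bsub>?RR\<^esub>) \<mm> ` carrier ?RR"
      using e_onto residue_field_props(3) by (simp add: regular_module_simps)
    from free_module_lift[OF regular_module_module residue_field_props(1,2) e this]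
    obtain c where c: "is_module_hom R ?F0 ?RR c"
      "\<And>u. u \<in> carrier ?F0 \<Longrightarrow> \<mm> +>\<^bsub>?RR\<^esub> c u = e u" by blast
    note Dc = is_module_homD[OF c(1), unfolded regular_module_simps]
    \<comment> \<open>c lifts e to R, so on boundaries it takes values in \<mm>, and multiplying w
      by such a value gives a multiple of x. Dividing by x defines f; at y0 it yields (c u0) w,
      which agrees with w modulo xM because c u0 is congruent to 1 modulo \<mm>.\<close>
    define f where "f = (\<lambda>y\<in>carrier ?F1. SOME m. m \<in> carrier M \<and> x \<odot>\<^bsub>M\<^esub> m = c (d 0 y) \<odot>\<^bsub>M\<^esub> w)"
    have f: "f y \<in> carrier M \<and> x \<odot>\<^bsub>M\<^esub> f y = c (d 0 y) \<odot>\<^bsub>M\<^esub> w" if y: "y \<in> carrier ?F1" for y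
    proof -
      have "\<mm> +>\<^bsub>?RR\<^esub> c (d 0 y) = \<zero>\<^bsub>?k\<^esub>" using c(2) Dd(1)[OF y] ed[OF y] by simp
      then have "c (d 0 y) \<in> \<mm>" using residue_field_props(4) Dc(1) Dd(1)[OF y] by blast
      then have "\<exists>m. m \<in> carrier M \<and> x \<odot>\<^bsub>M\<^esub> m = c (d 0 y) \<odot>\<^bsub>M\<^esub> w"
        using mw by (force simp: multiples_def)
      from someI_ex[OF this] show ?thesis using y by (simp add: f_def)
    qed
    have f_eq: "f y = m" if "y \<in> carrier ?F1" "m \<in> carrier M" "x \<odot>\<^bsub>M\<^esub> m = c (d 0 y) \<odot>\<^bsub>M\<^esub> w" for y m
      using f[OF that(1)] that cancel by simp
    have c_zero: "c \<zero>\<^bsub>?F0\<^esub> = \<zero>"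
      using is_module_hom_zero_minus(1)[OF F_module regular_module_module c(1)] by (simp add: regular_module_simps)
    have "is_module_hom R ?F1 M f"
    proof (rule is_module_homI)
      show "f y \<in> carrier M" if "y \<in> carrier ?F1" for y using f[OF that] by blast
    next
      fix y z assume yz: "y \<in> carrier ?F1" "z \<in> carrier ?F1"
      have "x \<odot>\<^bsub>M\<^esub> (f y \<oplus>\<^bsub>M\<^esub> f z) = c (d 0 (y \<oplus>\<^bsub>?F1\<^esub> z)) \<odot>\<^bsub>M\<^esub> w"
        using f[OF yz(1)] f[OF yz(2)] yz xR wM Dd(1,2) Dc(1,2) by (simp add: M.smult_r_distr M.smult_l_distr)
      then show "f (y \<oplus>\<^bsub>?F1\<^esub> z) = f y \<oplus>\<^bsub>M\<^esub> f z" using f yz by (intro f_eq) auto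
    next
      fix a y assume a: "a \<in> carrier R" and y: "y \<in> carrier ?F1"
      have "x \<odot>\<^bsub>M\<^esub> (a \<odot>\<^bsub>M\<^esub> f y) = a \<odot>\<^bsub>M\<^esub> (x \<odot>\<^bsub>M\<^esub> f y)"
        using f[OF y] a xR by (simp add: M.smult_left_commute)
      also have "\<dots> = c (d 0 (a \<odot>\<^bsub>?F1\<^esub> y)) \<odot>\<^bsub>M\<^esub> w"
        using f[OF y] y a wM Dd(1,3) Dc(1,3) by (simp add: M.smult_assoc1)
      finally show "f (a \<odot>\<^bsub>?F1\<^esub> y) = a \<odot>\<^bsub>M\<^esub> f y" using f y a by (intro f_eq) auto
    qed
    moreover have "f (d 1 z) = \<zero>\<^bsub>M\<^esub>" if "z \<in> carrier ?F2" for z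
      using d1[OF that] c_zero wM xR by (intro f_eq) auto
    ultimately have f_Z: "f \<in> cocycles R b d M 1" by (simp add: Z f_def)
    have cu0: "c u0 \<in> carrier R" using Dc(1) u0(1) by blast
    have "f y0 = c u0 \<odot>\<^bsub>M\<^esub> w"
      using y0 u0 cu0 wM xR Dc(3) by (intro f_eq) (simp_all add: M.smult_assoc1 flip: y0(2))
    have "\<one> \<ominus> c u0 \<in> \<mm>"
    proof -
      have "submodule \<mm> R ?RR" using max_ideal_ideal by (simp add: submodule_regular_iff)
      from quotient_module_simps(5)[OF regular_module_module this, of \<one> "c u0"]
      show ?thesis using c(2)[OF u0(1)] u0(2) cu0
        by (simp add: one_def regular_module_simps regular_module_minus)
    qed
    then have "w \<ominus>\<^bsub>M\<^esub> f y0 \<in> multiples M x"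
      using mw[of "\<one> \<ominus> c u0"] \<open>f y0 = c u0 \<odot>\<^bsub>M\<^esub> w\<close> cu0 wM by (simp add: M.minus_smult_l)
    moreover have "w = f y0 \<oplus>\<^bsub>M\<^esub> (w \<ominus>\<^bsub>M\<^esub> f y0)"
      using M.minus_cancel[of w "f y0"] wM f_cl[OF f_Z y0(1)] by (simp add: M.a_comm)
    ultimately show ?thesis using f_Z by blast
  qed

  have in_socle: "f y0 \<in> socle_mod \<mm> M x" if f: "f \<in> cocycles R b d M 1" for f
  proof -
    have f_hom: "is_module_hom R ?F1 M f" using f by (simp add: Z)
    note Df = is_module_homD[OF f_hom]
    have "a \<odot>\<^bsub>M\<^esub> f y0 \<in> multiples M x" if a: "a \<in> \<mm>" for a
    proof -
      \<comment> \<open>The element a x u0 is the boundary of both a y0 and x y, so f takes the same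
        value on them.\<close>
      obtain y where y: "y \<in> carrier ?F1" "a \<odot>\<^bsub>?F0\<^esub> u0 = d 0 y" using ker_mult[OF a u0(1)] by blast
      have aR: "a \<in> carrier R" using a by (rule max_ideal_sub)
      have "d 0 (a \<odot>\<^bsub>?F1\<^esub> y0) = d 0 (x \<odot>\<^bsub>?F1\<^esub> y)"
        using aR xR y y0 Dd(3) u0(1) F0.smult_left_commute[of a x u0] by (simp flip: y0(2) y(2))
      then have "f (a \<odot>\<^bsub>?F1\<^esub> y0) = f (x \<odot>\<^bsub>?F1\<^esub> y)" using aR xR y y0 by (intro same_image[OF f]) auto
      then have "a \<odot>\<^bsub>M\<^esub> f y0 = x \<odot>\<^bsub>M\<^esub> f y" using Df(3) aR xR y y0 by simp
      then show ?thesis using Df(1)[OF y(1)] by (auto simp: multiples_def)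
    qed
    then show ?thesis using f_cl[OF f y0(1)] by (simp add: socle_mod_def)
  qed

  have B_eq: "{f \<in> carrier ?H. f y0 \<in> multiples M x} = ?B" using B_iff by auto
  have corr: "chain_length {N. submodule N R ?H \<and> {f \<in> carrier ?H. f y0 \<in> multiples M x} \<subseteq> N} =
      chain_length {N. submodule N R M \<and> multiples M x \<subseteq> N \<and> N \<subseteq> socle_mod \<mm> M x}"
  proof (rule chain_length_correspondence[OF H M, where \<rho> = id and p = "\<lambda>f. f y0"])
    show "submodule (multiples M x) R M" by (rule submodule_multiples[OF M xR])
    show "submodule (socle_mod \<mm> M x) R M" "multiples M x \<subseteq> socle_mod \<mm> M x" by (rule W)+
    show "f y0 \<in> socle_mod \<mm> M x" if "f \<in> carrier ?H" for f using in_socle that by simp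
    show "(f \<oplus>\<^bsub>?H\<^esub> g) y0 = f y0 \<oplus>\<^bsub>M\<^esub> g y0" for f g
      using y0(1) by (simp add: hom_module_simps)
    show "\<exists>k\<in>multiples M x. (a \<odot>\<^bsub>?H\<^esub> f) y0 = id a \<odot>\<^bsub>M\<^esub> f y0 \<oplus>\<^bsub>M\<^esub> k"
      if "a \<in> carrier R" "f \<in> carrier ?H" for a f
      using y0(1) DK(2) f_cl that by (intro bexI[of _ "\<zero>\<^bsub>M\<^esub>"]) (auto simp: hom_module_simps)
    show "\<exists>f\<in>carrier ?H. \<exists>k\<in>multiples M x. w = f y0 \<oplus>\<^bsub>M\<^esub> k" if "w \<in> socle_mod \<mm> M x" for w
      using onto[OF that] by simp
  qed simp
  have B_sub: "submodule ?B R ?H"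
  proof (rule H.submoduleI')
    show "?B \<subseteq> carrier ?H" using B_iff by auto
    show "\<zero>\<^bsub>?H\<^esub> \<in> ?B"
      using H.zero_closed DK(2) y0(1) by (simp add: B_iff del: coboundaries.simps) (simp add: hom_module_simps)
  next
    fix f g assume "f \<in> ?B" "g \<in> ?B"
    then have fg: "f \<in> carrier ?H" "g \<in> carrier ?H" "f y0 \<in> multiples M x" "g y0 \<in> multiples M x"
      using B_iff by auto
    then have "(f \<oplus>\<^bsub>?H\<^esub> g) y0 \<in> multiples M x" using y0(1) DK(3) by (simp add: hom_module_simps)
    then show "f \<oplus>\<^bsub>?H\<^esub> g \<in> ?B" using H.a_closed[OF fg(1,2)] unfolding B_iff by simp
  next
    fix a f assume a: "a \<in> carrier R" and "f \<in> ?B"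
    then have f: "f \<in> carrier ?H" "f y0 \<in> multiples M x" using B_iff by auto
    then have "(a \<odot>\<^bsub>?H\<^esub> f) y0 \<in> multiples M x" using y0(1) DK(5) a by (simp add: hom_module_simps)
    then show "a \<odot>\<^bsub>?H\<^esub> f \<in> ?B" using H.smult_closed[OF a f(1)] unfolding B_iff by simp
  qed
  show ?thesis
    unfolding Ext quotient_module_length[OF H B_sub] using corr B_eq by simp
qed

end

text \<open>A nonunit generates a proper ideal; a maximal proper ideal above it exists by the
  Noetherian property and is the unique maximal ideal.\<close>

lemma noetherian_local_max_ideal:
  assumes R: "noetherian_ring R" "local_ring R"
  shows "noetherian_local R (max_ideal R)"
proof -
  interpret cring R using R(2) by (simp add: local_ring_def)
  interpret noetherian_ring R by (rule R(1))
  have ex: "\<exists>!m. maximalideal m R" using R(2) by (simp add: local_ring_def)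
  have m: "maximalideal (max_ideal R) R" unfolding max_ideal_def by (rule theI'[OF ex])
  interpret m: maximalideal "max_ideal R" R by (rule m)
  show ?thesis
  proof (intro noetherian_local.intro local_cring.intro local_cring_axioms.intro is_cring R(1) m.is_ideal)
    show "\<one>\<^bsub>R\<^esub> \<notin> max_ideal R" using m.I_notcarr m.one_imp_carrier by blast
    fix a assume a: "a \<in> carrier R" "a \<notin> max_ideal R"
    show "a \<in> Units R"
    proof (rule ccontr)
      assume nu: "a \<notin> Units R"
      have I: "ideal (PIdl\<^bsub>R\<^esub> a) R" by (rule cgenideal_ideal[OF a(1)])
      have "\<one>\<^bsub>R\<^esub> \<notin> PIdl\<^bsub>R\<^esub> a"
        using nu a(1) unit_factor[of _ a] by (auto simp: cgenideal_def Units_def m_comm)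
      then have ne: "{J. ideal J R \<and> PIdl\<^bsub>R\<^esub> a \<subseteq> J \<and> J \<noteq> carrier R} \<noteq> {}" using I by auto
      have ideals: "ideal J R" if "J \<in> {J. ideal J R \<and> PIdl\<^bsub>R\<^esub> a \<subseteq> J \<and> J \<noteq> carrier R}" for J
        using that by blast
      obtain N where N: "N \<in> {J. ideal J R \<and> PIdl\<^bsub>R\<^esub> a \<subseteq> J \<and> J \<noteq> carrier R}"
        "\<And>J. \<lbrakk>J \<in> {J. ideal J R \<and> PIdl\<^bsub>R\<^esub> a \<subseteq> J \<and> J \<noteq> carrier R}; N \<subseteq> J\<rbrakk> \<Longrightarrow> J = N"
        by (rule exists_maximal_ideal_in[OF ne ideals]) (assumption, rule that)
      have "maximalideal N R"
      proof (rule maximalidealI)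
        show "J = N \<or> J = carrier R" if "ideal J R" "N \<subseteq> J" "J \<subseteq> carrier R" for J
          using N(2)[OF _ that(2)] N(1) that by blast
      qed (use N(1) in auto)
      then have "N = max_ideal R" using ex m by blast
      then show False using N(1) cgenideal_self[OF a(1)] a(2) by blast
    qed
  qed
qed

section \<open>The socle of the quotient by an ideal\<close>

lemma (in ring) coset_eq_iff:
  assumes I: "ideal I R" and z: "z \<in> carrier R"
  shows "I +> z = I \<longleftrightarrow> z \<in> I"
proof -
  have "I \<subseteq> carrier R" using additive_subgroup.a_subset ideal.axioms(1)[OF I] by blast
  then have "I +> \<zero> = I" by (rule a_coset_add_zero)
  then show ?thesis
    using quotient_eq_iff_same_a_r_cos[OF I z zero_closed] minus_zero_right[OF z] by simp
qed

lemma quotient_carrier: "carrier (R Quot I) = (+>\<^bsub>R\<^esub>) I ` carrier R"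
  by (auto simp: FactRing_def A_RCOSETS_def')

text \<open>The colon ideal I : \<mm>, that is, the preimage in R of the socle of R/I.\<close>

definition ideal_socle :: "('a, 'b) ring_scheme \<Rightarrow> 'a set \<Rightarrow> 'a set \<Rightarrow> 'a set" where
  "ideal_socle R \<mm> I = {z \<in> carrier R. \<forall>a\<in>\<mm>. a \<otimes>\<^bsub>R\<^esub> z \<in> I}"

context local_cring
begin

lemma ideal_socle_ideal:
  assumes I: "ideal I R"
  shows "ideal (ideal_socle R \<mm> I) R" "I \<subseteq> ideal_socle R \<mm> I"
proof -
  note D = idealD[OF I]
  show "ideal (ideal_socle R \<mm> I) R"
  proof (rule idealI')
    show "r \<otimes> z \<in> ideal_socle R \<mm> I" if "r \<in> carrier R" "z \<in> ideal_socle R \<mm> I" for r z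
      using that D(5) max_ideal_sub by (auto simp: ideal_socle_def m_lcomm[of _ r])
    show "y \<oplus> z \<in> ideal_socle R \<mm> I" if "y \<in> ideal_socle R \<mm> I" "z \<in> ideal_socle R \<mm> I" for y z
      using that D(3) max_ideal_sub by (simp add: ideal_socle_def r_distr)
    show "\<zero> \<in> ideal_socle R \<mm> I" using D(2) max_ideal_sub by (simp add: ideal_socle_def)
  qed (auto simp: ideal_socle_def)
  show "I \<subseteq> ideal_socle R \<mm> I" using D(1,5) max_ideal_sub by (auto simp: ideal_socle_def)
qed

lemma quotient_local:
  assumes I: "ideal I R" "I \<subseteq> \<mm>"
  shows "local_cring (R Quot I) ((+>) I ` \<mm>)"
proof -
  interpret I: ideal I R by (rule I(1))
  interpret Q: cring "R Quot I" by (rule I.quotient_is_cring[OF is_cring])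
  interpret h: ring_hom_cring R "R Quot I" "(+>) I" by (rule I.rcos_ring_hom_cring[OF is_cring])
  note D = idealD[OF max_ideal_ideal]
  note onto = quotient_carrier[of R I]
  show ?thesis
  proof (intro local_cring.intro local_cring_axioms.intro Q.is_cring)
    show "ideal ((+>) I ` \<mm>) (R Quot I)"
    proof (rule Q.idealI')
      show "(+>) I ` \<mm> \<subseteq> carrier (R Quot I)" using D(1) onto by blast
      show "\<zero>\<^bsub>R Quot I\<^esub> \<in> (+>) I ` \<mm>" using D(2) h.hom_zero by (metis imageI)
    next
      fix A B assume "A \<in> (+>) I ` \<mm>" "B \<in> (+>) I ` \<mm>"
      then obtain a b where ab: "a \<in> \<mm>" "A = I +> a" "b \<in> \<mm>" "B = I +> b" by blast
      then have "A \<oplus>\<^bsub>R Quot I\<^esub> B = I +> (a \<oplus> b)" using D(1) by (simp add: subset_iff)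
      then show "A \<oplus>\<^bsub>R Quot I\<^esub> B \<in> (+>) I ` \<mm>" using D(3) ab by blast
    next
      fix C A assume C: "C \<in> carrier (R Quot I)" and "A \<in> (+>) I ` \<mm>"
      then obtain c a where ca: "c \<in> carrier R" "C = I +> c" "a \<in> \<mm>" "A = I +> a" using onto by blast
      then have "C \<otimes>\<^bsub>R Quot I\<^esub> A = I +> (c \<otimes> a)" using D(1) by (simp add: subset_iff)
      then show "C \<otimes>\<^bsub>R Quot I\<^esub> A \<in> (+>) I ` \<mm>" using D(5) ca by blast
    qed
    show "\<one>\<^bsub>R Quot I\<^esub> \<notin> (+>) I ` \<mm>"
    proof
      assume "\<one>\<^bsub>R Quot I\<^esub> \<in> (+>) I ` \<mm>"
      then obtain a where a: "a \<in> \<mm>" "I +> \<one> = I +> a" using h.hom_one by auto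
      have aR: "a \<in> carrier R" using a(1) by (rule max_ideal_sub)
      have "\<one> \<ominus> a \<in> I" using quotient_eq_iff_same_a_r_cos[OF I(1) one_closed aR] a(2) by simp
      then have "\<one> \<ominus> a \<oplus> a \<in> \<mm>" using I(2) D(3) a(1) by blast
      then show False using one_notin aR by (simp add: minus_cancel)
    qed
    fix A assume A: "A \<in> carrier (R Quot I)" "A \<notin> (+>) I ` \<mm>"
    then obtain a where a: "a \<in> carrier R" "A = I +> a" using onto by blast
    then have U: "a \<in> Units R" using A(2) units by blast
    have "A \<otimes>\<^bsub>R Quot I\<^esub> (I +> inv a) = \<one>\<^bsub>R Quot I\<^esub>"
      using U a by (simp flip: h.hom_mult h.hom_one)
    moreover have "I +> inv a \<in> carrier (R Quot I)" using U by simp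
    ultimately show "A \<in> Units (R Quot I)"
      using A(1) Q.m_comm[of A "I +> inv a"] unfolding Units_def by auto
  qed
qed

lemma socle_ideal: "ideal (socle R) R"
  unfolding socle_def max_ideal_eq
proof (rule idealI')
  show "\<zero> \<in> {y \<in> carrier R. \<forall>a\<in>\<mm>. a \<otimes> y = \<zero>}" using max_ideal_sub by simp
  fix y z assume "y \<in> {y \<in> carrier R. \<forall>a\<in>\<mm>. a \<otimes> y = \<zero>}" "z \<in> {y \<in> carrier R. \<forall>a\<in>\<mm>. a \<otimes> y = \<zero>}"
  then show "y \<oplus> z \<in> {y \<in> carrier R. \<forall>a\<in>\<mm>. a \<otimes> y = \<zero>}" using max_ideal_sub by (simp add: r_distr)
next
  fix r z assume "r \<in> carrier R" "z \<in> {y \<in> carrier R. \<forall>a\<in>\<mm>. a \<otimes> y = \<zero>}"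
  then show "r \<otimes> z \<in> {y \<in> carrier R. \<forall>a\<in>\<mm>. a \<otimes> y = \<zero>}" using max_ideal_sub by (simp add: m_lcomm[of _ r])
qed auto

text \<open>Scalars of R act on the socle through the surjection onto R/I, so its length can be
  computed over R, as an interval above I.\<close>

lemma artinian_ring_type_quotient:
  assumes I: "ideal I R" "I \<subseteq> \<mm>"
  shows "artinian_ring_type (R Quot I) =
    chain_length {N. submodule N R (ideal_module R (ideal_socle R \<mm> I)) \<and> I \<subseteq> N}"
proof -
  note QL = quotient_local[OF I]
  have Qc: "cring (R Quot I)" by (rule local_cring.axioms(1)[OF QL])
  have hom: "(+>) I \<in> ring_hom R (R Quot I)" by (rule ideal.rcos_ring_hom[OF I(1)])
  note onto = quotient_carrier[of R I] and h_closed = ring_hom_closed[OF hom]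
    and h_mult = ring_hom_mult[OF hom] and h_add = ring_hom_add[OF hom]
  have zero: "\<zero>\<^bsub>R Quot I\<^esub> = I" by (simp add: FactRing_def)
  let ?L = "ideal_socle R \<mm> I" and ?S = "socle (R Quot I)"
  have L: "ideal ?L R" by (rule ideal_socle_ideal[OF I(1)])
  have S_iff: "I +> z \<in> ?S \<longleftrightarrow> z \<in> ?L" if z: "z \<in> carrier R" for z
  proof -
    have "(I +> a) \<otimes>\<^bsub>R Quot I\<^esub> (I +> z) = I \<longleftrightarrow> a \<otimes> z \<in> I" if a: "a \<in> \<mm>" for a
    proof -
      have aR: "a \<in> carrier R" using a by (rule max_ideal_sub)
      show ?thesis
        unfolding h_mult[OF aR z, symmetric] by (rule coset_eq_iff[OF I(1) m_closed[OF aR z]])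
    qed
    then show ?thesis
      using z h_closed[OF z]
      unfolding socle_def ideal_socle_def local_cring.max_ideal_eq[OF QL] zero by blast
  qed
  have S: "ideal ?S (R Quot I)" by (rule local_cring.socle_ideal[OF QL])
  note L_mod = ideal_module_module[OF L] and S_mod = cring.ideal_module_module[OF Qc S]
  have LR: "z \<in> carrier R" if "z \<in> ?L" for z using that by (simp add: ideal_socle_def)
  have "chain_length {N. submodule N R (ideal_module R ?L) \<and>
        {z \<in> carrier (ideal_module R ?L). I +> z \<in> {\<zero>\<^bsub>R Quot I\<^esub>}} \<subseteq> N} =
      chain_length {N. submodule N (R Quot I) (ideal_module (R Quot I) ?S) \<and>
        {\<zero>\<^bsub>R Quot I\<^esub>} \<subseteq> N \<and> N \<subseteq> ?S}"
  proof (rule chain_length_correspondence[OF L_mod S_mod, where \<rho> = "(+>) I"], unfold ideal_module_simps)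
    show "submodule {\<zero>\<^bsub>R Quot I\<^esub>} (R Quot I) (ideal_module (R Quot I) ?S)"
      using submodule_zero[OF S_mod] by (simp add: ideal_module_simps)
    show "submodule ?S (R Quot I) (ideal_module (R Quot I) ?S)"
      using cring.submodule_ideal_module_iff[OF Qc S] S by simp
    show "{\<zero>\<^bsub>R Quot I\<^esub>} \<subseteq> ?S" using cring.idealD(2)[OF Qc S] by simp
    show "I +> z \<in> ?S" if "z \<in> ?L" for z using that S_iff LR by simp
    have add_zero: "A \<oplus>\<^bsub>R Quot I\<^esub> \<zero>\<^bsub>R Quot I\<^esub> = A" if "A \<in> carrier (R Quot I)" for A
      using abelian_monoid.r_zero[OF abelian_group.axioms(1)[OF ring.is_abelian_group[OF cring.axioms(1)[OF Qc]]] that] .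
    show "\<exists>k\<in>{\<zero>\<^bsub>R Quot I\<^esub>}. I +> a \<otimes> z = (I +> a) \<otimes>\<^bsub>R Quot I\<^esub> (I +> z) \<oplus>\<^bsub>R Quot I\<^esub> k"
      if "a \<in> carrier R" "z \<in> ?L" for a z
      using add_zero[OF h_closed[OF m_closed[OF that(1) LR[OF that(2)]]]] h_mult[OF that(1) LR[OF that(2)]]
      by simp
    show "\<exists>z\<in>?L. \<exists>k\<in>{\<zero>\<^bsub>R Quot I\<^esub>}. w = (I +> z) \<oplus>\<^bsub>R Quot I\<^esub> k" if w: "w \<in> ?S" for w
    proof -
      obtain z where z: "z \<in> carrier R" "w = I +> z" using cring.idealD(1)[OF Qc S] w unfolding onto by blast
      then show ?thesis using w S_iff[OF z(1)] add_zero[OF h_closed[OF z(1)]] by auto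
    qed
    show "I +> (y \<oplus> z) = (I +> y) \<oplus>\<^bsub>R Quot I\<^esub> (I +> z)" if "y \<in> ?L" "z \<in> ?L" for y z
      by (rule h_add[OF LR[OF that(1)] LR[OF that(2)]])
  qed (rule onto[symmetric])
  moreover have "{z \<in> carrier (ideal_module R ?L). I +> z \<in> {\<zero>\<^bsub>R Quot I\<^esub>}} = I"
    using coset_eq_iff[OF I(1)] LR ideal_socle_ideal(2)[OF I(1)] unfolding ideal_module_simps zero by blast
  moreover have "{N. submodule N (R Quot I) (ideal_module (R Quot I) ?S) \<and>
      {\<zero>\<^bsub>R Quot I\<^esub>} \<subseteq> N \<and> N \<subseteq> ?S} = {N. submodule N (R Quot I) (ideal_module (R Quot I) ?S)}"
    using cring.submodule_ideal_module_iff[OF Qc S] cring.idealD(2)[OF Qc] by blast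
  ultimately show ?thesis by (simp add: artinian_ring_type_def module_length_chain)
qed

end

section \<open>Trace ideals\<close>

lemma (in cring) finsum_in_ideal:
  assumes J: "ideal J R" and "\<And>i. i < n \<Longrightarrow> g i \<in> J"
  shows "(\<Oplus>i\<in>{..<n::nat}. g i) \<in> J"
  using assms(2)
proof (induction n)
  case 0
  then show ?case using idealD(2)[OF J] by simp
next
  case (Suc n)
  have "g i \<in> carrier R" if "i < Suc n" for i using Suc.prems[OF that] idealD(1)[OF J] by blast
  then have "(\<Oplus>i\<in>{..<Suc n}. g i) = g n \<oplus> (\<Oplus>i\<in>{..<n}. g i)"
    unfolding lessThan_Suc by (intro finsum_insert) auto
  then show ?case using Suc idealD(3)[OF J] by simp
qed

lemma (in cring) trace_value:
  assumes "is_module_hom R M (regular_module R) f" "y \<in> carrier M"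
  shows "f y \<in> trace R M"
proof -
  have fy: "f y \<in> carrier R" using is_module_homD(1)[OF assms] by (simp add: regular_module_simps)
  have "f y = (\<Oplus>i\<in>{..<1::nat}. f y)" using fy by (simp add: lessThan_Suc)
  then show ?thesis
    unfolding trace_def using assms
    by (intro CollectI exI[of _ "1::nat"] exI[of _ "\<lambda>_. f"] exI[of _ "\<lambda>_. y"]) auto
qed

lemma (in cring) trace_ideal_stable:
  fixes M :: "('a, 'm) module"
  assumes I: "ideal I R" and tr: "I = trace R M"
    and x: "regular_element R x" and s: "s \<in> carrier R" "\<And>i. i \<in> I \<Longrightarrow> s \<otimes> i \<in> PIdl x"
    and i: "i \<in> I"
  shows "\<exists>k\<in>I. s \<otimes> i = x \<otimes> k"
proof -
  note D = idealD[OF I]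
  have xR: "x \<in> carrier R" using x by (simp add: regular_element_def)
  define J where "J = {i \<in> carrier R. \<exists>k\<in>I. s \<otimes> i = x \<otimes> k}"
  have IR: "k \<in> carrier R" if "k \<in> I" for k using that D(1) by blast
  have J: "ideal J R"
  proof (rule idealI')
    have "s \<otimes> \<zero> = x \<otimes> \<zero>" using s(1) xR by simp
    then show "\<zero> \<in> J" using D(2) by (auto simp: J_def)
  next
    fix a b assume "a \<in> J" "b \<in> J"
    then obtain k l where *: "a \<in> carrier R" "b \<in> carrier R" "k \<in> I" "s \<otimes> a = x \<otimes> k" "l \<in> I" "s \<otimes> b = x \<otimes> l"
      by (auto simp: J_def)
    then have "s \<otimes> (a \<oplus> b) = x \<otimes> (k \<oplus> l)" using s(1) xR IR by (simp add: r_distr)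
    then show "a \<oplus> b \<in> J" using * D(3) by (auto simp: J_def)
  next
    fix r a assume r: "r \<in> carrier R" and "a \<in> J"
    then obtain k where *: "a \<in> carrier R" "k \<in> I" "s \<otimes> a = x \<otimes> k" by (auto simp: J_def)
    have "s \<otimes> (r \<otimes> a) = r \<otimes> (s \<otimes> a)" using * r s(1) by (simp add: m_lcomm)
    also have "\<dots> = x \<otimes> (r \<otimes> k)" using * r xR IR by (simp add: m_lcomm)
    finally show "r \<otimes> a \<in> J" using * r D(5) by (auto simp: J_def)
  qed (auto simp: J_def)
  have f_in_J: "f y \<in> J" if f: "is_module_hom R M (regular_module R) f" and y: "y \<in> carrier M" for f y
  proof -
    note Df = is_module_homD[OF f, unfolded regular_module_simps]
    define g where "g y = (THE b. b \<in> carrier R \<and> s \<otimes> f y = x \<otimes> b)" for y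
    have g: "g y \<in> carrier R \<and> s \<otimes> f y = x \<otimes> g y" if y: "y \<in> carrier M" for y
    proof -
      have "f y \<in> I" using trace_value[OF f y] tr by simp
      then obtain b where "b \<in> carrier R" "s \<otimes> f y = x \<otimes> b"
        using s(2)[of "f y"] xR by (auto simp: cgenideal_def m_comm)
      then have "\<exists>!b. b \<in> carrier R \<and> s \<otimes> f y = x \<otimes> b" using regular_cancel[OF x] by metis
      then show ?thesis unfolding g_def by (rule theI')
    qed
    have "is_module_hom R M (regular_module R) g"
    proof (rule is_module_homI, unfold regular_module_simps)
      show "g y \<in> carrier R" if "y \<in> carrier M" for y using g[OF that] by blast
    next
      fix y z assume yz: "y \<in> carrier M" "z \<in> carrier M"
      show "g (y \<oplus>\<^bsub>M\<^esub> z) = g y \<oplus> g z"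
        unfolding g_def[of "y \<oplus>\<^bsub>M\<^esub> z"]
      proof (rule the_equality)
        show *: "g y \<oplus> g z \<in> carrier R \<and> s \<otimes> f (y \<oplus>\<^bsub>M\<^esub> z) = x \<otimes> (g y \<oplus> g z)"
          using g[OF yz(1)] g[OF yz(2)] Df(1,2) yz s(1) xR by (simp add: r_distr)
        show "b = g y \<oplus> g z" if "b \<in> carrier R \<and> s \<otimes> f (y \<oplus>\<^bsub>M\<^esub> z) = x \<otimes> b" for b
          using that * regular_cancel[OF x] by metis
      qed
    next
      fix a y assume a: "a \<in> carrier R" and y: "y \<in> carrier M"
      show "g (a \<odot>\<^bsub>M\<^esub> y) = a \<otimes> g y"
        unfolding g_def[of "a \<odot>\<^bsub>M\<^esub> y"]
      proof (rule the_equality)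
        have "s \<otimes> f (a \<odot>\<^bsub>M\<^esub> y) = a \<otimes> (s \<otimes> f y)" using Df(1,3) a y s(1) by (simp add: m_lcomm)
        also have "\<dots> = x \<otimes> (a \<otimes> g y)" using g[OF y] a xR by (simp add: m_lcomm)
        finally show *: "a \<otimes> g y \<in> carrier R \<and> s \<otimes> f (a \<odot>\<^bsub>M\<^esub> y) = x \<otimes> (a \<otimes> g y)"
          using g[OF y] a by simp
        show "b = a \<otimes> g y" if "b \<in> carrier R \<and> s \<otimes> f (a \<odot>\<^bsub>M\<^esub> y) = x \<otimes> b" for b
          using that * regular_cancel[OF x] by metis
      qed
    qed
    from trace_value[OF this y] have "g y \<in> I" using tr by simp
    then show ?thesis using g[OF y] Df(1)[OF y] unfolding J_def by blast
  qed
  obtain n :: nat and f y where fy: "i = (\<Oplus>j\<in>{..<n}. f j (y j))"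
    "\<And>j. j < n \<Longrightarrow> is_module_hom R M (regular_module R) (f j) \<and> y j \<in> carrier M"
    using i unfolding tr trace_def by blast
  have "i \<in> J" unfolding fy(1) by (rule finsum_in_ideal[OF J]) (use fy(2) f_in_J in blast)
  then show ?thesis by (simp add: J_def)
qed

section \<open>The type of a trace ideal\<close>

text \<open>Of the trace condition only \<open>stable\<close> is retained, with the denominator x
  cleared; the module whose trace is I no longer occurs.\<close>

locale trace_ideal_setting = gorenstein_one +
  fixes I :: "'a set" and x :: 'a
  assumes I: "ideal I R" "I \<subseteq> \<mm>" and x: "x \<in> I" "regular_element R x"
    and stable: "\<And>s i. \<lbrakk>s \<in> carrier R; \<And>i. i \<in> I \<Longrightarrow> s \<otimes> i \<in> PIdl x; i \<in> I\<rbrakk> \<Longrightarrow> \<exists>k\<in>I. s \<otimes> i = x \<otimes> k"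
begin

lemma x_props: "x \<in> \<mm>" "x \<in> carrier R"
  using x(1) I(2) max_ideal_sub by auto

lemma I_sub: "i \<in> I \<Longrightarrow> i \<in> carrier R" using idealD(1)[OF I(1)] by blast

definition xI :: "'a set" where "xI = (\<otimes>) x ` I"

definition T :: "'a set" where "T = ideal_socle R \<mm> xI"

definition sx :: "'a set" where "sx = ideal_socle R \<mm> (PIdl x)"

lemma mult_hom: "is_module_hom R (regular_module R) (regular_module R) ((\<otimes>) x)"
  by (rule is_module_homI) (auto simp: regular_module_simps x_props r_distr m_lcomm)

lemma mult_ideal: "ideal J R \<Longrightarrow> ideal ((\<otimes>) x ` J) R"
  using submodule_image[OF regular_module_module regular_module_module mult_hom]
  by (simp add: submodule_regular_iff)

lemma xI_ideal: "ideal xI R" unfolding xI_def by (rule mult_ideal[OF I(1)])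

lemma T_ideal: "ideal T R" and xI_T: "xI \<subseteq> T"
  unfolding T_def using ideal_socle_ideal[OF xI_ideal] by auto

lemma sx_ideal: "ideal sx R" and x_sx: "PIdl x \<subseteq> sx"
  unfolding sx_def using ideal_socle_ideal[OF cgenideal_ideal[OF x_props(2)]] by auto

lemma PIdl_x: "PIdl x = (\<otimes>) x ` carrier R"
  using x_props(2) by (auto simp: cgenideal_def m_comm image_iff)

lemma xI_sub: "xI \<subseteq> PIdl x" unfolding PIdl_x xI_def using I_sub by blast

lemma T_sub_sx: "T \<subseteq> sx" unfolding T_def sx_def ideal_socle_def using xI_sub by blast

lemma mult_mem_xI: "z \<in> carrier R \<Longrightarrow> x \<otimes> z \<in> xI \<longleftrightarrow> z \<in> I"
  unfolding xI_def using regular_cancel[OF x(2)] I_sub by blast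

lemma mult_mem_T:
  assumes z: "z \<in> carrier R"
  shows "x \<otimes> z \<in> T \<longleftrightarrow> z \<in> ideal_socle R \<mm> I"
proof -
  have "a \<otimes> (x \<otimes> z) \<in> xI \<longleftrightarrow> a \<otimes> z \<in> I" if a: "a \<in> \<mm>" for a
    using mult_mem_xI[of "a \<otimes> z"] max_ideal_sub[OF a] z x_props by (simp add: m_lcomm)
  then show ?thesis using z x_props by (auto simp: T_def ideal_socle_def)
qed

lemma T_inter: "T \<inter> PIdl x = (\<otimes>) x ` ideal_socle R \<mm> I"
  using mult_mem_T by (auto simp: PIdl_x ideal_socle_def)

text \<open>Take a = x, which lies in \<mm>, and cancel x.\<close>

lemma T_sub_I: "T \<subseteq> I"
proof
  fix y assume y: "y \<in> T"
  then have "x \<otimes> y \<in> xI" "y \<in> carrier R" using x_props by (auto simp: T_def ideal_socle_def)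
  then show "y \<in> I" using mult_mem_xI by blast
qed

text \<open>In the total ring of fractions \<open>B/x\<close> below is the ring \<open>I : I = R : I\<close>. Since it is finite over
  \<open>R\<close>, the element \<open>x\<close> does not lie in \<open>\<mm>B\<close>, and duality modulo \<open>x\<^sup>2\<close> turns this into an element
  of \<open>T\<close> outside \<open>(x)\<close>.\<close>

lemma T_not_sub: "\<exists>y\<in>T. y \<notin> PIdl x"
proof -
  define B where "B = {b \<in> carrier R. \<forall>i\<in>I. b \<otimes> i \<in> PIdl x}"
  note Px = idealD[OF cgenideal_ideal[OF x_props(2)]]
  have B_ideal: "ideal B R"
  proof (rule idealI')
    show "r \<otimes> b \<in> B" if "r \<in> carrier R" "b \<in> B" for r b
      using that Px(5) I_sub by (auto simp: B_def m_assoc)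
  qed (use Px I_sub in \<open>auto simp: B_def l_distr\<close>)
  note DB = idealD[OF B_ideal]
  have BR: "b \<in> carrier R" if "b \<in> B" for b using that DB(1) by blast
  have xB: "x \<in> B" using x_props I_sub by (auto simp: B_def PIdl_x)
  have B_I: "b \<in> I" if b: "b \<in> B" for b
  proof -
    obtain k where k: "k \<in> I" "b \<otimes> x = x \<otimes> k" using stable[of b x] b x(1) by (auto simp: B_def)
    then have "x \<otimes> b = x \<otimes> k" using BR[OF b] x_props by (simp add: m_comm)
    then show ?thesis using regular_cancel[OF x(2)] BR[OF b] I_sub k(1) by blast
  qed
  \<comment> \<open>This says that B/x is closed under multiplication.\<close>
  have BB: "\<exists>c\<in>B. b \<otimes> b' = x \<otimes> c" if b: "b \<in> B" "b' \<in> B" for b b'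
  proof -
    have bI: "b \<otimes> i \<in> PIdl x" if "i \<in> I" for i using b(1) that by (simp add: B_def)
    obtain c where c: "c \<in> I" "b \<otimes> b' = x \<otimes> c" using stable[OF BR[OF b(1)] bI B_I[OF b(2)]] by blast
    have "c \<otimes> i \<in> PIdl x" if i: "i \<in> I" for i
    proof -
      have b'I: "b' \<otimes> i \<in> PIdl x" if "i \<in> I" for i using b(2) that by (simp add: B_def)
      obtain k where k: "k \<in> I" "b' \<otimes> i = x \<otimes> k" using stable[OF BR[OF b(2)] b'I i] by blast
      have cl: "b \<in> carrier R" "b' \<in> carrier R" "c \<in> carrier R" "i \<in> carrier R" "k \<in> carrier R"
        using BR b c i k I_sub by auto
      have "x \<otimes> (c \<otimes> i) = b \<otimes> b' \<otimes> i" using c cl x_props by (simp add: m_assoc)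
      also have "\<dots> = x \<otimes> (b \<otimes> k)" using cl k x_props by (simp add: m_assoc m_lcomm)
      finally have "c \<otimes> i = b \<otimes> k" using regular_cancel[OF x(2)] cl by simp
      then show ?thesis using bI[OF k(1)] by simp
    qed
    then show ?thesis using c I_sub by (auto simp: B_def)
  qed
  \<comment> \<open>The ideal generated by G is \<mm>B.\<close>
  define G where "G = {a \<otimes> b | a b. a \<in> \<mm> \<and> b \<in> B}"
  have GR: "G \<subseteq> carrier R" using max_ideal_sub BR by (auto simp: G_def)
  define J where "J = Idl G"
  have J: "ideal J R" unfolding J_def by (rule genideal_ideal[OF GR])
  have mB: "a \<otimes> b \<in> J" if "a \<in> \<mm>" "b \<in> B" for a b
    unfolding J_def using genideal_self[OF GR] that by (auto simp: G_def)
  have JR: "j \<in> carrier R" if "j \<in> J" for j using that idealD(1)[OF J] by blast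
  have "x \<notin> J"
  proof
    assume xJ: "x \<in> J"
    \<comment> \<open>D consists of the z with z B \<subseteq> x J. Since B/x is a ring, D contains
      \<mm>B = J; so x \<in> J would give x B \<subseteq> x J, hence B \<subseteq> \<mm>B and B = 0
      by Nakayama's lemma, although x \<in> B.\<close>
    define D where "D = {z \<in> carrier R. \<forall>b\<in>B. \<exists>j\<in>J. z \<otimes> b = x \<otimes> j}"
    have D: "ideal D R"
    proof (rule idealI')
      have "\<zero> \<otimes> b = x \<otimes> \<zero>" if "b \<in> B" for b using BR[OF that] x_props by simp
      then show "\<zero> \<in> D" using idealD(2)[OF J] by (auto simp: D_def)
    next
      fix y z assume yz: "y \<in> D" "z \<in> D"
      have "\<exists>j\<in>J. (y \<oplus> z) \<otimes> b = x \<otimes> j" if b: "b \<in> B" for b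
      proof -
        obtain j k where "j \<in> J" "y \<otimes> b = x \<otimes> j" "k \<in> J" "z \<otimes> b = x \<otimes> k"
          using yz b unfolding D_def by blast
        then show ?thesis
          using yz BR[OF b] JR x_props idealD(3)[OF J]
          by (intro bexI[of _ "j \<oplus> k"]) (auto simp: D_def l_distr r_distr)
      qed
      then show "y \<oplus> z \<in> D" using yz by (simp add: D_def)
    next
      fix r z assume r: "r \<in> carrier R" and z: "z \<in> D"
      have "\<exists>j\<in>J. (r \<otimes> z) \<otimes> b = x \<otimes> j" if b: "b \<in> B" for b
      proof -
        obtain j where j: "j \<in> J" "z \<otimes> b = x \<otimes> j" using z b unfolding D_def by blast
        have "(r \<otimes> z) \<otimes> b = r \<otimes> (x \<otimes> j)" using j z r BR[OF b] by (simp add: D_def m_assoc)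
        also have "\<dots> = x \<otimes> (r \<otimes> j)" using r JR[OF j(1)] x_props by (simp add: m_lcomm)
        finally show ?thesis using idealD(5)[OF J r j(1)] by blast
      qed
      then show "r \<otimes> z \<in> D" using r z by (simp add: D_def)
    qed (auto simp: D_def)
    have "G \<subseteq> D"
    proof
      fix z assume "z \<in> G"
      then obtain a b where ab: "a \<in> \<mm>" "b \<in> B" "z = a \<otimes> b" by (auto simp: G_def)
      have "\<exists>j\<in>J. z \<otimes> b' = x \<otimes> j" if b': "b' \<in> B" for b'
      proof -
        obtain c where c: "c \<in> B" "b \<otimes> b' = x \<otimes> c" using BB[OF ab(2) b'] by blast
        have "z \<otimes> b' = a \<otimes> (x \<otimes> c)"
          using ab c max_ideal_sub BR b' by (simp add: m_assoc)
        also have "\<dots> = x \<otimes> (a \<otimes> c)" using ab c max_ideal_sub BR x_props by (simp add: m_lcomm)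
        finally show ?thesis using mB[OF ab(1) c(1)] by blast
      qed
      then show "z \<in> D" using ab max_ideal_sub BR by (simp add: D_def)
    qed
    then have "J \<subseteq> D" unfolding J_def by (rule genideal_minimal[OF D])
    then have "x \<in> D" using xJ by blast
    have "B \<subseteq> J"
    proof
      fix b assume b: "b \<in> B"
      then obtain j where "j \<in> J" "x \<otimes> b = x \<otimes> j" using \<open>x \<in> D\<close> by (auto simp: D_def)
      then show "b \<in> J" using regular_cancel[OF x(2)] BR[OF b] JR by metis
    qed
    have "B \<subseteq> {\<zero>}"
    proof (rule nakayama[OF regular_module_module fin_gen_ideal[OF is_cring noetherian_ring_axioms B_ideal]])
      show "submodule B R (regular_module R)" "submodule {\<zero>} R (regular_module R)"
        using B_ideal zeroideal by (simp_all add: submodule_regular_iff)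
      fix L assume L: "submodule L R (regular_module R)"
        and G: "\<And>a k. \<lbrakk>a \<in> \<mm>; k \<in> B\<rbrakk> \<Longrightarrow> a \<odot>\<^bsub>regular_module R\<^esub> k \<in> L"
      have "G \<subseteq> L" using G by (auto simp: G_def regular_module_simps)
      then have "J \<subseteq> L" unfolding J_def
        by (rule genideal_minimal[rotated]) (use L in \<open>simp add: submodule_regular_iff\<close>)
      then show "B \<subseteq> L" using \<open>B \<subseteq> J\<close> by blast
    qed
    then have "x \<otimes> \<one> = \<zero>" using xB x_props by auto
    then have "\<one> = \<zero>" using x(2) by (simp add: regular_element_def)
    then show False using one_notin idealD(2)[OF max_ideal_ideal] by simp
  qed
  have xx: "x \<otimes> x \<in> \<mm>" "regular_element R (x \<otimes> x)" "x \<otimes> x \<in> J"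
    using idealD(5)[OF max_ideal_ideal] x_props regular_mult[OF x(2) x(2)] mB[OF x_props(1) xB] by auto
  obtain y where y: "y \<in> carrier R" "\<And>j. j \<in> J \<Longrightarrow> y \<otimes> j \<in> PIdl (x \<otimes> x)" "y \<otimes> x \<notin> PIdl (x \<otimes> x)"
    using separating_annihilator[OF xx(1,2) J xx(3) x_props(2) \<open>x \<notin> J\<close>] by metis
  have PIdl_xx: "z \<in> PIdl (x \<otimes> x) \<longleftrightarrow> (\<exists>r\<in>carrier R. z = x \<otimes> (x \<otimes> r))" for z
    using x_props by (auto simp: cgenideal_def m_comm m_lcomm m_assoc)
  have "y \<notin> PIdl x"
  proof
    assume "y \<in> PIdl x"
    then obtain r where "r \<in> carrier R" "y = x \<otimes> r" by (auto simp: PIdl_x)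
    then have "y \<otimes> x = x \<otimes> (x \<otimes> r)" using x_props by (simp add: m_comm m_lcomm)
    then show False using y(3) PIdl_xx \<open>r \<in> carrier R\<close> by blast
  qed
  moreover have "a \<otimes> y \<in> xI" if a: "a \<in> \<mm>" for a
  proof -
    have aR: "a \<in> carrier R" using a by (rule max_ideal_sub)
    have ayb: "\<exists>r\<in>carrier R. a \<otimes> y \<otimes> b = x \<otimes> (x \<otimes> r)" if b: "b \<in> B" for b
      using y(2)[OF mB[OF a b]] PIdl_xx aR y(1) BR[OF b] by (simp add: m_ac)
    obtain z where z: "z \<in> carrier R" "a \<otimes> y \<otimes> x = x \<otimes> (x \<otimes> z)" using ayb[OF xB] by blast
    then have "x \<otimes> (a \<otimes> y) = x \<otimes> (x \<otimes> z)" using aR y(1) x_props by (simp add: m_comm)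
    then have ay: "a \<otimes> y = x \<otimes> z" using regular_cancel[OF x(2)] aR y(1) x_props z(1) by simp
    have zB: "z \<otimes> b \<in> PIdl x" if b: "b \<in> B" for b
    proof -
      obtain r where r: "r \<in> carrier R" "x \<otimes> z \<otimes> b = x \<otimes> (x \<otimes> r)" using ayb[OF b] ay by auto
      then have "x \<otimes> (z \<otimes> b) = x \<otimes> (x \<otimes> r)" using z(1) BR[OF b] x_props by (simp add: m_assoc)
      then have "z \<otimes> b = x \<otimes> r" using regular_cancel[OF x(2)] z(1) BR[OF b] x_props r(1) by simp
      then show ?thesis using r(1) by (auto simp: PIdl_x)
    qed
    \<comment> \<open>Otherwise duality modulo x would yield u in B with u z outside (x): the double
      annihilator of I modulo (x) is I.\<close>
    have "z \<in> I"
    proof (rule ccontr)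
      assume "z \<notin> I"
      then obtain u where u: "u \<in> carrier R" "\<And>j. j \<in> I \<Longrightarrow> u \<otimes> j \<in> PIdl x" "u \<otimes> z \<notin> PIdl x"
        using separating_annihilator[OF x_props(1) x(2) I(1) x(1) z(1)] by metis
      then have "u \<in> B" by (simp add: B_def)
      then have "z \<otimes> u \<in> PIdl x" by (rule zB)
      then show False using u(3) m_comm[OF u(1) z(1)] by simp
    qed
    then show ?thesis using ay by (auto simp: xI_def)
  qed
  ultimately show ?thesis using y(1) by (auto simp: T_def ideal_socle_def)
qed

text \<open>The top step from x (I : \<mm>) to T is simple because y - r c, chosen in (x), stays in
  T. Multiplication by the regular x identifies the remaining interval with (I : \<mm>)/I.\<close>

lemma length_T:
  "chain_length {N. submodule N R (regular_module R) \<and> xI \<subseteq> N \<and> N \<subseteq> T} =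
    1 + artinian_ring_type (R Quot I)"
proof -
  let ?L = "ideal_socle R \<mm> I"
  let ?xL = "(\<otimes>) x ` ?L"
  note L = ideal_socle_ideal[OF I(1)]
  have xL: "ideal ?xL R" by (rule mult_ideal[OF L(1)])
  have LR: "z \<in> carrier R" if "z \<in> ?L" for z using that by (simp add: ideal_socle_def)
  have xI_xL: "xI \<subseteq> ?xL" unfolding xI_def using L(2) by blast
  have "chain_length {N. submodule N R (regular_module R) \<and> xI \<subseteq> N \<and> N \<subseteq> T} =
      1 + chain_length {N. submodule N R (regular_module R) \<and> xI \<subseteq> N \<and> N \<subseteq> ?xL}"
  proof (rule interval_length_Suc[OF regular_module_module])
    show "?xL \<subset> T" using T_inter T_not_sub by blast
    fix c y assume c: "c \<in> T" "c \<notin> ?xL" and y: "y \<in> T"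
    have cR: "c \<in> carrier R" "y \<in> carrier R" using c y by (auto simp: T_def ideal_socle_def)
    have "c \<notin> PIdl x" using c T_inter by blast
    moreover have "a \<otimes> c \<in> PIdl x" "a \<otimes> y \<in> PIdl x" if "a \<in> \<mm>" for a
      using T_sub_sx c y that by (auto simp: sx_def ideal_socle_def)
    ultimately obtain r where r: "r \<in> carrier R" "y \<ominus> r \<otimes> c \<in> PIdl x"
      using quotient_socle_simple[OF x_props(1) x(2) cR(1) _ _ cR(2)] by metis
    have "y \<ominus> r \<otimes> c \<in> T" using idealD(4,5)[OF T_ideal] y c r(1) by blast
    then have "y \<ominus> r \<otimes> c \<in> ?xL" using r(2) T_inter by blast
    then show "\<exists>r\<in>carrier R. y \<ominus>\<^bsub>regular_module R\<^esub> r \<odot>\<^bsub>regular_module R\<^esub> c \<in> ?xL"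
      using r(1) cR by (intro bexI[of _ r]) (simp_all add: regular_module_simps regular_module_minus)
  qed (use xI_ideal xL T_ideal xI_xL in \<open>simp_all add: submodule_regular_iff\<close>)
  moreover have "chain_length {N. submodule N R (ideal_module R ?L) \<and>
        {z \<in> carrier (ideal_module R ?L). x \<otimes> z \<in> xI} \<subseteq> N} =
      chain_length {N. submodule N R (regular_module R) \<and> xI \<subseteq> N \<and> N \<subseteq> ?xL}"
  proof (rule chain_length_correspondence[OF ideal_module_module[OF L(1)] regular_module_module, where \<rho> = id],
      unfold ideal_module_simps regular_module_simps)
    show "\<exists>k\<in>xI. x \<otimes> (a \<otimes> z) = id a \<otimes> (x \<otimes> z) \<oplus> k" if "a \<in> carrier R" "z \<in> ?L" for a z
      using that LR x_props idealD(2)[OF xI_ideal] by (intro bexI[of _ \<zero>]) (auto simp: m_lcomm)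
    show "\<exists>z\<in>?L. \<exists>k\<in>xI. w = x \<otimes> z \<oplus> k" if "w \<in> ?xL" for w
      using that LR x_props idealD(2)[OF xI_ideal] by force
  qed (use xI_ideal xL xI_xL LR x_props in \<open>auto simp: submodule_regular_iff r_distr\<close>)
  moreover have "{z \<in> carrier (ideal_module R ?L). x \<otimes> z \<in> xI} = I"
    using mult_mem_xI LR L(2) by (auto simp: ideal_module_simps)
  ultimately show ?thesis using artinian_ring_type_quotient[OF I] by simp
qed

lemma module_type_I: "module_type R (ideal_module R I) = 1 + artinian_ring_type (R Quot I)"
proof -
  note M = ideal_module_module[OF I(1)]
  have "module_type R (ideal_module R I) =
      chain_length {N. submodule N R (ideal_module R I) \<and> multiples (ideal_module R I) x \<subseteq> N \<and>
        N \<subseteq> socle_mod \<mm> (ideal_module R I) x}"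
    unfolding module_type_def dim
    using ext_residue_field_length[OF M x_props(1)] x(2) I_sub
    by (simp add: ideal_module_simps regular_element_def one_enat_def)
  moreover have "multiples (ideal_module R I) x = xI"
    by (simp add: multiples_def ideal_module_simps xI_def)
  \<comment> \<open>The socle is formed inside I, whereas T is defined inside R; they agree because
    T \<subseteq> I.\<close>
  moreover from this have "socle_mod \<mm> (ideal_module R I) x = T"
    using T_sub_I I_sub by (auto simp: socle_mod_def T_def ideal_socle_def ideal_module_simps)
  moreover have "{N. submodule N R (ideal_module R I) \<and> xI \<subseteq> N \<and> N \<subseteq> T} =
      {N. submodule N R (regular_module R) \<and> xI \<subseteq> N \<and> N \<subseteq> T}"
    using T_sub_I by (auto simp: submodule_ideal_module_iff[OF I(1)] submodule_regular_iff)
  ultimately show ?thesis using length_T by simp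
qed

end

section \<open>Idealization of an ideal\<close>

context cring
begin

context
  fixes I assumes I: "ideal I R"
begin

private abbreviation (input) S where "S \<equiv> R \<ltimes> ideal_module R I"

lemma I_in_R: "i \<in> I \<Longrightarrow> i \<in> carrier R" using idealD(1)[OF I] by blast

lemma idealization_simps:
  "carrier S = carrier R \<times> I"
  "(a, i) \<otimes>\<^bsub>S\<^esub> (c, j) = (a \<otimes> c, a \<otimes> j \<oplus> c \<otimes> i)"
  "\<one>\<^bsub>S\<^esub> = (\<one>, \<zero>)" "\<zero>\<^bsub>S\<^esub> = (\<zero>, \<zero>)"
  "(a, i) \<oplus>\<^bsub>S\<^esub> (c, j) = (a \<oplus> c, i \<oplus> j)"
  by (simp_all add: idealization_def ideal_module_simps)

lemma idealization_cring: "cring S"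
proof (rule cringI)
  note D = idealD[OF I]
  have neg: "\<ominus> i \<in> I" if "i \<in> I" for i using D(4)[OF D(2) that] I_in_R[OF that] by (simp add: a_minus_def)
  show "abelian_group S"
  proof (rule abelian_groupI)
    fix p assume "p \<in> carrier S"
    then obtain a i where p: "p = (a, i)" "a \<in> carrier R" "i \<in> I" by (auto simp: idealization_simps)
    then have "(\<ominus> a, \<ominus> i) \<oplus>\<^bsub>S\<^esub> p = \<zero>\<^bsub>S\<^esub>" "(\<ominus> a, \<ominus> i) \<in> carrier S"
      using neg I_in_R by (auto simp: idealization_simps l_neg)
    then show "\<exists>q\<in>carrier S. q \<oplus>\<^bsub>S\<^esub> p = \<zero>\<^bsub>S\<^esub>" by blast
  next
    fix p q r assume "p \<in> carrier S" "q \<in> carrier S" "r \<in> carrier S"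
    then show "p \<oplus>\<^bsub>S\<^esub> q \<oplus>\<^bsub>S\<^esub> r = p \<oplus>\<^bsub>S\<^esub> (q \<oplus>\<^bsub>S\<^esub> r)"
      using I_in_R by (auto simp: idealization_simps a_assoc)
  next
    fix p q assume "p \<in> carrier S" "q \<in> carrier S"
    then show "p \<oplus>\<^bsub>S\<^esub> q = q \<oplus>\<^bsub>S\<^esub> p" "p \<oplus>\<^bsub>S\<^esub> q \<in> carrier S"
      using I_in_R D(3) by (auto simp: idealization_simps a_comm)
  qed (use D I_in_R in \<open>auto simp: idealization_simps\<close>)
  show "comm_monoid S"
  proof (rule comm_monoidI)
    fix p q r assume "p \<in> carrier S" "q \<in> carrier S" "r \<in> carrier S"
    then obtain a i c j e k where *: "p = (a, i)" "a \<in> carrier R" "i \<in> carrier R"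
      "q = (c, j)" "c \<in> carrier R" "j \<in> carrier R" "r = (e, k)" "e \<in> carrier R" "k \<in> carrier R"
      using I_in_R by (auto simp: idealization_simps)
    have "a \<otimes> c \<otimes> k \<oplus> e \<otimes> (a \<otimes> j \<oplus> c \<otimes> i) = a \<otimes> (c \<otimes> k \<oplus> e \<otimes> j) \<oplus> c \<otimes> e \<otimes> i"
      using * by algebra
    then show "p \<otimes>\<^bsub>S\<^esub> q \<otimes>\<^bsub>S\<^esub> r = p \<otimes>\<^bsub>S\<^esub> (q \<otimes>\<^bsub>S\<^esub> r)"
      using * by (simp add: idealization_simps m_assoc)
  next
    fix p q assume "p \<in> carrier S" "q \<in> carrier S"
    then show "p \<otimes>\<^bsub>S\<^esub> q = q \<otimes>\<^bsub>S\<^esub> p" "p \<otimes>\<^bsub>S\<^esub> q \<in> carrier S"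
      using I_in_R D(3,5) by (auto simp: idealization_simps a_comm) (auto simp: m_comm)
  qed (use D I_in_R in \<open>auto simp: idealization_simps\<close>)
  fix p q r assume "p \<in> carrier S" "q \<in> carrier S" "r \<in> carrier S"
  then obtain a i c j e k where *: "p = (a, i)" "a \<in> carrier R" "i \<in> carrier R"
    "q = (c, j)" "c \<in> carrier R" "j \<in> carrier R" "r = (e, k)" "e \<in> carrier R" "k \<in> carrier R"
    using I_in_R by (auto simp: idealization_simps)
  have "(a \<oplus> c) \<otimes> k \<oplus> e \<otimes> (i \<oplus> j) = a \<otimes> k \<oplus> e \<otimes> i \<oplus> (c \<otimes> k \<oplus> e \<otimes> j)"
    using * by algebra
  then show "(p \<oplus>\<^bsub>S\<^esub> q) \<otimes>\<^bsub>S\<^esub> r = p \<otimes>\<^bsub>S\<^esub> r \<oplus>\<^bsub>S\<^esub> q \<otimes>\<^bsub>S\<^esub> r"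
    using * by (simp add: idealization_simps l_distr)
qed

text \<open>An ideal of the idealization is a submodule of the free R-module of rank two, hence
  finitely generated over R. The same generators serve over the idealization, since a acts as (a,
  0).\<close>

lemma idealization_noetherian:
  assumes "noetherian_ring R"
  shows "noetherian_ring S"
proof -
  interpret S: cring S by (rule idealization_cring)
  interpret F: module R "free_module R 2" by (rule free_module_module)
  note D = idealD[OF I]
  have pairs: "submodule {v \<in> carrier (free_module R 2). (v 0, v 1) \<in> J} R (free_module R 2)"
    if J: "ideal J S" for J
  proof (rule F.submoduleI')
    note DJ = S.idealD[OF J]
    show "\<zero>\<^bsub>free_module R 2\<^esub> \<in> {v \<in> carrier (free_module R 2). (v 0, v 1) \<in> J}"
      using DJ(2) F.zero_closed by (simp add: free_module_simps idealization_simps)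
    fix v w assume "v \<in> {v \<in> carrier (free_module R 2). (v 0, v 1) \<in> J}"
      "w \<in> {v \<in> carrier (free_module R 2). (v 0, v 1) \<in> J}"
    then show "v \<oplus>\<^bsub>free_module R 2\<^esub> w \<in> {v \<in> carrier (free_module R 2). (v 0, v 1) \<in> J}"
      using DJ(3)[of "(v 0, v 1)" "(w 0, w 1)"] F.a_closed[of v w]
      by (simp add: idealization_simps) (simp add: free_module_simps)
  next
    note DJ = S.idealD[OF J]
    fix a v assume a: "a \<in> carrier R" and v: "v \<in> {v \<in> carrier (free_module R 2). (v 0, v 1) \<in> J}"
    then have "v 0 \<in> carrier R" "v 1 \<in> carrier R" using free_module_closed by auto
    then have "(a, \<zero>) \<otimes>\<^bsub>S\<^esub> (v 0, v 1) = (a \<otimes> v 0, a \<otimes> v 1)"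
      using a by (simp add: idealization_simps)
    moreover have "(a, \<zero>) \<otimes>\<^bsub>S\<^esub> (v 0, v 1) \<in> J"
      using DJ(5)[of "(a, \<zero>)" "(v 0, v 1)"] a v D(2) by (simp add: idealization_simps)
    ultimately show "a \<odot>\<^bsub>free_module R 2\<^esub> v \<in> {v \<in> carrier (free_module R 2). (v 0, v 1) \<in> J}"
      using a v F.smult_closed[of a v] by (simp add: free_module_simps)
  qed auto
  show ?thesis
  proof (rule S.noetherian_ringI)
    fix J assume J: "ideal J S"
    note DJ = S.idealD[OF J]
    obtain V where V: "finite V" "V \<subseteq> {v \<in> carrier (free_module R 2). (v 0, v 1) \<in> J}"
      "\<And>N. \<lbrakk>submodule N R (free_module R 2); V \<subseteq> N\<rbrakk> \<Longrightarrow>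
        {v \<in> carrier (free_module R 2). (v 0, v 1) \<in> J} \<subseteq> N"
      using fin_gen_free[OF is_cring assms pairs[OF J]] unfolding fin_gen_def by blast
    let ?A = "(\<lambda>v. (v 0, v 1)) ` V"
    have A: "?A \<subseteq> J" using V(2) by blast
    then have AS: "?A \<subseteq> carrier S" using DJ(1) by blast
    have "J \<subseteq> Idl\<^bsub>S\<^esub> ?A"
    proof
      fix p assume p: "p \<in> J"
      then obtain a i where ai: "p = (a, i)" "a \<in> carrier R" "i \<in> carrier R"
        using DJ(1) I_in_R by (auto simp: idealization_simps)
      define v where "v = (\<lambda>n::nat. if n = 0 then a else if n = 1 then i else \<zero>)"
      have v: "v \<in> {v \<in> carrier (free_module R 2). (v 0, v 1) \<in> J}"
        using ai p by (auto simp: v_def free_module_simps)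
      have "V \<subseteq> {v \<in> carrier (free_module R 2). (v 0, v 1) \<in> Idl\<^bsub>S\<^esub> ?A}"
        using V(2) S.genideal_self[OF AS] by blast
      from V(3)[OF pairs[OF S.genideal_ideal[OF AS]] this] v
      have "(v 0, v 1) \<in> Idl\<^bsub>S\<^esub> ?A" by blast
      then show "p \<in> Idl\<^bsub>S\<^esub> ?A" using ai by (simp add: v_def)
    qed
    moreover have "Idl\<^bsub>S\<^esub> ?A \<subseteq> J" by (rule S.genideal_minimal[OF J A])
    ultimately show "\<exists>A\<subseteq>carrier S. finite A \<and> J = Idl\<^bsub>S\<^esub> A"
      using AS V(1) by (intro exI[of _ ?A]) auto
  qed
qed

lemma idealization_ideal:
  assumes J: "ideal J R" and K: "ideal K R" "K \<subseteq> I" and JK: "\<And>j i. \<lbrakk>j \<in> J; i \<in> I\<rbrakk> \<Longrightarrow> j \<otimes> i \<in> K"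
  shows "ideal (J \<times> K) S"
proof -
  interpret S: cring S by (rule idealization_cring)
  show ?thesis
  proof (rule S.idealI')
    fix p q assume "p \<in> carrier S" "q \<in> J \<times> K"
    then show "p \<otimes>\<^bsub>S\<^esub> q \<in> J \<times> K"
      using idealD(3,5)[OF K(1)] idealD(5)[OF J] JK by (auto simp: idealization_simps)
  qed (use idealD(1-3)[OF J] idealD(2,3)[OF K(1)] K(2) in \<open>auto simp: idealization_simps\<close>)
qed

text \<open>The element (0, i) has square zero.\<close>

lemma idealization_prime_contains:
  assumes P: "primeideal P S" and i: "i \<in> I"
  shows "(\<zero>, i) \<in> P"
proof -
  interpret S: cring S by (rule idealization_cring)
  interpret P: primeideal P S by (rule P)
  have "(\<zero>, i) \<otimes>\<^bsub>S\<^esub> (\<zero>, i) \<in> P"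
    using S.idealD(2)[OF P.is_ideal] I_in_R[OF i] by (simp add: idealization_simps)
  then show ?thesis using P.I_prime[of "(\<zero>, i)" "(\<zero>, i)"] i by (auto simp: idealization_simps)
qed

text \<open>A prime contains all (0, i) and is therefore determined by its first components, so the
  primes are exactly the P \<times> I.\<close>

lemma idealization_krull_dim: "krull_dim S = krull_dim R"
  unfolding krull_dim_chain
proof (rule antisym)
  interpret S: cring S by (rule idealization_cring)
  note D = idealD[OF I]
  have mem: "(a, i) \<in> P \<longleftrightarrow> (a, \<zero>) \<in> P" if P: "primeideal P S" and ai: "a \<in> carrier R" "i \<in> I" for P a i
  proof -
    note DP = S.idealD[OF primeideal.axioms(1)[OF P]]
    have i: "i \<in> carrier R" "\<ominus> i \<in> I"
      using ai I_in_R D(4)[OF D(2) ai(2)] by (auto simp: a_minus_def)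
    have "(a, i) = (a, \<zero>) \<oplus>\<^bsub>S\<^esub> (\<zero>, i)" "(a, \<zero>) = (a, i) \<oplus>\<^bsub>S\<^esub> (\<zero>, \<ominus> i)"
      using ai i by (simp_all add: idealization_simps r_neg)
    then show ?thesis
      using DP(3) idealization_prime_contains[OF P ai(2)] idealization_prime_contains[OF P i(2)] by metis
  qed
  show "chain_length {P. primeideal P S} \<le> chain_length {P. primeideal P R}"
  proof (rule chain_length_mono_map[where F = "\<lambda>P. {a \<in> carrier R. (a, \<zero>) \<in> P}"])
    fix P assume "P \<in> {P. primeideal P S}"
    then have P: "primeideal P S" by simp
    interpret P: primeideal P S by (rule P)
    note DP = S.idealD[OF P.is_ideal]
    have "primeideal {a \<in> carrier R. (a, \<zero>) \<in> P} R"
    proof (rule primeidealI[OF _ is_cring])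
      show "ideal {a \<in> carrier R. (a, \<zero>) \<in> P} R"
      proof (rule idealI')
        fix a c assume ac: "a \<in> {a \<in> carrier R. (a, \<zero>) \<in> P}" "c \<in> {a \<in> carrier R. (a, \<zero>) \<in> P}"
        then show "a \<oplus> c \<in> {a \<in> carrier R. (a, \<zero>) \<in> P}"
          using DP(3)[of "(a, \<zero>)" "(c, \<zero>)"] by (simp add: idealization_simps)
      next
        fix r a assume ra: "r \<in> carrier R" "a \<in> {a \<in> carrier R. (a, \<zero>) \<in> P}"
        then show "r \<otimes> a \<in> {a \<in> carrier R. (a, \<zero>) \<in> P}"
          using DP(5)[of "(r, \<zero>)" "(a, \<zero>)"] D(2) by (simp add: idealization_simps)
      qed (use DP(2) in \<open>auto simp: idealization_simps\<close>)
      have "\<one>\<^bsub>S\<^esub> \<notin> P" using P.I_notcarr P.one_imp_carrier by blast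
      then have "\<one> \<notin> {a \<in> carrier R. (a, \<zero>) \<in> P}" by (simp add: idealization_simps)
      then show "carrier R \<noteq> {a \<in> carrier R. (a, \<zero>) \<in> P}" using one_closed by blast
      fix a c assume ac: "a \<in> carrier R" "c \<in> carrier R" "a \<otimes> c \<in> {a \<in> carrier R. (a, \<zero>) \<in> P}"
      then have "(a, \<zero>) \<otimes>\<^bsub>S\<^esub> (c, \<zero>) \<in> P" by (simp add: idealization_simps)
      then show "a \<in> {a \<in> carrier R. (a, \<zero>) \<in> P} \<or> c \<in> {a \<in> carrier R. (a, \<zero>) \<in> P}"
        using P.I_prime[of "(a, \<zero>)" "(c, \<zero>)"] ac D(2) by (auto simp: idealization_simps)
    qed
    then show "{a \<in> carrier R. (a, \<zero>) \<in> P} \<in> {P. primeideal P R}" by simp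
  next
    fix P Q assume "P \<in> {P. primeideal P S}" "Q \<in> {P. primeideal P S}" and PQ: "P \<subset> Q"
    then have P: "primeideal P S" and Q: "primeideal Q S" by simp_all
    obtain q where q: "q \<in> Q" "q \<notin> P" using PQ by blast
    then obtain a i where ai: "q = (a, i)" "a \<in> carrier R" "i \<in> I"
      using S.idealD(1)[OF primeideal.axioms(1)[OF Q]] by (auto simp: idealization_simps)
    have "(a, \<zero>) \<in> Q" "(a, \<zero>) \<notin> P" using q mem[OF P ai(2,3)] mem[OF Q ai(2,3)] ai(1) by auto
    then show "{a \<in> carrier R. (a, \<zero>) \<in> P} \<subset> {a \<in> carrier R. (a, \<zero>) \<in> Q}" using PQ ai(2) by blast
  qed
  show "chain_length {P. primeideal P R} \<le> chain_length {P. primeideal P S}"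
  proof (rule chain_length_mono_map[where F = "\<lambda>P. P \<times> I"])
    fix P assume "P \<in> {P. primeideal P R}"
    then have P: "primeideal P R" by simp
    interpret P: primeideal P R by (rule P)
    have "primeideal (P \<times> I) S"
    proof (rule primeidealI[OF _ S.is_cring])
      show "ideal (P \<times> I) S"
        by (rule idealization_ideal[OF P.is_ideal I]) (use idealD(1)[OF P.is_ideal] D(5) in auto)
      show "carrier S \<noteq> P \<times> I" using P.I_notcarr D(2) by (auto simp: idealization_simps)
      fix p q assume "p \<in> carrier S" "q \<in> carrier S" "p \<otimes>\<^bsub>S\<^esub> q \<in> P \<times> I"
      then show "p \<in> P \<times> I \<or> q \<in> P \<times> I"
        using P.I_prime[of "fst p" "fst q"] by (cases p; cases q) (auto simp: idealization_simps)
    qed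
    then show "P \<times> I \<in> {P. primeideal P S}" by simp
  next
    fix P Q :: "'a set" assume "P \<subset> Q"
    then show "P \<times> I \<subset> Q \<times> I" using D(2) by blast
  qed
qed

end

end

lemma (in noetherian_local) idealization_local:
  assumes I: "ideal I R"
  shows "noetherian_local (R \<ltimes> ideal_module R I) (\<mm> \<times> I)"
proof -
  let ?S = "R \<ltimes> ideal_module R I"
  interpret S: cring ?S by (rule idealization_cring[OF I])
  note simps = idealization_simps[OF I] and IR = I_in_R[OF I]
  show ?thesis
  proof (intro noetherian_local.intro local_cring.intro local_cring_axioms.intro S.is_cring
      idealization_noetherian[OF I noetherian_ring_axioms])
    show "ideal (\<mm> \<times> I) ?S"
      by (rule idealization_ideal[OF I max_ideal_ideal I]) (use max_ideal_sub idealD(5)[OF I] in auto)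
    show "\<one>\<^bsub>?S\<^esub> \<notin> \<mm> \<times> I" using one_notin by (simp add: simps)
    fix p assume p: "p \<in> carrier ?S" "p \<notin> \<mm> \<times> I"
    then obtain a i where ai: "p = (a, i)" "a \<in> carrier R" "i \<in> I" "i \<in> carrier R" "a \<notin> \<mm>"
      using IR by (auto simp: simps)
    then have U: "a \<in> Units R" using units by blast
    \<comment> \<open>Since elements of I square to zero here, the inverse of a + i is 1/a - i/(a
      a).\<close>
    let ?q = "(inv a, \<ominus> (inv a \<otimes> (inv a \<otimes> i)))"
    have "inv a \<otimes> (inv a \<otimes> i) \<in> I" using U idealD(5)[OF I] ai(3) by simp
    then have "\<ominus> (inv a \<otimes> (inv a \<otimes> i)) \<in> I"
      using idealD(4)[OF I idealD(2)[OF I]] IR by (auto simp: a_minus_def)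
    then have q: "?q \<in> carrier ?S" using U by (simp add: simps)
    have "a \<otimes> (inv a \<otimes> (inv a \<otimes> i)) = inv a \<otimes> i"
      using U ai by (simp flip: m_assoc)
    then have "p \<otimes>\<^bsub>?S\<^esub> ?q = \<one>\<^bsub>?S\<^esub>"
      using U ai by (simp add: simps r_minus l_neg)
    then show "p \<in> Units ?S" using p(1) q S.m_comm[OF p(1) q] unfolding Units_def by auto
  qed
qed

section \<open>The type of the idealization\<close>

context trace_ideal_setting
begin

abbreviation (input) RI where "RI \<equiv> R \<ltimes> ideal_module R I"

text \<open>As I \<subseteq> \<mm>, c I lies in (x), and \<open>stable\<close> improves this to x I.
  This disposes of the mixed term in the multiplication of the idealization.\<close>

lemma sx_I: "c \<otimes> i \<in> xI" if c: "c \<in> sx" and i: "i \<in> I"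
proof -
  have "c \<in> carrier R" "\<And>i. i \<in> I \<Longrightarrow> c \<otimes> i \<in> PIdl x"
    using c I(2) max_ideal_sub by (auto simp: sx_def ideal_socle_def m_comm)
  from stable[OF this i] show ?thesis by (auto simp: xI_def)
qed

text \<open>The element (x, 0) is regular, with multiples (x) \<times> x I and socle preimage
  \<open>sx \<times> T\<close>. The step down to (x) \<times> T is simple because the socle of R/(x)
  is; the interval left over projects to T/xI.\<close>

lemma ring_type_idealization: "ring_type RI = 2 + artinian_ring_type (R Quot I)"
proof -
  interpret S: noetherian_local RI "\<mm> \<times> I" by (rule idealization_local[OF I(1)])
  interpret SS: module RI "regular_module RI" by (rule S.regular_module_module)
  note simps = idealization_simps[OF I(1)]
  let ?x = "(x, \<zero>)"
  have zero_I: "\<zero> \<in> I" by (rule idealD(2)[OF I(1)])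
  have x_S: "?x \<in> \<mm> \<times> I" using x_props zero_I by simp
  have x_mult: "?x \<otimes>\<^bsub>RI\<^esub> (c, t) = (x \<otimes> c, x \<otimes> t)" if "c \<in> carrier R" "t \<in> carrier R" for c t
    using that x_props by (simp add: simps)
  have reg: "p = \<zero>\<^bsub>RI\<^esub>" if "p \<in> carrier RI" "?x \<otimes>\<^bsub>RI\<^esub> p = \<zero>\<^bsub>RI\<^esub>" for p
    using that x(2) I_sub x_mult by (auto simp: simps regular_element_def)
  have ext: "ring_type RI = chain_length {N. submodule N RI (regular_module RI) \<and>
      multiples (regular_module RI) ?x \<subseteq> N \<and> N \<subseteq> socle_mod (\<mm> \<times> I) (regular_module RI) ?x}"
    unfolding ring_type_def module_type_def idealization_krull_dim[OF I(1)] dim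
    using S.ext_residue_field_length[OF S.regular_module_module x_S] reg
    by (simp add: S.regular_module_simps one_enat_def)
  have mult: "multiples (regular_module RI) ?x = (PIdl x) \<times> xI"
  proof (rule Set.set_eqI)
    fix p :: "'a \<times> 'a"
    obtain c t where p: "p = (c, t)" by (cases p)
    have "p \<in> multiples (regular_module RI) ?x \<longleftrightarrow> (\<exists>a\<in>carrier R. \<exists>i\<in>I. p = ?x \<otimes>\<^bsub>RI\<^esub> (a, i))"
      by (auto simp: multiples_def S.regular_module_simps simps(1))
    also have "\<dots> \<longleftrightarrow> p \<in> (PIdl x) \<times> xI"
      using I_sub x_mult unfolding p PIdl_x xI_def by auto
    finally show "p \<in> multiples (regular_module RI) ?x \<longleftrightarrow> p \<in> (PIdl x) \<times> xI" .
  qed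
  have soc: "socle_mod (\<mm> \<times> I) (regular_module RI) ?x = sx \<times> T"
  proof (rule Set.set_eqI)
    fix p :: "'a \<times> 'a"
    obtain c t where p: "p = (c, t)" by (cases p)
    have "p \<in> socle_mod (\<mm> \<times> I) (regular_module RI) ?x \<longleftrightarrow> c \<in> carrier R \<and> t \<in> I \<and>
        (\<forall>a\<in>\<mm>. \<forall>i\<in>I. a \<otimes> c \<in> PIdl x \<and> a \<otimes> t \<oplus> c \<otimes> i \<in> xI)"
      by (auto simp: socle_mod_def mult p S.regular_module_simps simps)
    also have "\<dots> \<longleftrightarrow> c \<in> sx \<and> t \<in> T"
    proof
      assume *: "c \<in> carrier R \<and> t \<in> I \<and> (\<forall>a\<in>\<mm>. \<forall>i\<in>I. a \<otimes> c \<in> PIdl x \<and> a \<otimes> t \<oplus> c \<otimes> i \<in> xI)"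
      then have "c \<in> sx" using zero_I by (auto simp: sx_def ideal_socle_def)
      moreover have "a \<otimes> t \<in> xI" if "a \<in> \<mm>" for a
      proof -
        have "a \<otimes> t \<oplus> c \<otimes> \<zero> \<in> xI" using * that zero_I by blast
        then show ?thesis using * max_ideal_sub[OF that] I_sub by simp
      qed
      ultimately show "c \<in> sx \<and> t \<in> T" using * I_sub by (auto simp: T_def ideal_socle_def)
    next
      assume ct: "c \<in> sx \<and> t \<in> T"
      then have "c \<in> carrier R" "t \<in> I" using T_sub_I by (auto simp: sx_def ideal_socle_def)
      moreover have "a \<otimes> c \<in> PIdl x" "a \<otimes> t \<in> xI" if "a \<in> \<mm>" for a
        using ct that by (auto simp: sx_def T_def ideal_socle_def)
      ultimately show "c \<in> carrier R \<and> t \<in> I \<and>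
          (\<forall>a\<in>\<mm>. \<forall>i\<in>I. a \<otimes> c \<in> PIdl x \<and> a \<otimes> t \<oplus> c \<otimes> i \<in> xI)"
        using ct sx_I idealD(3)[OF xI_ideal] by blast
    qed
    finally show "p \<in> socle_mod (\<mm> \<times> I) (regular_module RI) ?x \<longleftrightarrow> p \<in> sx \<times> T" by (simp add: p)
  qed
  note Px = cgenideal_ideal[OF x_props(2)]
  have Px_I: "c \<otimes> i \<in> xI" if "c \<in> PIdl x" "i \<in> I" for c i using sx_I x_sx that by blast
  have xI_I: "xI \<subseteq> I" using xI_T T_sub_I by blast
  have A: "ideal ((PIdl x) \<times> xI) RI" by (rule idealization_ideal[OF I(1) Px xI_ideal xI_I Px_I])
  have B: "ideal ((PIdl x) \<times> T) RI"
    by (rule idealization_ideal[OF I(1) Px T_ideal T_sub_I]) (use Px_I xI_T in blast)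
  have C: "ideal (sx \<times> T) RI"
    by (rule idealization_ideal[OF I(1) sx_ideal T_ideal T_sub_I]) (use sx_I xI_T in blast)
  obtain s where s: "s \<in> carrier R" "s \<notin> PIdl x" "\<And>a. a \<in> \<mm> \<Longrightarrow> a \<otimes> s \<in> PIdl x"
    using quotient_socle_nonzero[OF x_props(1) x(2)] by metis
  then have s_sx: "s \<in> sx" by (simp add: sx_def ideal_socle_def)
  have "chain_length {N. submodule N RI (regular_module RI) \<and> (PIdl x) \<times> xI \<subseteq> N \<and> N \<subseteq> sx \<times> T} =
      1 + chain_length {N. submodule N RI (regular_module RI) \<and> (PIdl x) \<times> xI \<subseteq> N \<and> N \<subseteq> (PIdl x) \<times> T}"
  proof (rule interval_length_Suc[OF S.regular_module_module])
    show "(PIdl x) \<times> T \<subset> sx \<times> T" using x_sx s(2) s_sx idealD(2)[OF T_ideal] by blast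
    fix c y assume c: "c \<in> sx \<times> T" "c \<notin> (PIdl x) \<times> T" and y: "y \<in> sx \<times> T"
    obtain c1 c2 y1 y2 where cy: "c = (c1, c2)" "y = (y1, y2)" by (cases c, cases y)
    have c1: "c1 \<in> carrier R" "c1 \<notin> PIdl x" "\<And>a. a \<in> \<mm> \<Longrightarrow> a \<otimes> c1 \<in> PIdl x"
      and y1: "y1 \<in> carrier R" "\<And>a. a \<in> \<mm> \<Longrightarrow> a \<otimes> y1 \<in> PIdl x"
      using c y by (auto simp: cy sx_def ideal_socle_def)
    obtain r where r: "r \<in> carrier R" "y1 \<ominus> r \<otimes> c1 \<in> PIdl x"
      using quotient_socle_simple[OF x_props(1) x(2) c1 y1] by metis
    have rS: "(r, \<zero>) \<in> carrier RI" using r(1) zero_I by (simp add: simps)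
    have d: "y \<ominus>\<^bsub>RI\<^esub> (r, \<zero>) \<otimes>\<^bsub>RI\<^esub> c \<in> sx \<times> T"
      using S.idealD(4)[OF C y S.idealD(5)[OF C rS c(1)]] .
    obtain e f where ef: "y \<ominus>\<^bsub>RI\<^esub> (r, \<zero>) \<otimes>\<^bsub>RI\<^esub> c = (e, f)" by (cases "y \<ominus>\<^bsub>RI\<^esub> (r, \<zero>) \<otimes>\<^bsub>RI\<^esub> c")
    have cyS: "c \<in> carrier RI" "y \<in> carrier RI" using c(1) y S.idealD(1)[OF C] by blast+
    have "y = (e, f) \<oplus>\<^bsub>RI\<^esub> (r, \<zero>) \<otimes>\<^bsub>RI\<^esub> c"
      using S.minus_cancel[OF cyS(2) S.m_closed[OF rS cyS(1)]] unfolding ef by (rule sym)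
    then have "y1 = e \<oplus> r \<otimes> c1" by (simp add: cy simps)
    moreover have "e \<in> carrier R" using d ef by (simp add: sx_def ideal_socle_def)
    ultimately have "e \<in> PIdl x" using r c1(1) by (simp add: add_minus_cancel)
    then have "y \<ominus>\<^bsub>RI\<^esub> (r, \<zero>) \<otimes>\<^bsub>RI\<^esub> c \<in> (PIdl x) \<times> T" using d ef by simp
    then show "\<exists>r\<in>carrier RI. y \<ominus>\<^bsub>regular_module RI\<^esub> r \<odot>\<^bsub>regular_module RI\<^esub> c \<in> (PIdl x) \<times> T"
      using rS cyS by (intro bexI[of _ "(r, \<zero>)"]) (simp_all add: S.regular_module_simps S.regular_module_minus)
  qed (use A B C xI_T in \<open>auto simp: S.submodule_regular_iff\<close>)
  moreover have "chain_length {N. submodule N RI (ideal_module RI ((PIdl x) \<times> T)) \<and>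
        {z \<in> carrier (ideal_module RI ((PIdl x) \<times> T)). snd z \<in> xI} \<subseteq> N} =
      chain_length {N. submodule N R (regular_module R) \<and> xI \<subseteq> N \<and> N \<subseteq> T}"
  proof (rule chain_length_correspondence[OF S.ideal_module_module[OF B] regular_module_module, where \<rho> = fst],
      unfold ideal_module_simps regular_module_simps)
    have TR: "t \<in> carrier R" if "t \<in> T" for t using that by (simp add: T_def ideal_socle_def)
    show "fst ` carrier RI = carrier R" using zero_I by (force simp: simps)
    show "submodule xI R (regular_module R)" "submodule T R (regular_module R)"
      using xI_ideal T_ideal by (simp_all add: submodule_regular_iff)
    show "xI \<subseteq> T" by (rule xI_T)
    show "snd z \<in> T" if "z \<in> (PIdl x) \<times> T" for z using that by auto
    show "snd (y \<oplus>\<^bsub>RI\<^esub> z) = snd y \<oplus> snd z" for y z by (cases y, cases z) (simp add: simps)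
    \<comment> \<open>The second component of (r, i)(c, t) is r t + c i, and c i lies in x I because
      c is in (x).\<close>
    show "\<exists>k\<in>xI. snd (a \<otimes>\<^bsub>RI\<^esub> z) = fst a \<otimes> snd z \<oplus> k" if a: "a \<in> carrier RI" and z: "z \<in> (PIdl x) \<times> T" for a z
    proof -
      obtain r i c t where *: "a = (r, i)" "z = (c, t)" by (cases a, cases z)
      then show ?thesis using a z Px_I by (intro bexI[of _ "c \<otimes> i"]) (auto simp: simps)
    qed
    show "\<exists>z\<in>(PIdl x) \<times> T. \<exists>k\<in>xI. w = snd z \<oplus> k" if "w \<in> T" for w
      using that TR idealD(2)[OF Px] idealD(2)[OF xI_ideal]
      by (intro bexI[of _ "(\<zero>, w)"] bexI[of _ \<zero>]) auto
  qed
  moreover have "{z \<in> carrier (ideal_module RI ((PIdl x) \<times> T)). snd z \<in> xI} = (PIdl x) \<times> xI"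
    using xI_T by (auto simp: ideal_module_simps)
  moreover have "{N. submodule N RI (ideal_module RI ((PIdl x) \<times> T)) \<and> (PIdl x) \<times> xI \<subseteq> N} =
      {N. submodule N RI (regular_module RI) \<and> (PIdl x) \<times> xI \<subseteq> N \<and> N \<subseteq> (PIdl x) \<times> T}"
    by (auto simp: S.submodule_ideal_module_iff[OF B] S.submodule_regular_iff)
  ultimately have "ring_type RI = 1 + (1 + artinian_ring_type (R Quot I))"
    using ext mult soc length_T by simp
  also have "\<dots> = 2 + artinian_ring_type (R Quot I)"
    by (simp add: add.assoc[symmetric] one_add_one)
  finally show ?thesis .
qed

end

theorem proposition6p5:
  fixes R :: "('a, 'b) ring_scheme" and I :: "'a set"
  assumes "gorenstein_local_ring TYPE('e) R"
    and "krull_dim R = 1"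
    and "primary_to R (max_ideal R) I"
    and "trace_ideal TYPE('m) R I"
  shows "module_type R (ideal_module R I) = 1 + artinian_ring_type (R Quot I) \<and>
    ring_type (R \<ltimes> ideal_module R I) = 2 + artinian_ring_type (R Quot I)"
proof -
  have R: "noetherian_ring R" "local_ring R" "finite_injective_dimension TYPE('e) R (regular_module R)"
    using assms(1) by (auto simp: gorenstein_local_ring_def)
  obtain E :: "nat \<Rightarrow> ('a, 'e) module" and \<delta> \<epsilon> n
    where "injective_resolution R (regular_module R) E \<delta> \<epsilon>" "\<forall>i>n. carrier (E i) = {\<zero>\<^bsub>E i\<^esub>}"
    using R(3) unfolding finite_injective_dimension_def by blast
  then interpret gorenstein_one R "max_ideal R" E \<delta> \<epsilon> n
    using noetherian_local_max_ideal[OF R(1,2)] assms(2)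
    by (intro gorenstein_one.intro finite_injdim.intro gorenstein_one_axioms.intro
        finite_injdim_axioms.intro) auto
  have I: "ideal I R" "I \<noteq> carrier R" "ideal_radical R I = max_ideal R"
    using assms(3) by (auto simp: primary_to_def primary_ideal_def)
  obtain M :: "('a, 'm) module" where M: "I = trace R M" using assms(4) by (auto simp: trace_ideal_def)
  \<comment> \<open>The radical of I is the maximal ideal, so a power of w lies in I; it is still
    regular and serves as x.\<close>
  obtain w where w: "w \<in> max_ideal R" "regular_element R w" by (rule regular_exists)
  then obtain k :: nat where k: "w [^]\<^bsub>R\<^esub> k \<in> I" using I(3) by (auto simp: ideal_radical_def)
  interpret trace_ideal_setting R "max_ideal R" E \<delta> \<epsilon> n I "w [^]\<^bsub>R\<^esub> k"
  proof (intro trace_ideal_setting.intro trace_ideal_setting_axioms.intro gorenstein_one_axioms)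
    show "ideal I R" by (rule I(1))
    show "I \<subseteq> max_ideal R" by (rule proper_ideal_sub[OF I(1,2)])
    show "w [^]\<^bsub>R\<^esub> k \<in> I" by (rule k)
    show reg: "regular_element R (w [^]\<^bsub>R\<^esub> k)" by (rule regular_power[OF w(2)])
    show "\<exists>l\<in>I. s \<otimes>\<^bsub>R\<^esub> i = w [^]\<^bsub>R\<^esub> k \<otimes>\<^bsub>R\<^esub> l"
      if "s \<in> carrier R" "\<And>i. i \<in> I \<Longrightarrow> s \<otimes>\<^bsub>R\<^esub> i \<in> PIdl\<^bsub>R\<^esub> (w [^]\<^bsub>R\<^esub> k)" "i \<in> I" for s i
      using trace_ideal_stable[OF I(1) M reg that] .
  qed
  show ?thesis using module_type_I ring_type_idealization by simp
qed

end
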